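(* Let $(W,S)$ be a finitely generated Coxeter system, let $\Lambda$ be a graph of groups decomposition of $W$, and let $\Psi$ be a reduced graph of groups decomposition of $W$ such that each vertex group of $\Psi$ is a subgroup of a conjugate (in $W$) of a vertex group of $\Lambda$. Then for each vertex $V$ of $\Lambda$, the vertex group $\Lambda(V)$ has a graph of groups decomposition $\Phi_V$ such that each vertex group of $\Phi_V$ is either (1) conjugate (in $W$) to a vertex group of $\Psi$, or (2) a subgroup of $v\Lambda(E)v^{-1}$ for some $v\in\Lambda(V)$ and some edge $E$ of $\Lambda$ adjacent to $V$.
   Context: A Coxeter system $(W,S)$ is a group $W$ with generating set $S$ having a presentation $\langle S : (st)^{m(s,t)}\ (s,t\in S,\ m(s,t)<\infty)\rangle$, where $m:S^2\to\{1,2,\ldots,\infty\}$, $m(s,t)=m(t,s)$, and $m(s,t)=1$ iff $s=t$; it is finitely generated if $S$ is finite. A graph of groups decomposition of a group $G$ is a graph of groups (in the usual Bass–Serre sense, on a connected graph) whose fundamental group is $G$; its vertex and edge groups are identified with subgroups of $G$. For a Coxeter group the underlying graph of any graph of groups decomposition is a tree, since a Coxeter group has no nontrivial homomorphism to $\mathbb Z$; hence identifications are made so that all edge maps are inclusions, and each edge group $\Lambda(E)$ is a subgroup of the vertex groups at both endpoints of $E$. A graph of groups is reduced if no edge group is equal to its originating vertex group nor has image equal to its terminating vertex group, except possibly for an edge that is a loop at a vertex. *)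

theory Defs
  imports
    "HOL-Algebra.Coset"
    "HOL-Library.Extended_Nat"
    "Graph_Theory.Graph_Theory"
begin

section \<open>Groups given by generators and relators\<close>

text \<open>The letter \<open>(x, True)\<close> stands for the generator \<open>x\<close> and \<open>(x, False)\<close> for its formal inverse.\<close>

type_synonym 'a word = "('a \<times> bool) list"

definition words :: "'a set \<Rightarrow> 'a word set" where
  "words X = lists (X \<times> UNIV)"

inductive_set word_rel :: "'a set \<Rightarrow> 'a word set \<Rightarrow> ('a word \<times> 'a word) set"
  for X :: "'a set" and R :: "'a word set" where
  refl: "w \<in> words X \<Longrightarrow> (w, w) \<in> word_rel X R"
| sym: "(u, v) \<in> word_rel X R \<Longrightarrow> (v, u) \<in> word_rel X R"
| trans: "(u, v) \<in> word_rel X R \<Longrightarrow> (v, w) \<in> word_rel X R \<Longrightarrow> (u, w) \<in> word_rel X R"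
| cancel: "u \<in> words X \<Longrightarrow> v \<in> words X \<Longrightarrow> x \<in> X \<Longrightarrow>
    (u @ [(x, b), (x, \<not> b)] @ v, u @ v) \<in> word_rel X R"
| relator: "u \<in> words X \<Longrightarrow> v \<in> words X \<Longrightarrow> r \<in> R \<Longrightarrow> r \<in> words X \<Longrightarrow>
    (u @ r @ v, u @ v) \<in> word_rel X R"

definition word_class :: "'a set \<Rightarrow> 'a word set \<Rightarrow> 'a word \<Rightarrow> 'a word set" where
  "word_class X R w = word_rel X R `` {w}"

definition presented_group :: "'a set \<Rightarrow> 'a word set \<Rightarrow> 'a word set monoid" where
  "presented_group X R =
    \<lparr> carrier = words X // word_rel X R,
      monoid.mult = (\<lambda>A B. \<Union>a\<in>A. \<Union>b\<in>B. word_class X R (a @ b)),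
      monoid.one = word_class X R [] \<rparr>"

lemma word_rel_words: "(u, v) \<in> word_rel X R \<Longrightarrow> u \<in> words X \<and> v \<in> words X"
  by (induction rule: word_rel.induct) (auto simp: words_def)

lemma equiv_word_rel: "equiv (words X) (word_rel X R)"
proof (rule equivI)
  show "word_rel X R \<subseteq> words X \<times> words X"
    using word_rel_words by auto
  show "refl_on (words X) (word_rel X R)"
    by (rule refl_onI) (rule word_rel.refl)
  show "Relation.sym (word_rel X R)"
    by (rule symI) (rule word_rel.sym)
  show "Relation.trans (word_rel X R)"
    by (rule transI) (rule word_rel.trans)
qed

lemma word_rel_append_right:
  "(u, v) \<in> word_rel X R \<Longrightarrow> w \<in> words X \<Longrightarrow> (u @ w, v @ w) \<in> word_rel X R"
proof (induction rule: word_rel.induct)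
  case (cancel u v x b)
  then show ?case
    using word_rel.cancel[of u X "v @ w" x b R] by (auto simp: words_def)
next
  case (relator u v r)
  then show ?case
    using word_rel.relator[of u X "v @ w" r R] by (auto simp: words_def)
next
  case (refl w)
  then show ?case
    by (auto intro!: word_rel.refl simp: words_def)
qed (blast intro: word_rel.sym word_rel.trans)+

lemma word_rel_append_left:
  "(u, v) \<in> word_rel X R \<Longrightarrow> w \<in> words X \<Longrightarrow> (w @ u, w @ v) \<in> word_rel X R"
proof (induction rule: word_rel.induct)
  case (cancel u v x b)
  then show ?case
    using word_rel.cancel[of "w @ u" X v x b R] by (auto simp: words_def)
next
  case (relator u v r)
  then show ?case
    using word_rel.relator[of "w @ u" X v r R] by (auto simp: words_def)
next
  case (refl w)
  then show ?case
    by (auto intro!: word_rel.refl simp: words_def)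
qed (blast intro: word_rel.sym word_rel.trans)+

lemma word_rel_append:
  assumes "(u, u') \<in> word_rel X R" "(v, v') \<in> word_rel X R"
  shows "(u @ v, u' @ v') \<in> word_rel X R"
proof (rule word_rel.trans)
  show "(u @ v, u' @ v) \<in> word_rel X R"
    using assms word_rel_words by (blast intro: word_rel_append_right)
  show "(u' @ v, u' @ v') \<in> word_rel X R"
    using assms word_rel_words by (blast intro: word_rel_append_left)
qed

lemma word_class_eq_iff:
  assumes "u \<in> words X" "v \<in> words X"
  shows "word_class X R u = word_class X R v \<longleftrightarrow> (u, v) \<in> word_rel X R"
  unfolding word_class_def using assms eq_equiv_class_iff[OF equiv_word_rel] by metis

lemma carrier_presented_group:
  "carrier (presented_group X R) = word_class X R ` words X"
  by (auto simp: presented_group_def quotient_def word_class_def)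

lemma one_presented_group: "\<one>\<^bsub>presented_group X R\<^esub> = word_class X R []"
  by (simp add: presented_group_def)

lemma mult_presented_group:
  assumes "u \<in> words X" "v \<in> words X"
  shows "word_class X R u \<otimes>\<^bsub>presented_group X R\<^esub> word_class X R v = word_class X R (u @ v)"
proof -
  have "word_class X R (a @ b) = word_class X R (u @ v)"
    if "a \<in> word_class X R u" "b \<in> word_class X R v" for a b
  proof -
    have "(u @ v, a @ b) \<in> word_rel X R"
      using that by (auto simp: word_class_def intro: word_rel_append)
    then show ?thesis
      using word_rel_words word_class_eq_iff by blast
  qed
  moreover have "u \<in> word_class X R u" "v \<in> word_class X R v"
    using assms by (auto simp: word_class_def intro: word_rel.refl)
  ultimately have "(\<Union>a\<in>word_class X R u. \<Union>b\<in>word_class X R v. word_class X R (a @ b)) =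
      word_class X R (u @ v)"
    by blast
  then show ?thesis
    by (simp add: presented_group_def)
qed

lemma word_inverse_cancel:
  "w \<in> words X \<Longrightarrow>
    (rev (map (\<lambda>(x, b). (x, \<not> b)) w) @ w, []) \<in> word_rel X R"
proof (induction w)
  case Nil
  then show ?case by (auto intro: word_rel.refl)
next
  case (Cons l w)
  obtain x b where l: "l = (x, b)" by force
  let ?w' = "rev (map (\<lambda>(x, b). (x, \<not> b)) w)"
  have w: "w \<in> words X" "x \<in> X" "?w' \<in> words X"
    using Cons.prems l by (auto simp: words_def)
  have "(?w' @ [(x, \<not> b), (x, \<not> \<not> b)] @ w, ?w' @ w) \<in> word_rel X R"
    using w by (intro word_rel.cancel)
  then show ?case
    using word_rel.trans[OF _ Cons.IH[OF w(1)]] l by simp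
qed

lemma group_presented_group: "group (presented_group X R)"
proof (rule groupI)
  have Nil: "[] \<in> words X" by (simp add: words_def)
  have app: "u @ v \<in> words X" if "u \<in> words X" "v \<in> words X" for u v
    using that by (simp add: words_def)
  show "\<one>\<^bsub>presented_group X R\<^esub> \<in> carrier (presented_group X R)"
    using Nil by (simp add: one_presented_group carrier_presented_group)
  fix A assume "A \<in> carrier (presented_group X R)"
  then obtain a where a: "a \<in> words X" "A = word_class X R a"
    by (auto simp: carrier_presented_group)
  show "\<one>\<^bsub>presented_group X R\<^esub> \<otimes>\<^bsub>presented_group X R\<^esub> A = A"
    using a Nil by (simp add: one_presented_group mult_presented_group)
  let ?a' = "rev (map (\<lambda>(x, b). (x, \<not> b)) a)"
  have a': "?a' \<in> words X"
    using a by (auto simp: words_def)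
  have "word_class X R ?a' \<otimes>\<^bsub>presented_group X R\<^esub> A = \<one>\<^bsub>presented_group X R\<^esub>"
    using a a' Nil app word_inverse_cancel[OF a(1), of R]
    by (simp add: one_presented_group mult_presented_group word_class_eq_iff)
  then show "\<exists>B\<in>carrier (presented_group X R).
      B \<otimes>\<^bsub>presented_group X R\<^esub> A = \<one>\<^bsub>presented_group X R\<^esub>"
    using a' by (auto simp: carrier_presented_group)
  fix B assume "B \<in> carrier (presented_group X R)"
  then obtain b where b: "b \<in> words X" "B = word_class X R b"
    by (auto simp: carrier_presented_group)
  show "A \<otimes>\<^bsub>presented_group X R\<^esub> B \<in> carrier (presented_group X R)"
    using a b app by (simp add: mult_presented_group carrier_presented_group)
  fix C assume "C \<in> carrier (presented_group X R)"
  then obtain c where c: "c \<in> words X" "C = word_class X R c"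
    by (auto simp: carrier_presented_group)
  show "A \<otimes>\<^bsub>presented_group X R\<^esub> B \<otimes>\<^bsub>presented_group X R\<^esub> C =
      A \<otimes>\<^bsub>presented_group X R\<^esub> (B \<otimes>\<^bsub>presented_group X R\<^esub> C)"
    using a b c app by (simp add: mult_presented_group)
qed


section \<open>Coxeter systems\<close>

definition coxeter_relators :: "'g set \<Rightarrow> ('g \<Rightarrow> 'g \<Rightarrow> enat) \<Rightarrow> 'g word set" where
  "coxeter_relators S m =
    {concat (replicate k [(s, True), (t, True)]) | s t k. s \<in> S \<and> t \<in> S \<and> m s t = enat k}"

definition coxeter_system :: "'g monoid \<Rightarrow> 'g set \<Rightarrow> bool" where
  "coxeter_system W S \<longleftrightarrow> group W \<and> S \<subseteq> carrier W \<and>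
    (\<exists>m. (\<forall>s\<in>S. \<forall>t\<in>S. 1 \<le> m s t \<and> m s t = m t s \<and> (m s t = 1 \<longleftrightarrow> s = t)) \<and>
      (\<exists>\<phi> \<in> iso (presented_group S (coxeter_relators S m)) W.
        \<forall>s\<in>S. \<phi> (word_class S (coxeter_relators S m) [(s, True)]) = s))"


section \<open>Graphs of groups\<close>

text \<open>
  The underlying graph is a graph in the sense of Serre: the two orientations of a geometric edge
  are distinct arcs \<open>e\<close> and \<open>arev \<G> e\<close>, also for loops.
  The monomorphism \<open>emb \<G> e\<close> maps the edge group into the vertex group at the head of \<open>e\<close>;
  the one into the vertex group at the tail is \<open>emb \<G> (arev \<G> e)\<close>.
\<close>

record ('v, 'e, 'x, 'y) graph_of_groups =
  base :: "('v, 'e) pre_digraph"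
  arev :: "'e \<Rightarrow> 'e"
  vgroup :: "'v \<Rightarrow> 'x monoid"
  egroup :: "'e \<Rightarrow> 'y monoid"
  emb :: "'e \<Rightarrow> 'y \<Rightarrow> 'x"

definition wf_graph_of_groups :: "('v, 'e, 'x, 'y, 'z) graph_of_groups_scheme \<Rightarrow> bool" where
  "wf_graph_of_groups \<G> \<longleftrightarrow>
    bidirected_digraph (base \<G>) (arev \<G>) \<and> connected (base \<G>) \<and>
    (\<forall>v\<in>verts (base \<G>). group (vgroup \<G> v)) \<and>
    (\<forall>e\<in>arcs (base \<G>). group (egroup \<G> e) \<and> egroup \<G> (arev \<G> e) = egroup \<G> e \<and>
      emb \<G> e \<in> mon (egroup \<G> e) (vgroup \<G> (head (base \<G>) e)))"

definition reduced_graph_of_groups :: "('v, 'e, 'x, 'y, 'z) graph_of_groups_scheme \<Rightarrow> bool" where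
  "reduced_graph_of_groups \<G> \<longleftrightarrow>
    (\<forall>e\<in>arcs (base \<G>). tail (base \<G>) e \<noteq> head (base \<G>) e \<longrightarrow>
      emb \<G> (arev \<G> e) ` carrier (egroup \<G> e) \<noteq> carrier (vgroup \<G> (tail (base \<G>) e)) \<and>
      emb \<G> e ` carrier (egroup \<G> e) \<noteq> carrier (vgroup \<G> (head (base \<G>) e)))"

text \<open>
  Maximal trees are given by their sets of arcs. The predicates \<^const>\<open>tree\<close> and
  \<^const>\<open>spanning_tree\<close> of the library exclude directed cycles, and in a bidirected graph
  \<open>[e, arev \<G> e]\<close> is one for every non-loop \<open>e\<close>; so these cycles have to be admitted here.
\<close>

definition maximal_tree :: "('v, 'e, 'x, 'y, 'z) graph_of_groups_scheme \<Rightarrow> 'e set \<Rightarrow> bool" where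
  "maximal_tree \<G> T \<longleftrightarrow>
    T \<subseteq> arcs (base \<G>) \<and> arev \<G> ` T \<subseteq> T \<and> connected ((base \<G>)\<lparr>arcs := T\<rparr>) \<and>
    (\<forall>p. pre_digraph.cycle ((base \<G>)\<lparr>arcs := T\<rparr>) p \<longrightarrow> (\<exists>e. p = [e, arev \<G> e]))"


section \<open>The fundamental group of a graph of groups\<close>

datatype ('v, 'e, 'x) generator = Vtx 'v 'x | Edg 'e

definition fg_generators ::
    "('v, 'e, 'x, 'y, 'z) graph_of_groups_scheme \<Rightarrow> ('v, 'e, 'x) generator set" where
  "fg_generators \<G> =
    {Vtx v x | v x. v \<in> verts (base \<G>) \<and> x \<in> carrier (vgroup \<G> v)} \<union> Edg ` arcs (base \<G>)"

text \<open>
  The relators say, in this order, that each vertex group maps homomorphically, that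
  the letters of \<open>e\<close> and \<open>arev \<G> e\<close> are inverse to each other, that conjugation by the letter
  of \<open>e\<close> carries the image of the edge group at the head of \<open>e\<close> to its image at the tail,
  and that the letters of the arcs in the maximal tree are trivial.
\<close>

definition fg_relators ::
    "('v, 'e, 'x, 'y, 'z) graph_of_groups_scheme \<Rightarrow> 'e set \<Rightarrow> ('v, 'e, 'x) generator word set" where
  "fg_relators \<G> T =
    {[(Vtx v x, True), (Vtx v y, True), (Vtx v (x \<otimes>\<^bsub>vgroup \<G> v\<^esub> y), False)] | v x y.
        v \<in> verts (base \<G>) \<and> x \<in> carrier (vgroup \<G> v) \<and> y \<in> carrier (vgroup \<G> v)} \<union>
    {[(Edg e, True), (Edg (arev \<G> e), True)] | e. e \<in> arcs (base \<G>)} \<union>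
    {[(Edg e, True), (Vtx (head (base \<G>) e) (emb \<G> e a), True), (Edg e, False),
      (Vtx (tail (base \<G>) e) (emb \<G> (arev \<G> e) a), False)] | e a.
        e \<in> arcs (base \<G>) \<and> a \<in> carrier (egroup \<G> e)} \<union>
    {[(Edg e, True)] | e. e \<in> T}"

definition fundamental_group ::
    "('v, 'e, 'x, 'y, 'z) graph_of_groups_scheme \<Rightarrow> 'e set \<Rightarrow>
      ('v, 'e, 'x) generator word set monoid" where
  "fundamental_group \<G> T = presented_group (fg_generators \<G>) (fg_relators \<G> T)"


section \<open>Graph of groups decompositions\<close>

text \<open>
  A decomposition of \<open>G\<close> comes with an identification of the fundamental group (with respect to
  a maximal tree) with \<open>G\<close>. Through it the vertex and edge groups become subgroups of \<open>G\<close>.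
  The types of vertices and arcs only provide names. For a decomposition of a subgroup \<open>H\<close> of \<open>G\<close>
  induced by the action of \<open>H\<close> on the Bass-Serre tree of a decomposition of \<open>G\<close>, pairs of an
  element of \<open>G\<close> and a vertex (arc) suffice as names for the orbits of \<open>H\<close> on vertices (arcs).
\<close>

record ('v, 'e, 'x, 'y, 'g) decomposition = "('v, 'e, 'x, 'y) graph_of_groups" +
  mtree :: "'e set"
  ident :: "('v, 'e, 'x) generator word set \<Rightarrow> 'g"

definition graph_of_groups_decomposition ::
    "'g monoid \<Rightarrow> ('v, 'e, 'x, 'y, 'g) decomposition \<Rightarrow> bool" where
  "graph_of_groups_decomposition G \<Lambda> \<longleftrightarrow>
    wf_graph_of_groups \<Lambda> \<and> maximal_tree \<Lambda> (mtree \<Lambda>) \<and>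
    ident \<Lambda> \<in> iso (fundamental_group \<Lambda> (mtree \<Lambda>)) G"

definition vertex_element :: "('v, 'e, 'x, 'y, 'g) decomposition \<Rightarrow> 'v \<Rightarrow> 'x \<Rightarrow> 'g" where
  "vertex_element \<Lambda> v x =
    ident \<Lambda> (word_class (fg_generators \<Lambda>) (fg_relators \<Lambda> (mtree \<Lambda>)) [(Vtx v x, True)])"

definition vertex_group :: "('v, 'e, 'x, 'y, 'g) decomposition \<Rightarrow> 'v \<Rightarrow> 'g set" where
  "vertex_group \<Lambda> v = vertex_element \<Lambda> v ` carrier (vgroup \<Lambda> v)"

text \<open>
  The edge group is embedded through the vertex group at the head of \<open>e\<close>. If \<open>e\<close> is in the maximal
  tree, in particular if the graph is a tree, then \<open>e\<close> and \<open>arev \<Lambda> e\<close> give the same subgroup.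
\<close>

definition edge_group :: "('v, 'e, 'x, 'y, 'g) decomposition \<Rightarrow> 'e \<Rightarrow> 'g set" where
  "edge_group \<Lambda> e =
    (\<lambda>a. vertex_element \<Lambda> (head (base \<Lambda>) e) (emb \<Lambda> e a)) ` carrier (egroup \<Lambda> e)"

definition conjugate :: "'g monoid \<Rightarrow> 'g \<Rightarrow> 'g set \<Rightarrow> 'g set" where
  "conjugate G g H = g <#\<^bsub>G\<^esub> H #>\<^bsub>G\<^esub> inv\<^bsub>G\<^esub> g"

text \<open>
  An arc adjacent to a vertex may be taken to have its head there, since every geometric edge
  occurs with both orientations.
\<close>

definition adjacent_edges :: "('v, 'e, 'x, 'y, 'z) graph_of_groups_scheme \<Rightarrow> 'v \<Rightarrow> 'e set" where
  "adjacent_edges \<G> v = {e \<in> arcs (base \<G>). head (base \<G>) e = v}"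

end

theory Submission
  imports Defs
begin

text \<open>
  Let \<open>H = \<Lambda>(V)\<close> act on the Bass-Serre tree of \<open>\<Psi>\<close>. By the structure theorem for groups acting on
  trees, \<open>H\<close> is the fundamental group of a graph of groups on the quotient graph, whose vertex
  groups are the intersections of \<open>H\<close> with conjugates \<open>K\<close> of vertex groups of \<open>\<Psi>\<close>. Every such \<open>K\<close>
  fixes a vertex of the Bass-Serre tree of \<open>\<Lambda>\<close>. If this is the vertex with stabilizer \<open>H\<close>, then
  \<open>K \<subseteq> H\<close> and the vertex group is \<open>K\<close>. Otherwise \<open>H \<inter> K\<close> fixes two vertices, hence the first edge on
  the path between them, whose stabilizer is conjugate in \<open>H\<close> to a group of an edge adjacent
  to \<open>V\<close>.
\<close>

section \<open>Trees in the sense of Serre\<close>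

text \<open>Bass-Serre theory is derived here from the presentation itself. Its two hard points are
  usually settled by normal forms of words; here both are settled by integrating labels. That the
  coset graph is a tree amounts to having, for each geometric edge, a function on the vertices that
  changes exactly across this edge. Crossings counted modulo 2 form a crossed homomorphism, well
  defined as soon as every relator contributes zero. That the fundamental group of the quotient maps
  injectively to the acting group calls for a map back. On a tree, labels of arcs by elements of any
  group, inverse to each other on reversed arcs, come from a function on the vertices; suitable
  labels in the abstract fundamental group yield this map. The tree acted on and the set of orbits
  may be infinite, so the lift of a maximal tree of the quotient comes from Zorn's lemma.\<close>

lemma (in wf_digraph) connectedI_closed:
  assumes "x \<in> verts G"
    and "\<And>P y. P x \<Longrightarrow> (\<And>f. f \<in> arcs G \<Longrightarrow> P (tail G f) \<longleftrightarrow> P (head G f)) \<Longrightarrow> y \<in> verts G \<Longrightarrow> P y"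
  shows "connected G"
proof -
  let ?R = "rtrancl_on (verts G) ((arcs_ends G)\<^sup>s)"
  have ends: "(tail G f, head G f) \<in> (arcs_ends G)\<^sup>s" "(head G f, tail G f) \<in> (arcs_ends G)\<^sup>s"
    if "f \<in> arcs G" for f
    using that by (auto simp: symcl_def arcs_ends_conv image_iff)
  have reach: "(x, y) \<in> ?R" if "y \<in> verts G" for y
  proof (rule assms(2)[of "\<lambda>y. (x, y) \<in> ?R"])
    show "(x, x) \<in> ?R" using assms(1) by blast
    show "(x, tail G f) \<in> ?R \<longleftrightarrow> (x, head G f) \<in> ?R" if "f \<in> arcs G" for f
      using ends[OF that] that rtrancl_on_into_rtrancl_on[of x _ "verts G" "(arcs_ends G)\<^sup>s"]
      by (meson head_in_verts tail_in_verts)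
  qed (use that in auto)
  have "sym ?R"
    by (rule rtrancl_on_sym) (auto simp: symcl_def sym_def)
  then have "(u, v) \<in> ?R" if "u \<in> verts G" "v \<in> verts G" for u v
    using reach[OF that(1)] reach[OF that(2)] by (meson rtrancl_on_trans symE)
  then show ?thesis
    using assms(1) by (auto simp: connected_conv)
qed

text \<open>Connectedness in the form of an induction principle. As \<open>connectedI_closed\<close>
  is its converse, connectedness is proved in the same style, without constructing walks.\<close>

lemma (in wf_digraph) connected_induct:
  assumes "connected G" "x \<in> verts G" "P x"
    and "\<And>f. f \<in> arcs G \<Longrightarrow> P (tail G f) \<longleftrightarrow> P (head G f)" "y \<in> verts G"
  shows "P y"
proof -
  have "(x, y) \<in> rtrancl_on (verts G) ((arcs_ends G)\<^sup>s)"
    using assms by (auto simp: connected_conv)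
  then show ?thesis
  proof (induction rule: rtrancl_on_induct)
    case (step y z)
    then show ?case using assms(4) by (auto simp: symcl_def arcs_ends_conv)
  qed (rule assms(3))
qed

text \<open>Requiring that each geometric edge separates the vertices into two sides is a way of
  excluding circuits that avoids reduced walks.\<close>

locale serre_tree = bidirected_digraph G rv for G :: "('a, 'b) pre_digraph" and rv +
  assumes connected: "connected G"
    and sides: "f \<in> arcs G \<Longrightarrow>
      \<exists>\<sigma>. \<forall>f'\<in>arcs G. (\<sigma> (tail G f') \<noteq> (\<sigma> (head G f') :: bool)) \<longleftrightarrow> f' = f \<or> f' = rv f"
begin

text \<open>\<open>connected\<close> speaks of undirected reachability; directed walks exist because
  \<open>rv\<close> turns any arc around.\<close>

lemma reachable: "x \<in> verts G \<Longrightarrow> y \<in> verts G \<Longrightarrow> \<exists>p. awalk x p y"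
proof (rule connected_induct[OF connected, of x "\<lambda>y. \<exists>p. awalk x p y"])
  assume x: "x \<in> verts G"
  then show "\<exists>p. awalk x p x" using awalk_Nil_iff by blast
  have ext: "\<exists>p. awalk x p (head G f)" if "f \<in> arcs G" "\<exists>p. awalk x p (tail G f)" for f
  proof -
    from that obtain p where "awalk x p (tail G f)" by blast
    moreover have "awalk (tail G f) [f] (head G f)" using that arc_implies_awalk by blast
    ultimately show ?thesis using awalk_appendI by blast
  qed
  show "(\<exists>p. awalk x p (tail G f)) \<longleftrightarrow> (\<exists>p. awalk x p (head G f))" if "f \<in> arcs G" for f
    using ext[OF that] ext[of "rv f"] that by auto
qed

section \<open>Distance from a root and parent arcs\<close>

definition depth :: "'a \<Rightarrow> 'a \<Rightarrow> nat" where
  "depth x y = (LEAST n. \<exists>p. awalk x p y \<and> length p = n)"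

lemma depth_le: "awalk x p y \<Longrightarrow> depth x y \<le> length p"
  unfolding depth_def by (rule Least_le) blast

lemma shortest:
  assumes "x \<in> verts G" "y \<in> verts G"
  obtains p where "awalk x p y" "length p = depth x y"
proof -
  have "\<exists>n p. awalk x p y \<and> length p = n" using reachable[OF assms] by blast
  then have "\<exists>p. awalk x p y \<and> length p = depth x y"
    unfolding depth_def by (rule LeastI_ex)
  then show ?thesis using that by blast
qed

lemma depth_self: "x \<in> verts G \<Longrightarrow> depth x x = 0"
  using depth_le[of x "[]" x] by (simp add: awalk_Nil_iff)

lemma depth_eq_0: "x \<in> verts G \<Longrightarrow> y \<in> verts G \<Longrightarrow> depth x y = 0 \<longleftrightarrow> x = y"
  by (metis awalk_Nil_iff depth_self length_0_conv shortest)

lemma depth_walk_arc: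
  assumes "awalk x p y" "a \<in> set p"
  shows "depth x (tail G a) < length p" "depth x (head G a) \<le> length p"
proof -
  obtain q r where p: "p = q @ a # r" using split_list[OF assms(2)] by blast
  have w: "awalk x q (tail G a)" "awalk x (q @ [a]) (head G a)"
    using assms(1) p by (auto simp: awalk_Cons_iff arc_implies_awalk awalk_Nil_iff)
  show "depth x (tail G a) < length p" "depth x (head G a) \<le> length p"
    using depth_le[OF w(1)] depth_le[OF w(2)] p by auto
qed

lemma side_walk:
  assumes "awalk x p y" "f \<notin> set p" "rv f \<notin> set p"
    "\<forall>f'\<in>arcs G. (\<sigma> (tail G f') \<noteq> (\<sigma> (head G f') :: bool)) \<longleftrightarrow> f' = f \<or> f' = rv f"
  shows "\<sigma> x = \<sigma> y"
  using assms(1-3)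
proof (induction p arbitrary: x)
  case (Cons a p)
  then have "awalk (head G a) p y" "tail G a = x" "a \<in> arcs G" by (auto simp: awalk_Cons_iff)
  with Cons assms(4) show ?case by (metis list.set_intros)
qed (simp add: awalk_Nil_iff)

text \<open>A tree is bipartite: if the ends of \<open>f\<close> had equal depth, shortest walks to
  them could use neither \<open>f\<close> nor its reverse, so both ends would lie on the side of
  \<open>x\<close>, although \<open>f\<close> separates them.\<close>

lemma depth_arc:
  assumes x: "x \<in> verts G" and f: "f \<in> arcs G"
  shows "depth x (head G f) = Suc (depth x (tail G f)) \<or> depth x (tail G f) = Suc (depth x (head G f))"
proof -
  have le: "depth x (head G f) \<le> Suc (depth x (tail G f))" if f: "f \<in> arcs G" for f
  proof -
    obtain p where "awalk x p (tail G f)" "length p = depth x (tail G f)"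
      using shortest x f by (metis tail_in_verts)
    moreover from this f have "awalk x (p @ [f]) (head G f)"
      by (auto simp: awalk_Cons_iff awalk_Nil_iff)
    ultimately show ?thesis using depth_le[of x "p @ [f]" "head G f"] by simp
  qed
  obtain p where p: "awalk x p (tail G f)" "length p = depth x (tail G f)"
    using shortest x f by (metis tail_in_verts)
  obtain q where q: "awalk x q (head G f)" "length q = depth x (head G f)"
    using shortest x f by (metis head_in_verts)
  obtain \<sigma> where \<sigma>: "\<forall>f'\<in>arcs G. (\<sigma> (tail G f') \<noteq> (\<sigma> (head G f') :: bool)) \<longleftrightarrow> f' = f \<or> f' = rv f"
    using sides[OF f] by blast
  have "f \<in> set p \<or> rv f \<in> set p \<or> f \<in> set q \<or> rv f \<in> set q"
    using side_walk[OF p(1) _ _ \<sigma>] side_walk[OF q(1) _ _ \<sigma>] \<sigma> f by metis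
  then have "depth x (head G f) \<noteq> depth x (tail G f)"
    using depth_walk_arc[OF p(1), of f] depth_walk_arc[OF p(1), of "rv f"]
      depth_walk_arc[OF q(1), of f] depth_walk_arc[OF q(1), of "rv f"] p(2) q(2) f by auto
  moreover have "depth x (tail G f) \<le> Suc (depth x (head G f))"
    using le[of "rv f"] f by simp
  ultimately show ?thesis using le[OF f] by linarith
qed

lemma parent_exists:
  assumes x: "x \<in> verts G" and y: "y \<in> verts G" and ne: "x \<noteq> y"
  shows "\<exists>f\<in>arcs G. head G f = y \<and> depth x y = Suc (depth x (tail G f))"
proof -
  obtain p where p: "awalk x p y" "length p = depth x y" using shortest x y by metis
  have "p \<noteq> []" using p ne by (auto simp: awalk_Nil_iff)
  then obtain q f where q: "p = q @ [f]" by (metis rev_exhaust)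
  then have "awalk x q (tail G f)" "f \<in> arcs G" "head G f = y"
    using p by (auto simp: awalk_Cons_iff awalk_Nil_iff)
  moreover from this have "depth x y = Suc (depth x (tail G f))"
    using depth_le[of x q "tail G f"] depth_arc[OF x, of f] p q by auto
  ultimately show ?thesis by blast
qed

text \<open>Shortest walks to the two tails are too short to meet \<open>f\<close>, so both tails
  lie on the side of \<open>x\<close>. A second arc into \<open>y\<close> would put \<open>y\<close>
  on this side too, but \<open>f\<close> separates its tail from \<open>y\<close>.\<close>

lemma parent_unique:
  assumes x: "x \<in> verts G" and f: "f \<in> arcs G" "f' \<in> arcs G" and h: "head G f = y" "head G f' = y"
    and d: "depth x y = Suc (depth x (tail G f))" "depth x y = Suc (depth x (tail G f'))"
  shows "f = f'"
proof (rule ccontr)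
  assume ne: "f \<noteq> f'"
  obtain p where p: "awalk x p (tail G f)" "length p = depth x (tail G f)"
    using shortest x f by (metis tail_in_verts)
  obtain p' where p': "awalk x p' (tail G f')" "length p' = depth x (tail G f')"
    using shortest x f by (metis tail_in_verts)
  obtain \<sigma> where \<sigma>: "\<forall>f'\<in>arcs G. (\<sigma> (tail G f') \<noteq> (\<sigma> (head G f') :: bool)) \<longleftrightarrow> f' = f \<or> f' = rv f"
    using sides[OF f(1)] by blast
  have off: "f \<notin> set q \<and> rv f \<notin> set q" if "awalk x q z" "length q < depth x y" for q z
    using depth_walk_arc[OF that(1), of f] depth_walk_arc[OF that(1), of "rv f"] that f h by auto
  have "\<sigma> x = \<sigma> (tail G f)" "\<sigma> x = \<sigma> (tail G f')"
    using off[OF p(1)] off[OF p'(1)] p(2) p'(2) d side_walk[OF p(1) _ _ \<sigma>] side_walk[OF p'(1) _ _ \<sigma>]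
    by auto
  moreover have "f' \<noteq> rv f"
  proof
    assume "f' = rv f"
    then have "tail G f' = y" using f h by simp
    then show False using d(2) by (metis n_not_Suc_n)
  qed
  then have "\<sigma> (tail G f') = \<sigma> y" "\<sigma> (tail G f) \<noteq> \<sigma> y" using \<sigma> f h ne by metis+
  ultimately show False by simp
qed

text \<open>Since a tree is simply connected, labels can be multiplied up along the paths from a
  root. This is applied modulo 2 to a maximal tree, and with values in the fundamental group of the
  quotient to the tree acted on.\<close>

lemma potential_exists:
  assumes A: "group A" and lab: "\<And>f. f \<in> arcs G \<Longrightarrow> lab f \<in> carrier A"
    and lab_rv: "\<And>f. f \<in> arcs G \<Longrightarrow> lab f \<otimes>\<^bsub>A\<^esub> lab (rv f) = \<one>\<^bsub>A\<^esub>"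
  shows "\<exists>c. (\<forall>v\<in>verts G. c v \<in> carrier A) \<and>
    (\<forall>f\<in>arcs G. c (head G f) = c (tail G f) \<otimes>\<^bsub>A\<^esub> lab f)"
proof -
  interpret A: group A by fact
  obtain x where x: "x \<in> verts G" using connected by (auto simp: connected_conv)
  define par where
    "par y = (SOME f. f \<in> arcs G \<and> head G f = y \<and> depth x y = Suc (depth x (tail G f)))" for y
  have par: "par y \<in> arcs G" "head G (par y) = y" "depth x y = Suc (depth x (tail G (par y)))"
    if "y \<in> verts G" "depth x y = Suc n" for y n
  proof -
    have "\<exists>f. f \<in> arcs G \<and> head G f = y \<and> depth x y = Suc (depth x (tail G f))"
      using parent_exists[OF x that(1)] depth_self[OF x] that by (metis nat.distinct(1))
    from someI_ex[OF this] show "par y \<in> arcs G" "head G (par y) = y"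
      "depth x y = Suc (depth x (tail G (par y)))" unfolding par_def by auto
  qed
  have par_eq: "par (head G f) = f"
    if "f \<in> arcs G" "depth x (head G f) = Suc (depth x (tail G f))" for f
    using par[of "head G f"] parent_unique[OF x, of "par (head G f)" f] that by auto
  \<comment> \<open>The argument \<open>n\<close> stands for the depth, which makes the recursion
    along parent arcs primitive; only the values \<open>cn (depth x y) y\<close> matter.\<close>
  define cn where "cn = rec_nat (\<lambda>y. \<one>\<^bsub>A\<^esub>) (\<lambda>n g y. g (tail G (par y)) \<otimes>\<^bsub>A\<^esub> lab (par y))"
  define c where "c y = cn (depth x y) y" for y
  have cn_closed: "cn n y \<in> carrier A" if "y \<in> verts G" "depth x y = n" for n y
    using that
  proof (induction n arbitrary: y)
    case (Suc n)
    then have "depth x (tail G (par y)) = n" using par(3) by fastforce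
    then show ?case using Suc par[OF Suc.prems] by (simp add: cn_def lab)
  qed (simp add: cn_def)
  have c_closed: "c y \<in> carrier A" if "y \<in> verts G" for y
    using cn_closed that by (simp add: c_def)
  have step: "c (head G f) = c (tail G f) \<otimes>\<^bsub>A\<^esub> lab f"
    if "f \<in> arcs G" "depth x (head G f) = Suc (depth x (tail G f))" for f
    using that par_eq[OF that] by (simp add: c_def cn_def)
  \<comment> \<open>Every arc points away from the root or is the reverse of one that does.\<close>
  have "c (head G f) = c (tail G f) \<otimes>\<^bsub>A\<^esub> lab f" if f: "f \<in> arcs G" for f
  proof (cases "depth x (head G f) = Suc (depth x (tail G f))")
    case False
    then have "c (tail G f) = c (head G f) \<otimes>\<^bsub>A\<^esub> lab (rv f)"
      using step[of "rv f"] depth_arc[OF x f] f by simp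
    moreover have "lab (rv f) \<otimes>\<^bsub>A\<^esub> lab f = \<one>\<^bsub>A\<^esub>"
      using lab_rv[of "rv f"] f by simp
    ultimately show ?thesis
      using lab[OF f] lab[of "rv f"] c_closed[of "head G f"] f by (simp add: A.m_assoc)
  qed (simp add: step f)
  then show ?thesis using c_closed by blast
qed

text \<open>Booleans under exclusive or are the group of order two, where labels inverse on reversed
  arcs are the same as symmetric labels.\<close>

lemma bool_potential_exists:
  assumes "\<And>f. f \<in> arcs G \<Longrightarrow> lab (rv f) = (lab f :: bool)"
  shows "\<exists>c. \<forall>f\<in>arcs G. c (head G f) = (c (tail G f) \<noteq> lab f)"
proof -
  let ?A = "\<lparr>carrier = UNIV, monoid.mult = (\<noteq>), one = False\<rparr> :: bool monoid"
  have "group ?A" by (rule groupI) auto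
  from potential_exists[OF this, of lab] assms show ?thesis by auto
qed

end

section \<open>Words and presentations\<close>

definition wval :: "('g, 'm) monoid_scheme \<Rightarrow> ('a \<Rightarrow> 'g) \<Rightarrow> 'a word \<Rightarrow> 'g" where
  "wval G f w = foldr (\<lambda>(x, b) g. (if b then f x else inv\<^bsub>G\<^esub> f x) \<otimes>\<^bsub>G\<^esub> g) w \<one>\<^bsub>G\<^esub>"

lemma words_simps [simp]:
  "[] \<in> words X" "(x, b) # w \<in> words X \<longleftrightarrow> x \<in> X \<and> w \<in> words X"
  "u @ v \<in> words X \<longleftrightarrow> u \<in> words X \<and> v \<in> words X"
  by (auto simp: words_def)

context group
begin

lemma wval_simps [simp]:
  "wval G f [] = \<one>"
  "wval G f ((x, b) # w) = (if b then f x else inv (f x)) \<otimes> wval G f w"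
  by (simp_all add: wval_def)

lemma wval_closed [simp]: "f \<in> X \<rightarrow> carrier G \<Longrightarrow> w \<in> words X \<Longrightarrow> wval G f w \<in> carrier G"
  by (induction w) (auto simp: Pi_iff)

lemma wval_append:
  assumes "f \<in> X \<rightarrow> carrier G" "u \<in> words X" "v \<in> words X"
  shows "wval G f (u @ v) = wval G f u \<otimes> wval G f v"
  using assms
proof (induction u)
  case (Cons l u)
  then show ?case by (cases l) (auto simp: m_assoc Pi_iff)
qed auto

lemma wval_word_rel:
  assumes f: "f \<in> X \<rightarrow> carrier G" and R: "\<And>r. r \<in> R \<Longrightarrow> r \<in> words X \<Longrightarrow> wval G f r = \<one>"
  shows "(u, v) \<in> word_rel X R \<Longrightarrow> wval G f u = wval G f v"
proof (induction rule: word_rel.induct)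
  case (cancel u v x b)
  then show ?case using f
    by (cases b) (auto simp: wval_append[OF f] m_assoc[symmetric] Pi_iff)
next
  case (relator u v r)
  then show ?case using f R by (simp add: wval_append[OF f])
qed auto

text \<open>Elements of a presented group are classes, so evaluation picks a word; the assumptions
  of the next context make the value independent of the pick.\<close>

definition class_val :: "('x \<Rightarrow> 'a) \<Rightarrow> 'x word set \<Rightarrow> 'a" where
  "class_val f A = wval G f (SOME w. w \<in> A)"

context
  fixes f :: "'x \<Rightarrow> 'a" and X :: "'x set" and R :: "'x word set"
  assumes f: "f \<in> X \<rightarrow> carrier G" and R: "\<And>r. r \<in> R \<Longrightarrow> r \<in> words X \<Longrightarrow> wval G f r = \<one>"
begin

lemma class_val_word_class:
  assumes "w \<in> words X" shows "class_val f (word_class X R w) = wval G f w"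
proof -
  have "w \<in> word_class X R w" using assms by (auto simp: word_class_def intro: word_rel.refl)
  then have "(SOME w'. w' \<in> word_class X R w) \<in> word_class X R w" by (rule someI)
  then have "(w, SOME w'. w' \<in> word_class X R w) \<in> word_rel X R"
    by (simp add: word_class_def)
  from wval_word_rel[OF f R this] show ?thesis by (simp add: class_val_def)
qed

text \<open>Von Dyck's theorem.\<close>

lemma class_val_hom: "class_val f \<in> hom (presented_group X R) G"
  using f by (auto simp: hom_def carrier_presented_group mult_presented_group
      class_val_word_class wval_append)

end

lemma hom_presented_group_wval:
  assumes \<phi>: "\<phi> \<in> hom (presented_group X R) G" and w: "w \<in> words X"
  shows "\<phi> (word_class X R w) = wval G (\<lambda>x. \<phi> (word_class X R [(x, True)])) w"
proof -
  let ?P = "presented_group X R"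
  interpret P: group ?P by (rule group_presented_group)
  interpret h: group_hom ?P G \<phi> by unfold_locales (rule \<phi>)
  have cl: "word_class X R u \<in> carrier ?P" if "u \<in> words X" for u
    using that by (simp add: carrier_presented_group)
  have inv: "inv\<^bsub>?P\<^esub> word_class X R [(x, True)] = word_class X R [(x, False)]" if "x \<in> X" for x
  proof (rule P.inv_equality)
    have "([(x, False), (x, True)], []) \<in> word_rel X R"
      using word_rel.cancel[of "[]" X "[]" x False R] that by simp
    then show "word_class X R [(x, False)] \<otimes>\<^bsub>?P\<^esub> word_class X R [(x, True)] = \<one>\<^bsub>?P\<^esub>"
      using that by (simp add: mult_presented_group one_presented_group word_class_eq_iff)
  qed (use that cl in auto)
  show ?thesis
    using w
  proof (induction w)
    case Nil
    then show ?case using h.hom_one by (simp add: one_presented_group)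
  next
    case (Cons l w)
    obtain x b where l: "l = (x, b)" by force
    then have x: "x \<in> X" "w \<in> words X" using Cons.prems by auto
    have "word_class X R (l # w) = word_class X R [l] \<otimes>\<^bsub>?P\<^esub> word_class X R w"
      using x l by (simp add: mult_presented_group)
    moreover have "\<phi> (word_class X R [(x, False)]) = inv \<phi> (word_class X R [(x, True)])"
      using x inv[of x] h.hom_inv[of "word_class X R [(x, True)]"] cl by simp
    ultimately show ?case using Cons.IH x l cl by (cases b) (simp_all add: h.hom_mult)
  qed
qed

end


section \<open>Decomposed groups\<close>

text \<open>Instantiated with both given decompositions of \<open>W\<close>, and again with the
  quotient graph of groups and its own presented group, where it supplies the defining
  relations.\<close>

locale decomposed_group = group W for W :: "'g monoid" (structure) +
  fixes \<Delta> :: "('v, 'e, 'x, 'y, 'g) decomposition"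
  assumes decomposition: "graph_of_groups_decomposition W \<Delta>"
begin

abbreviation "gens \<equiv> fg_generators \<Delta>"
abbreviation "rels \<equiv> fg_relators \<Delta> (mtree \<Delta>)"

definition gval :: "('v, 'e, 'x) generator \<Rightarrow> 'g" where
  "gval x = ident \<Delta> (word_class gens rels [(x, True)])"

abbreviation t where "t e \<equiv> gval (Edg e)"

lemma wf: "wf_graph_of_groups \<Delta>" and maxtree: "maximal_tree \<Delta> (mtree \<Delta>)"
  and ident_iso: "ident \<Delta> \<in> iso (presented_group gens rels) W"
  using decomposition by (auto simp: graph_of_groups_decomposition_def fundamental_group_def)

sublocale bidirected_digraph "base \<Delta>" "arev \<Delta>"
  using wf by (simp add: wf_graph_of_groups_def)

lemma connected_base: "connected (base \<Delta>)"
  using wf by (simp add: wf_graph_of_groups_def)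

lemma vgroup_group: "v \<in> verts (base \<Delta>) \<Longrightarrow> group (vgroup \<Delta> v)"
  and egroup_group: "e \<in> arcs (base \<Delta>) \<Longrightarrow> group (egroup \<Delta> e)"
  and egroup_arev: "e \<in> arcs (base \<Delta>) \<Longrightarrow> egroup \<Delta> (arev \<Delta> e) = egroup \<Delta> e"
  and emb_hom: "e \<in> arcs (base \<Delta>) \<Longrightarrow> emb \<Delta> e \<in> hom (egroup \<Delta> e) (vgroup \<Delta> (head (base \<Delta>) e))"
  using wf by (auto simp: wf_graph_of_groups_def mon_def)

lemma gens_iff [simp]:
  "Vtx v x \<in> gens \<longleftrightarrow> v \<in> verts (base \<Delta>) \<and> x \<in> carrier (vgroup \<Delta> v)"
  "Edg e \<in> gens \<longleftrightarrow> e \<in> arcs (base \<Delta>)"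
  by (auto simp: fg_generators_def)

lemma ident_hom: "ident \<Delta> \<in> hom (presented_group gens rels) W"
  using ident_iso by (simp add: iso_def)

lemma gval_closed: "gval \<in> gens \<rightarrow> carrier W"
  using ident_hom by (auto simp: gval_def hom_def carrier_presented_group)

lemma gval_in [simp]: "x \<in> gens \<Longrightarrow> gval x \<in> carrier W"
  using gval_closed by auto

lemma ident_wval: "w \<in> words gens \<Longrightarrow> ident \<Delta> (word_class gens rels w) = wval W gval w"
  using hom_presented_group_wval[OF ident_hom] by (simp add: gval_def[abs_def])

lemma relator_val: "r \<in> rels \<Longrightarrow> r \<in> words gens \<Longrightarrow> wval W gval r = \<one>"
proof -
  assume r: "r \<in> rels" "r \<in> words gens"
  then have "word_class gens rels r = word_class gens rels []"
    using word_rel.relator[of "[]" gens "[]" r rels] by (simp add: word_class_eq_iff)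
  then show ?thesis using ident_wval r by (metis ident_wval words_simps(1) wval_simps(1))
qed

lemma wval_surj: "g \<in> carrier W \<Longrightarrow> \<exists>w\<in>words gens. wval W gval w = g"
proof -
  assume "g \<in> carrier W"
  then have "g \<in> ident \<Delta> ` word_class gens rels ` words gens"
    using ident_iso by (simp add: iso_def bij_betw_def carrier_presented_group)
  then show ?thesis using ident_wval by auto
qed

text \<open>Faithfulness of the presentation, from injectivity of the identification: a function of
  words that respects \<open>word_rel\<close> descends to \<open>W\<close>.\<close>

lemma wval_eq_word_rel:
  assumes "u \<in> words gens" "v \<in> words gens" "wval W gval u = wval W gval v"
  shows "(u, v) \<in> word_rel gens rels"
proof -
  have "inj_on (ident \<Delta>) (carrier (presented_group gens rels))"
    using ident_iso by (simp add: iso_def bij_betw_def)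
  moreover have "ident \<Delta> (word_class gens rels u) = ident \<Delta> (word_class gens rels v)"
    by (simp only: ident_wval assms)
  ultimately have "word_class gens rels u = word_class gens rels v"
    using assms by (simp add: inj_on_eq_iff carrier_presented_group)
  then show ?thesis using assms word_class_eq_iff by blast
qed

lemma gval_vtx_mult:
  assumes "v \<in> verts (base \<Delta>)" "x \<in> carrier (vgroup \<Delta> v)" "y \<in> carrier (vgroup \<Delta> v)"
  shows "gval (Vtx v (x \<otimes>\<^bsub>vgroup \<Delta> v\<^esub> y)) = gval (Vtx v x) \<otimes> gval (Vtx v y)"
proof -
  interpret v: group "vgroup \<Delta> v" using assms vgroup_group by blast
  let ?r = "[(Vtx v x, True), (Vtx v y, True), (Vtx v (x \<otimes>\<^bsub>vgroup \<Delta> v\<^esub> y), False)]"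
  have "wval W gval ?r = \<one>"
    using assms by (intro relator_val) (auto simp: fg_relators_def)
  then have "gval (Vtx v x) \<otimes> gval (Vtx v y) \<otimes> inv gval (Vtx v (x \<otimes>\<^bsub>vgroup \<Delta> v\<^esub> y)) = \<one>"
    using assms by (simp add: m_assoc)
  then show ?thesis using assms
    by (metis gens_iff(1) gval_in inv_closed inv_equality inv_inv m_closed v.m_closed)
qed

lemma t_arev [simp]:
  assumes "e \<in> arcs (base \<Delta>)" shows "t e \<otimes> t (arev \<Delta> e) = \<one>"
proof -
  have "wval W gval [(Edg e, True), (Edg (arev \<Delta> e), True)] = \<one>"
    using assms by (intro relator_val) (auto simp: fg_relators_def)
  then show ?thesis using assms by simp
qed

lemma t_conj:
  assumes e: "e \<in> arcs (base \<Delta>)" and a: "a \<in> carrier (egroup \<Delta> e)"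
  shows "t e \<otimes> gval (Vtx (head (base \<Delta>) e) (emb \<Delta> e a)) =
    gval (Vtx (tail (base \<Delta>) e) (emb \<Delta> (arev \<Delta> e) a)) \<otimes> t e"
proof -
  let ?x = "Vtx (head (base \<Delta>) e) (emb \<Delta> e a)"
  let ?y = "Vtx (tail (base \<Delta>) e) (emb \<Delta> (arev \<Delta> e) a)"
  have xy: "?x \<in> gens" "?y \<in> gens"
    using emb_hom[OF e] emb_hom[of "arev \<Delta> e"] e a egroup_arev[OF e] by (auto simp: hom_def)
  have "wval W gval [(Edg e, True), (?x, True), (Edg e, False), (?y, False)] = \<one>"
    using e a xy by (intro relator_val) (auto simp: fg_relators_def)
  then have "t e \<otimes> gval ?x \<otimes> inv (t e) \<otimes> inv gval ?y = \<one>"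
    using e xy by (simp add: m_assoc)
  then have "t e \<otimes> gval ?x \<otimes> inv (t e) = gval ?y"
    using e xy by (metis gens_iff(2) gval_in inv_closed inv_equality inv_inv m_closed)
  then show ?thesis
    using e xy by (metis gens_iff(2) gval_in inv_closed inv_solve_right m_closed)
qed

lemma t_mtree [simp]:
  assumes "e \<in> mtree \<Delta>" shows "t e = \<one>"
proof -
  have "wval W gval [(Edg e, True)] = \<one>"
    using assms maxtree by (intro relator_val) (auto simp: fg_relators_def maximal_tree_def)
  then show ?thesis using assms maxtree by (auto simp: maximal_tree_def)
qed

lemma vertex_group_gval: "vertex_group \<Delta> v = (\<lambda>x. gval (Vtx v x)) ` carrier (vgroup \<Delta> v)"
  by (simp add: vertex_group_def vertex_element_def gval_def)

lemma edge_group_gval: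
  "edge_group \<Delta> e = (\<lambda>a. gval (Vtx (head (base \<Delta>) e) (emb \<Delta> e a))) ` carrier (egroup \<Delta> e)"
  by (simp add: edge_group_def vertex_element_def gval_def)

lemma vertex_group_hom:
  "v \<in> verts (base \<Delta>) \<Longrightarrow> (\<lambda>x. gval (Vtx v x)) \<in> hom (vgroup \<Delta> v) W"
  by (auto simp: hom_def gval_vtx_mult)

lemma vertex_group_subgroup:
  assumes v: "v \<in> verts (base \<Delta>)" shows "subgroup (vertex_group \<Delta> v) W"
proof -
  interpret h: group_hom "vgroup \<Delta> v" W "\<lambda>x. gval (Vtx v x)"
    using v vgroup_group vertex_group_hom group_axioms
    by (auto simp: group_hom_def group_hom_axioms_def)
  show ?thesis unfolding vertex_group_gval using h.img_is_subgroup by simp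
qed

lemma edge_group_subgroup:
  assumes e: "e \<in> arcs (base \<Delta>)" shows "subgroup (edge_group \<Delta> e) W"
proof -
  let ?f = "(\<lambda>x. gval (Vtx (head (base \<Delta>) e) x)) \<circ> emb \<Delta> e"
  have "?f \<in> hom (egroup \<Delta> e) W"
    using emb_hom[OF e] vertex_group_hom[of "head (base \<Delta>) e"] e
    by (intro Group.hom_compose) auto
  then interpret h: group_hom "egroup \<Delta> e" W ?f
    using egroup_group[OF e] group_axioms by (auto simp: group_hom_def group_hom_axioms_def)
  show ?thesis unfolding edge_group_gval using h.img_is_subgroup by (simp add: o_def)
qed

lemma edge_group_subset: "e \<in> arcs (base \<Delta>) \<Longrightarrow> edge_group \<Delta> e \<subseteq> vertex_group \<Delta> (head (base \<Delta>) e)"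
  using emb_hom[of e] by (auto simp: edge_group_gval vertex_group_gval hom_def)

text \<open>Elements of the edge group at the tail pass through the letter of \<open>e\<close> and
  come out in the edge group at the head. This makes heads of arcs in the Bass-Serre tree
  independent of coset representatives.\<close>

lemma edge_group_arev_t:
  assumes e: "e \<in> arcs (base \<Delta>)" and b: "b \<in> edge_group \<Delta> (arev \<Delta> e)"
  shows "\<exists>b'\<in>edge_group \<Delta> e. b \<otimes> t e = t e \<otimes> b'"
proof -
  obtain a where "a \<in> carrier (egroup \<Delta> e)" "b = gval (Vtx (tail (base \<Delta>) e) (emb \<Delta> (arev \<Delta> e) a))"
    using b e egroup_arev[OF e] by (auto simp: edge_group_gval)
  then show ?thesis
    using t_conj[OF e] by (auto simp: edge_group_gval intro!: bexI)
qed

end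

text \<open>Deleting \<open>f\<close> and its reverse must disconnect the ends of \<open>f\<close>,
  since a remaining path would close up with \<open>f\<close> to a forbidden circuit. Off
  \<open>T\<close> the reversal is the identity, as \<open>bidirected_digraph\<close> requires off
  the arcs.\<close>

lemma (in bidirected_digraph) serre_tree_subgraph:
  assumes T: "T \<subseteq> arcs G" "arev ` T \<subseteq> T" and conn: "connected (G\<lparr>arcs := T\<rparr>)"
    and cyc: "\<And>p. pre_digraph.cycle (G\<lparr>arcs := T\<rparr>) p \<Longrightarrow> \<exists>e. p = [e, arev e]"
  shows "serre_tree (G\<lparr>arcs := T\<rparr>) (\<lambda>e. if e \<in> T then arev e else e)"
proof -
  let ?T = "G\<lparr>arcs := T\<rparr>" and ?rv = "\<lambda>e. if e \<in> T then arev e else e"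
  have wfT: "wf_digraph (G\<lparr>arcs := A\<rparr>)" if "A \<subseteq> T" for A
    using T that by unfold_locales auto
  interpret T: wf_digraph ?T by (rule wfT) simp
  have mem: "arev e \<in> T \<longleftrightarrow> e \<in> T" for e
    using T by (metis arev_arev image_subset_iff)
  have bi: "bidirected_digraph ?T ?rv"
    using T arev_neq mem by (intro T.bidirected_digraphI) auto
  have side: "\<exists>\<sigma>. \<forall>f'\<in>arcs ?T. (\<sigma> (tail ?T f') \<noteq> (\<sigma> (head ?T f') :: bool)) \<longleftrightarrow> f' = f \<or> f' = ?rv f"
    if f: "f \<in> T" for f
  proof -
    let ?D = "G\<lparr>arcs := T - {f, arev f}\<rparr>"
    interpret D: wf_digraph ?D by (rule wfT) auto
    \<comment> \<open>One side of \<open>f\<close> is the component of its head after the geometric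
      edge is removed.\<close>
    define \<sigma> where "\<sigma> y \<longleftrightarrow> (\<exists>p. D.awalk (head G f) p y)" for y
    have step: "\<sigma> (head G e)" if "e \<in> T - {f, arev f}" "\<sigma> (tail G e)" for e
    proof -
      from that obtain p where "D.awalk (head G f) p (tail G e)" unfolding \<sigma>_def by blast
      moreover have "D.awalk (tail G e) [e] (head G e)" using D.arc_implies_awalk[of e] that by auto
      ultimately show ?thesis unfolding \<sigma>_def using D.awalk_appendI by blast
    qed
    have same: "\<sigma> (head G e) = \<sigma> (tail G e)" if "e \<in> T - {f, arev f}" for e
    proof -
      have "arev e \<in> T - {f, arev f}" using that mem by (auto dest: arg_cong[of _ _ arev])
      then show ?thesis using step[of e] step[of "arev e"] that T by auto
    qed
    have head: "\<sigma> (head G f)"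
      unfolding \<sigma>_def by (intro exI[of _ "[]"]) (use T f in \<open>auto simp: D.awalk_Nil_iff\<close>)
    have tail: "\<not> \<sigma> (tail G f)"
    proof
      assume "\<sigma> (tail G f)"
      then obtain p where p: "D.apath (head G f) p (tail G f)"
        unfolding \<sigma>_def using D.apath_awalk_to_apath by blast
      have "compatible ?D ?T" by (simp add: compatible_def)
      note [simp] = compatible_cas[OF this] compatible_awalk_verts[OF this]
      have "T.cycle (f # p)"
        using p T f unfolding T.cycle_def D.apath_def D.awalk_def T.awalk_def
        by (intro exI[of _ "tail G f"]) auto
      then have "p = [arev f]" using cyc by blast
      then show False using p by (auto simp: D.apath_def D.awalk_def)
    qed
    have "\<forall>f'\<in>arcs ?T. (\<sigma> (tail ?T f') \<noteq> \<sigma> (head ?T f')) \<longleftrightarrow> f' = f \<or> f' = ?rv f"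
      using same head tail f T by auto
    then show ?thesis by blast
  qed
  show ?thesis
    using bi conn side by (simp add: serre_tree_def serre_tree_axioms_def)
qed

text \<open>A circuit that crosses its first arc \<open>e\<close> has to cross back, necessarily by
  \<open>rv e\<close>. As the remaining part \<open>q\<close> visits no vertex twice, and
  \<open>rv e\<close> starts where \<open>q\<close> starts and ends where \<open>q\<close> ends, it
  is both the first and the last arc of \<open>q\<close>.\<close>

lemma (in serre_tree) cycle_trivial:
  assumes "cycle p" shows "\<exists>e. p = [e, rv e]"
proof -
  obtain u where u: "awalk u p u" "distinct (tl (awalk_verts u p))" "p \<noteq> []"
    using assms unfolding cycle_def by blast
  then obtain e q where p: "p = e # q" by (cases p) auto
  have e: "e \<in> arcs G" "tail G e = u" and q: "awalk (head G e) q (tail G e)"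
    "distinct (awalk_verts (head G e) q)"
    using u p by (auto simp: awalk_Cons_iff)
  obtain \<sigma> where \<sigma>: "\<forall>f'\<in>arcs G. (\<sigma> (tail G f') \<noteq> (\<sigma> (head G f') :: bool)) \<longleftrightarrow> f' = e \<or> f' = rv e"
    using sides[OF e(1)] by blast
  then have eq: "e \<in> set q \<or> rv e \<in> set q"
    using side_walk[OF q(1) _ _ \<sigma>] e by metis
  then have qne: "q \<noteq> []" by auto
  have ends: "head G (last q) = tail G e" "tail G (hd q) = head G e"
    using awlast_of_awalk[OF q(1)] q(1) qne by (auto simp: awalk_verts_conv awalk_def cas_simp)
  have vs: "awalk_verts (head G e) q = map (tail G) q @ [tail G e]"
    "awalk_verts (head G e) q = head G e # map (head G) q"
    using awalk_verts_conv[of "head G e" q] awalk_verts_conv'[of "head G e" q "tail G e"] q qne ends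
    by (auto simp: awalk_def)
  have "e \<notin> set q" using vs(1) q(2) by auto
  then have re: "rv e \<in> set q" using eq by blast
  have inj: "inj_on (tail G) (set q)" "inj_on (head G) (set q)"
    using q(2) vs by (metis distinct.simps(2) distinct_append distinct_map)+
  have hd: "hd q = rv e" using inj_onD[OF inj(1), of "hd q" "rv e"] ends re e qne by simp
  have last: "last q = rv e" using inj_onD[OF inj(2), of "last q" "rv e"] ends re e qne by simp
  have "distinct q" using q(2) vs(1) by (simp add: distinct_map)
  then have "q = [rv e]" using hd last qne
    by (cases q) (auto split: if_splits, metis last_in_set)
  then show ?thesis using p by blast
qed


section \<open>The Bass-Serre tree\<close>

text \<open>Canonical representatives of left cosets, so that the names of vertices and arcs of the tree
  are pairs of a group element and a vertex or arc.\<close>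

definition crep :: "('g, 'm) monoid_scheme \<Rightarrow> 'g set \<Rightarrow> 'g \<Rightarrow> 'g" where
  "crep G H g = (SOME h. h \<in> g <#\<^bsub>G\<^esub> H)"

context group
begin

lemma mult_inv_cancel: "x \<in> carrier G \<Longrightarrow> y \<in> carrier G \<Longrightarrow> x \<otimes> (inv x \<otimes> y) = y"
  by (simp add: m_assoc[symmetric])

lemma crep_rep: "subgroup H G \<Longrightarrow> g \<in> carrier G \<Longrightarrow> \<exists>b\<in>H. crep G H g = g \<otimes> b"
proof -
  assume "subgroup H G" "g \<in> carrier G"
  then have "g \<in> g <# H" using subgroup.one_closed[of H G] by (force simp: l_coset_def)
  then have "crep G H g \<in> g <# H" unfolding crep_def by (rule someI)
  then show ?thesis by (auto simp: l_coset_def)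
qed

lemma crep_eq_iff:
  assumes H: "subgroup H G" and g: "g \<in> carrier G" "g' \<in> carrier G"
  shows "crep G H g = crep G H g' \<longleftrightarrow> (\<exists>b\<in>H. g' = g \<otimes> b)"
proof
  interpret subgroup H G by fact
  assume "crep G H g = crep G H g'"
  then obtain b b' where b: "b \<in> H" "b' \<in> H" "g \<otimes> b = g' \<otimes> b'"
    using crep_rep[OF H g(1)] crep_rep[OF H g(2)] by metis
  have "g \<otimes> (b \<otimes> inv b') = g \<otimes> b \<otimes> inv b'"
    using b(1,2) g by (simp add: m_assoc)
  also have "\<dots> = g'"
    unfolding b(3) using b(1,2) g by (simp add: m_assoc)
  finally have "g' = g \<otimes> (b \<otimes> inv b')" ..
  then show "\<exists>b\<in>H. g' = g \<otimes> b" using b by blast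
next
  interpret subgroup H G by fact
  assume "\<exists>b\<in>H. g' = g \<otimes> b"
  then obtain b where b: "b \<in> H" "g' = g \<otimes> b" by blast
  have "g' <# H = g <# H"
  proof -
    have "g' \<otimes> h \<in> g <# H" if "h \<in> H" for h
      using that b g by (auto simp: l_coset_def m_assoc)
    moreover have "g \<otimes> h \<in> g' <# H" if "h \<in> H" for h
    proof -
      have "g \<otimes> h = g' \<otimes> (inv b \<otimes> h)"
        using that b g by (simp add: m_assoc mult_inv_cancel)
      then show ?thesis using that b by (auto simp: l_coset_def)
    qed
    ultimately show ?thesis by (auto simp: l_coset_def)
  qed
  then show "crep G H g = crep G H g'" by (simp add: crep_def)
qed

text \<open>The extension, modulo 2, of a crossed homomorphism \<open>D\<close> from generators to words: \<open>D g x\<close> is the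
  contribution of the step from \<open>g\<close> to \<open>g \<otimes> f x\<close> in the Cayley graph.\<close>

fun csum :: "('x \<Rightarrow> 'a) \<Rightarrow> ('a \<Rightarrow> 'x \<Rightarrow> bool) \<Rightarrow> 'a \<Rightarrow> 'x word \<Rightarrow> bool" where
  "csum f D g [] = False"
| "csum f D g ((x, True) # w) = (D g x \<noteq> csum f D (g \<otimes> f x) w)"
| "csum f D g ((x, False) # w) = (D (g \<otimes> inv f x) x \<noteq> csum f D (g \<otimes> inv f x) w)"

lemma csum_append:
  assumes "f \<in> X \<rightarrow> carrier G" "g \<in> carrier G" "u \<in> words X" "v \<in> words X"
  shows "csum f D g (u @ v) = (csum f D g u \<noteq> csum f D (g \<otimes> wval G f u) v)"
  using assms(2-4)
proof (induction u arbitrary: g)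
  case (Cons l u)
  obtain x b where l: "l = (x, b)" by force
  have "f x \<in> carrier G" "wval G f u \<in> carrier G" using Cons.prems l assms(1) by auto
  then show ?case using Cons l by (cases b) (auto simp: m_assoc)
qed simp

text \<open>A relator can be inserted anywhere in a word, so it must contribute nothing from every
  starting point \<open>g\<close>.\<close>

lemma csum_word_rel:
  assumes f: "f \<in> X \<rightarrow> carrier G"
    and R: "\<And>r. r \<in> R \<Longrightarrow> r \<in> words X \<Longrightarrow> wval G f r = \<one>"
      "\<And>r g. r \<in> R \<Longrightarrow> r \<in> words X \<Longrightarrow> g \<in> carrier G \<Longrightarrow> \<not> csum f D g r"
  shows "(u, v) \<in> word_rel X R \<Longrightarrow> g \<in> carrier G \<Longrightarrow> csum f D g u = csum f D g v"
proof (induction arbitrary: g rule: word_rel.induct)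
  case (cancel u v x b)
  have fx: "f x \<in> carrier G" "wval G f u \<in> carrier G" using f cancel by auto
  then have "\<not> csum f D h [(x, b), (x, \<not> b)]" "wval G f [(x, b), (x, \<not> b)] = \<one>"
    if "h \<in> carrier G" for h
    using that by (cases b; simp add: m_assoc)+
  moreover have "csum f D g (u @ [(x, b), (x, \<not> b)] @ v) = (csum f D g u \<noteq>
      (csum f D (g \<otimes> wval G f u) [(x, b), (x, \<not> b)] \<noteq>
       csum f D (g \<otimes> wval G f u \<otimes> wval G f [(x, b), (x, \<not> b)]) v))"
    using f fx cancel by (subst csum_append[where X = X] csum_append[where X = X, symmetric]; simp)+
  ultimately show ?case using f fx cancel by (simp add: csum_append[where X = X])
next
  case (relator u v r)
  have fx: "wval G f u \<in> carrier G" using f relator by auto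
  have "csum f D g (u @ r @ v) = (csum f D g u \<noteq>
      (csum f D (g \<otimes> wval G f u) r \<noteq> csum f D (g \<otimes> wval G f u \<otimes> wval G f r) v))"
    using f fx relator by (simp add: csum_append[where X = X])
  then show ?case using f fx relator R by (simp add: csum_append[where X = X])
qed auto

end

section \<open>Cosets as vertices and arcs of the Bass-Serre tree\<close>

context decomposed_group
begin

text \<open>An arc of the tree is named by a coset at its tail, whereas \<open>edge_group\<close>
  embeds at the head; hence the reversed arc.\<close>

definition arc_stab :: "'e \<Rightarrow> 'g set" where
  "arc_stab e = edge_group \<Delta> (arev \<Delta> e)"

definition bsv :: "'g \<Rightarrow> 'v \<Rightarrow> 'g \<times> 'v" where
  "bsv g v = (crep W (vertex_group \<Delta> v) g, v)"

definition bse :: "'g \<Rightarrow> 'e \<Rightarrow> 'g \<times> 'e" where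
  "bse g e = (crep W (arc_stab e) g, e)"

text \<open>The translates by \<open>g\<close> of all tails of arcs lie in one copy of the vertices
  of the base graph; the letter \<open>t e\<close> leads to the copy that contains the head. It is
  trivial on \<open>mtree\<close>, so the maximal tree lifts to each copy.\<close>

definition bass_serre :: "('g \<times> 'v, 'g \<times> 'e) pre_digraph" where
  "bass_serre =
    \<lparr>verts = {bsv g v | g v. g \<in> carrier W \<and> v \<in> verts (base \<Delta>)},
     arcs = {bse g e | g e. g \<in> carrier W \<and> e \<in> arcs (base \<Delta>)},
     tail = (\<lambda>(g, e). bsv g (tail (base \<Delta>) e)),
     head = (\<lambda>(g, e). bsv (g \<otimes> t e) (head (base \<Delta>) e))\<rparr>"

definition bs_rev :: "'g \<times> 'e \<Rightarrow> 'g \<times> 'e" where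
  "bs_rev f = (if f \<in> arcs bass_serre then bse (fst f \<otimes> t (snd f)) (arev \<Delta> (snd f)) else f)"

definition bs_vact :: "'g \<Rightarrow> 'g \<times> 'v \<Rightarrow> 'g \<times> 'v" where
  "bs_vact h x = bsv (h \<otimes> fst x) (snd x)"

definition bs_eact :: "'g \<Rightarrow> 'g \<times> 'e \<Rightarrow> 'g \<times> 'e" where
  "bs_eact h f = bse (h \<otimes> fst f) (snd f)"

lemma arc_stab_subgroup: "e \<in> arcs (base \<Delta>) \<Longrightarrow> subgroup (arc_stab e) W"
  by (simp add: arc_stab_def edge_group_subgroup)

lemma arc_stab_tail:
  "e \<in> arcs (base \<Delta>) \<Longrightarrow> b \<in> arc_stab e \<Longrightarrow> b \<in> vertex_group \<Delta> (tail (base \<Delta>) e)"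
  using edge_group_subset[of "arev \<Delta> e"] by (auto simp: arc_stab_def)

lemma arc_stab_head:
  assumes "e \<in> arcs (base \<Delta>)" "b \<in> arc_stab e"
  shows "\<exists>b'\<in>arc_stab (arev \<Delta> e). b \<otimes> t e = t e \<otimes> b'"
  using edge_group_arev_t[of e b] assms by (simp add: arc_stab_def)

lemma bsv_eq_iff:
  assumes "g \<in> carrier W" "h \<in> carrier W" "v \<in> verts (base \<Delta>)"
  shows "bsv g v = bsv h w \<longleftrightarrow> v = w \<and> (\<exists>b\<in>vertex_group \<Delta> v. h = g \<otimes> b)"
  using crep_eq_iff[OF vertex_group_subgroup] assms by (auto simp: bsv_def)

lemma bse_eq_iff:
  assumes "g \<in> carrier W" "h \<in> carrier W" "e \<in> arcs (base \<Delta>)"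
  shows "bse g e = bse h e' \<longleftrightarrow> e = e' \<and> (\<exists>b\<in>arc_stab e. h = g \<otimes> b)"
  using crep_eq_iff[OF arc_stab_subgroup] assms by (auto simp: bse_def)

lemma bsv_rep:
  assumes "g \<in> carrier W" "v \<in> verts (base \<Delta>)"
  obtains b where "b \<in> vertex_group \<Delta> v" "b \<in> carrier W" "bsv g v = (g \<otimes> b, v)"
  using crep_rep[OF vertex_group_subgroup assms(1)] assms(2)
    subgroup.mem_carrier[OF vertex_group_subgroup[OF assms(2)]] unfolding bsv_def by metis

lemma bse_rep:
  assumes "g \<in> carrier W" "e \<in> arcs (base \<Delta>)"
  obtains b where "b \<in> arc_stab e" "b \<in> carrier W" "bse g e = (g \<otimes> b, e)"
  using crep_rep[OF arc_stab_subgroup assms(1)] assms(2)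
    subgroup.mem_carrier[OF arc_stab_subgroup[OF assms(2)]] unfolding bse_def by metis

lemma bsv_in [simp]: "g \<in> carrier W \<Longrightarrow> v \<in> verts (base \<Delta>) \<Longrightarrow> bsv g v \<in> verts bass_serre"
  by (auto simp: bass_serre_def)

lemma bse_in [simp]: "g \<in> carrier W \<Longrightarrow> e \<in> arcs (base \<Delta>) \<Longrightarrow> bse g e \<in> arcs bass_serre"
  by (auto simp: bass_serre_def)

lemma bs_vertsE:
  assumes "x \<in> verts bass_serre"
  obtains g v where "g \<in> carrier W" "v \<in> verts (base \<Delta>)" "x = bsv g v"
  using assms by (auto simp: bass_serre_def)

lemma bs_arcsE:
  assumes "f \<in> arcs bass_serre"
  obtains g e where "g \<in> carrier W" "e \<in> arcs (base \<Delta>)" "f = bse g e"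
  using assms by (auto simp: bass_serre_def)

lemma tail_bse:
  assumes "g \<in> carrier W" "e \<in> arcs (base \<Delta>)"
  shows "tail bass_serre (bse g e) = bsv g (tail (base \<Delta>) e)"
proof -
  obtain b where "b \<in> arc_stab e" "b \<in> carrier W" "bse g e = (g \<otimes> b, e)"
    using bse_rep assms by blast
  then show ?thesis
    using assms arc_stab_tail bsv_eq_iff[of g "g \<otimes> b" "tail (base \<Delta>) e" "tail (base \<Delta>) e"]
    by (auto simp: bass_serre_def)
qed

text \<open>Replacing \<open>g\<close> by the canonical representative of its arc changes
  \<open>g \<otimes> t e\<close> only by an element of the edge group at the head. Both the head and
  the reversal of an arc are therefore well defined.\<close>

lemma bse_t:
  assumes g: "g \<in> carrier W" and e: "e \<in> arcs (base \<Delta>)"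
  obtains a b where "bse g e = (a, e)" "a \<in> carrier W" "b \<in> arc_stab (arev \<Delta> e)"
    "b \<in> carrier W" "a \<otimes> t e = g \<otimes> t e \<otimes> b"
proof -
  obtain b where b: "b \<in> arc_stab e" "b \<in> carrier W" "bse g e = (g \<otimes> b, e)"
    using bse_rep assms by blast
  obtain b' where b': "b' \<in> arc_stab (arev \<Delta> e)" "b \<otimes> t e = t e \<otimes> b'"
    using arc_stab_head e b by blast
  have "b' \<in> carrier W"
    using b' e subgroup.mem_carrier[OF arc_stab_subgroup] by (meson arev_in_arcs)
  then have "g \<otimes> b \<otimes> t e = g \<otimes> t e \<otimes> b'" using b b' g e by (simp add: m_assoc)
  then show ?thesis using that[of "g \<otimes> b" b'] \<open>b' \<in> carrier W\<close> b b' g by simp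
qed

lemma head_bse:
  assumes "g \<in> carrier W" "e \<in> arcs (base \<Delta>)"
  shows "head bass_serre (bse g e) = bsv (g \<otimes> t e) (head (base \<Delta>) e)"
proof -
  obtain a b where ab: "bse g e = (a, e)" "a \<in> carrier W" "b \<in> arc_stab (arev \<Delta> e)"
    "b \<in> carrier W" "a \<otimes> t e = g \<otimes> t e \<otimes> b"
    using bse_t assms by blast
  have "b \<in> vertex_group \<Delta> (head (base \<Delta>) e)"
    using arc_stab_tail[of "arev \<Delta> e" b] ab assms by simp
  then have "bsv (g \<otimes> t e) (head (base \<Delta>) e) = bsv (a \<otimes> t e) (head (base \<Delta>) e)"
    using ab assms by (subst bsv_eq_iff) auto
  then show ?thesis using ab by (simp add: bass_serre_def)
qed

lemma bs_rev_bse: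
  assumes "g \<in> carrier W" "e \<in> arcs (base \<Delta>)"
  shows "bs_rev (bse g e) = bse (g \<otimes> t e) (arev \<Delta> e)"
proof -
  obtain a b where ab: "bse g e = (a, e)" "a \<in> carrier W" "b \<in> arc_stab (arev \<Delta> e)"
    "b \<in> carrier W" "a \<otimes> t e = g \<otimes> t e \<otimes> b"
    using bse_t assms by blast
  then have "bse (g \<otimes> t e) (arev \<Delta> e) = bse (a \<otimes> t e) (arev \<Delta> e)"
    using assms by (subst bse_eq_iff) auto
  then show ?thesis using ab bse_in[OF assms] by (simp add: bs_rev_def)
qed

lemma bs_vact_bsv:
  assumes "h \<in> carrier W" "g \<in> carrier W" "v \<in> verts (base \<Delta>)"
  shows "bs_vact h (bsv g v) = bsv (h \<otimes> g) v"
proof -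
  obtain b where b: "b \<in> vertex_group \<Delta> v" "b \<in> carrier W" "bsv g v = (g \<otimes> b, v)"
    using bsv_rep assms by blast
  then have "bsv (h \<otimes> g) v = bsv (h \<otimes> (g \<otimes> b)) v"
    using assms by (subst bsv_eq_iff) (auto simp: m_assoc[symmetric])
  then show ?thesis using b by (simp add: bs_vact_def)
qed

lemma bs_eact_bse:
  assumes "h \<in> carrier W" "g \<in> carrier W" "e \<in> arcs (base \<Delta>)"
  shows "bs_eact h (bse g e) = bse (h \<otimes> g) e"
proof -
  obtain b where b: "b \<in> arc_stab e" "b \<in> carrier W" "bse g e = (g \<otimes> b, e)"
    using bse_rep assms by blast
  then have "bse (h \<otimes> g) e = bse (h \<otimes> (g \<otimes> b)) e"
    using assms by (subst bse_eq_iff) (auto simp: m_assoc[symmetric])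
  then show ?thesis using b by (simp add: bs_eact_def)
qed

lemma snd_bs [simp]: "snd (bsv g v) = v" "snd (bse g e) = e"
  by (simp_all add: bsv_def bse_def)

lemma t_t_arev: "g \<in> carrier W \<Longrightarrow> e \<in> arcs (base \<Delta>) \<Longrightarrow> g \<otimes> t e \<otimes> t (arev \<Delta> e) = g"
  by (simp add: m_assoc)

lemma wf_bass_serre: "wf_digraph bass_serre"
  by unfold_locales (auto elim!: bs_arcsE simp: tail_bse head_bse)

lemma bidirected_bass_serre: "bidirected_digraph bass_serre bs_rev"
proof (rule wf_digraph.bidirected_digraphI[OF wf_bass_serre])
  fix f assume "f \<in> arcs bass_serre"
  then obtain g e where f: "g \<in> carrier W" "e \<in> arcs (base \<Delta>)" "f = bse g e"
    by (rule bs_arcsE)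
  show "bs_rev f \<noteq> f"
    using f arev_neq by (metis bs_rev_bse snd_bs(2))
  show "bs_rev (bs_rev f) = f"
    using f by (simp add: bs_rev_bse t_t_arev)
  show "tail bass_serre (bs_rev f) = head bass_serre f"
    using f by (simp add: bs_rev_bse tail_bse head_bse)
qed (simp add: bs_rev_def)

text \<open>Each translate of the maximal tree is connected, and the translates by \<open>g\<close>
  and \<open>g \<otimes> gval x\<close> share a vertex if \<open>x\<close> is a vertex letter and
  are joined by an arc if it is an edge letter. The generators reach all of
  \<open>W\<close>.\<close>

lemma connected_bass_serre: "connected bass_serre"
proof -
  obtain u where u: "u \<in> verts (base \<Delta>)" using connected_base by (auto simp: connected_conv)
  show ?thesis
  proof (rule wf_digraph.connectedI_closed[OF wf_bass_serre])
    show "bsv \<one> u \<in> verts bass_serre" using u by simp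
    fix P y
    assume P: "P (bsv \<one> u)" "y \<in> verts bass_serre"
      and step: "\<And>f. f \<in> arcs bass_serre \<Longrightarrow> P (tail bass_serre f) \<longleftrightarrow> P (head bass_serre f)"
    have step': "P (bsv g (tail (base \<Delta>) e)) \<longleftrightarrow> P (bsv (g \<otimes> t e) (head (base \<Delta>) e))"
      if "g \<in> carrier W" "e \<in> arcs (base \<Delta>)" for g e
      using step[of "bse g e"] that by (simp add: tail_bse head_bse)
    have T: "mtree \<Delta> \<subseteq> arcs (base \<Delta>)" "connected ((base \<Delta>)\<lparr>arcs := mtree \<Delta>\<rparr>)"
      using maxtree by (auto simp: maximal_tree_def)
    have wfT: "wf_digraph ((base \<Delta>)\<lparr>arcs := mtree \<Delta>\<rparr>)"
      using T by unfold_locales auto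
    \<comment> \<open>This moves within the translate by \<open>g\<close> of the maximal tree, where
      the letters are trivial.\<close>
    have eqv: "P (bsv g v) \<longleftrightarrow> P (bsv g u)" if "g \<in> carrier W" "v \<in> verts (base \<Delta>)" for g v
    proof (rule wf_digraph.connected_induct[OF wfT T(2), of u "\<lambda>v. P (bsv g v) \<longleftrightarrow> P (bsv g u)"])
      show "(P (bsv g (tail ((base \<Delta>)\<lparr>arcs := mtree \<Delta>\<rparr>) f)) \<longleftrightarrow> P (bsv g u)) \<longleftrightarrow>
          (P (bsv g (head ((base \<Delta>)\<lparr>arcs := mtree \<Delta>\<rparr>) f)) \<longleftrightarrow> P (bsv g u))"
        if "f \<in> arcs ((base \<Delta>)\<lparr>arcs := mtree \<Delta>\<rparr>)" for f
        using step'[of g f] that \<open>g \<in> carrier W\<close> T(1) by auto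
    qed (use that u in auto)
    have gen: "P (bsv (g \<otimes> gval x) u) \<longleftrightarrow> P (bsv g u)" if g: "g \<in> carrier W" and x: "x \<in> gens" for g x
    proof (cases x)
      case (Vtx v y)
      then have v: "v \<in> verts (base \<Delta>)" using x by simp
      have "gval x \<in> vertex_group \<Delta> v" using Vtx x by (simp add: vertex_group_gval)
      then have "bsv g v = bsv (g \<otimes> gval x) v" using g x v by (subst bsv_eq_iff) auto
      then show ?thesis using eqv[of g v] eqv[of "g \<otimes> gval x" v] g x v by simp
    next
      case (Edg e)
      then show ?thesis
        using step'[of g e] eqv[of g "tail (base \<Delta>) e"] eqv[of "g \<otimes> gval x" "head (base \<Delta>) e"] g x
        by simp
    qed
    have "P (bsv (g \<otimes> wval W gval w) u) \<longleftrightarrow> P (bsv g u)" if "g \<in> carrier W" "w \<in> words gens" for g w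
      using that
    proof (induction w arbitrary: g)
      case (Cons l w)
      obtain x b where l: "l = (x, b)" by force
      then have x: "x \<in> gens" "wval W gval w \<in> carrier W"
        using Cons.prems wval_closed[OF gval_closed] by auto
      have "P (bsv (g \<otimes> inv gval x) u) \<longleftrightarrow> P (bsv g u)"
        using gen[of "g \<otimes> inv gval x" x] x Cons.prems by (simp add: m_assoc)
      then show ?case
        using Cons.IH[of "g \<otimes> (if b then gval x else inv gval x)"] Cons.prems gen[of g x] x l
        by (cases b) (simp_all add: m_assoc)
    qed simp
    then have "P (bsv g u)" if "g \<in> carrier W" for g
      using wval_surj[OF that] P(1) by (metis l_one one_closed that)
    then show "P y" using eqv P(2) by (metis bs_vertsE)
  qed
qed

section \<open>Every geometric edge of the Bass-Serre tree separates\<close>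

lemma serre_tree_mtree:
  "serre_tree ((base \<Delta>)\<lparr>arcs := mtree \<Delta>\<rparr>) (\<lambda>e. if e \<in> mtree \<Delta> then arev \<Delta> e else e)"
  using maxtree by (intro serre_tree_subgraph) (auto simp: maximal_tree_def)

text \<open>A group action on a graph is on a tree if the group has a crossed homomorphism to the functions
  on the geometric edges that sends a group element to the walk from the base point to its
  translate. The presentation provides this crossed homomorphism. Here only the coefficient
  of one edge, modulo 2, is computed: \<open>lab\<close> is the indicator function of this edge, and
  \<open>pot g v\<close> is the contribution of the walk in the translate by \<open>g\<close> of the
  maximal tree.\<close>

context
  fixes lab :: "'g \<times> 'e \<Rightarrow> bool" and pot :: "'g \<Rightarrow> 'v \<Rightarrow> bool"
  assumes lab_rev: "\<And>f. f \<in> arcs bass_serre \<Longrightarrow> lab (bs_rev f) = lab f"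
    and pot: "\<And>g e. g \<in> carrier W \<Longrightarrow> e \<in> mtree \<Delta> \<Longrightarrow>
      pot g (head (base \<Delta>) e) = (pot g (tail (base \<Delta>) e) \<noteq> lab (bse g e))"
begin

text \<open>The walk goes out in the translate by \<open>g\<close>, crosses the arc if
  \<open>x\<close> is an edge letter, and returns in the translate by
  \<open>g \<otimes> gval x\<close>; modulo 2 the way back is added as well.\<close>

definition cross :: "'g \<Rightarrow> ('v, 'e, 'x) generator \<Rightarrow> bool" where
  "cross g x = (case x of
     Vtx v y \<Rightarrow> pot g v \<noteq> pot (g \<otimes> gval x) v
   | Edg e \<Rightarrow> pot g (tail (base \<Delta>) e) \<noteq> (lab (bse g e) \<noteq> pot (g \<otimes> t e) (head (base \<Delta>) e)))"

lemma lab_arev: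
  "g \<in> carrier W \<Longrightarrow> e \<in> arcs (base \<Delta>) \<Longrightarrow> lab (bse (g \<otimes> t e) (arev \<Delta> e)) = lab (bse g e)"
  using lab_rev[of "bse g e"] by (simp add: bs_rev_bse)

text \<open>Each relator traces a closed walk in which all contributions cancel in pairs; for the
  letter of an arc in the maximal tree this is the assumption on \<open>pot\<close>.\<close>

lemma csum_relator:
  assumes r: "r \<in> rels" "r \<in> words gens" and g: "g \<in> carrier W"
  shows "\<not> csum gval cross g r"
proof -
  consider
    (vtx) v x y where "v \<in> verts (base \<Delta>)" "x \<in> carrier (vgroup \<Delta> v)" "y \<in> carrier (vgroup \<Delta> v)"
      "r = [(Vtx v x, True), (Vtx v y, True), (Vtx v (x \<otimes>\<^bsub>vgroup \<Delta> v\<^esub> y), False)]"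
  | (rev) e where "e \<in> arcs (base \<Delta>)" "r = [(Edg e, True), (Edg (arev \<Delta> e), True)]"
  | (conj) e a where "e \<in> arcs (base \<Delta>)" "a \<in> carrier (egroup \<Delta> e)"
      "r = [(Edg e, True), (Vtx (head (base \<Delta>) e) (emb \<Delta> e a), True), (Edg e, False),
        (Vtx (tail (base \<Delta>) e) (emb \<Delta> (arev \<Delta> e) a), False)]"
  | (tree) e where "e \<in> mtree \<Delta>" "r = [(Edg e, True)]"
    using r(1) unfolding fg_relators_def by auto
  then show ?thesis
  proof cases
    case vtx
    let ?x = "gval (Vtx v x)" and ?y = "gval (Vtx v y)"
    have xy: "?x \<in> carrier W" "?y \<in> carrier W" using vtx by auto
    have "g \<otimes> ?x \<otimes> ?y \<otimes> inv (?x \<otimes> ?y) = g"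
      using xy g by (simp add: m_assoc[symmetric] inv_mult_group) (simp add: m_assoc)
    moreover have "g \<otimes> (?x \<otimes> ?y) = g \<otimes> ?x \<otimes> ?y" using xy g by (simp add: m_assoc)
    ultimately show ?thesis using vtx by (auto simp: cross_def gval_vtx_mult)
  next
    case rev
    then show ?thesis using g by (auto simp: cross_def lab_arev t_t_arev)
  next
    case conj
    let ?b = "gval (Vtx (head (base \<Delta>) e) (emb \<Delta> e a))"
    let ?b' = "gval (Vtx (tail (base \<Delta>) e) (emb \<Delta> (arev \<Delta> e) a))"
    have mem: "?b \<in> carrier W" "?b' \<in> carrier W" using r(2) conj by auto
    have eq: "t e \<otimes> ?b = ?b' \<otimes> t e" using t_conj conj by blast
    have gb: "g \<otimes> t e \<otimes> ?b \<otimes> inv (t e) = g \<otimes> ?b'"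
    proof -
      have "g \<otimes> t e \<otimes> ?b \<otimes> inv (t e) = g \<otimes> (t e \<otimes> ?b) \<otimes> inv (t e)"
        using mem g conj by (simp add: m_assoc)
      also have "\<dots> = g \<otimes> ?b'" unfolding eq using mem g conj by (simp add: m_assoc)
      finally show ?thesis .
    qed
    have gb': "g \<otimes> ?b' \<otimes> t e = g \<otimes> t e \<otimes> ?b"
      using mem g conj eq by (simp add: m_assoc)
    \<comment> \<open>The relator crosses an arc of type \<open>e\<close> once forwards and once
      backwards. Both are the same arc of the tree, because \<open>?b'\<close> fixes it up to the
      translation by \<open>g\<close>.\<close>
    have "?b' \<in> arc_stab e"
      using conj egroup_arev by (auto simp: arc_stab_def edge_group_gval)
    then have "bse (g \<otimes> ?b') e = bse g e"
      using g conj mem by (subst eq_commute, subst bse_eq_iff) auto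
    moreover have "g \<otimes> ?b' \<otimes> inv ?b' = g" using mem g by (simp add: m_assoc)
    ultimately show ?thesis using conj gb gb' by (auto simp: cross_def)
  next
    case tree
    then show ?thesis using pot[OF g, of e] g by (auto simp: cross_def)
  qed
qed

text \<open>The sum of \<open>c g\<close> and \<open>pot g v\<close> modulo 2 counts the labelled
  edges on a walk from the base point to the vertex \<open>bsv g v\<close>; adjacent vertices differ
  by the label of the arc between them.\<close>

lemma side_of_cross:
  "\<exists>\<sigma>. \<forall>f\<in>arcs bass_serre. (\<sigma> (tail bass_serre f) \<noteq> (\<sigma> (head bass_serre f) :: bool)) \<longleftrightarrow> lab f"
proof -
  \<comment> \<open>The word for \<open>g\<close> is arbitrary: faithfulness of the presentation and
    \<open>csum_relator\<close> make the sum independent of it.\<close>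
  define c where "c g = csum gval cross \<one> (SOME w. w \<in> words gens \<and> wval W gval w = g)" for g
  have c: "c (wval W gval w) = csum gval cross \<one> w" if "w \<in> words gens" for w
  proof -
    let ?w = "SOME u. u \<in> words gens \<and> wval W gval u = wval W gval w"
    have "?w \<in> words gens \<and> wval W gval ?w = wval W gval w"
      by (rule someI[of _ w]) (simp add: that)
    then have "(?w, w) \<in> word_rel gens rels" using that wval_eq_word_rel by blast
    then show ?thesis
      unfolding c_def using csum_word_rel[OF gval_closed relator_val csum_relator] one_closed
      by blast
  qed
  have c_mult: "c (g \<otimes> gval x) = (c g \<noteq> cross g x)" if "g \<in> carrier W" "x \<in> gens" for g x
  proof -
    obtain w where w: "w \<in> words gens" "wval W gval w = g" using wval_surj \<open>g \<in> carrier W\<close> by blast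
    have "wval W gval (w @ [(x, True)]) = g \<otimes> gval x"
      using w that by (simp add: wval_append[OF gval_closed])
    then show ?thesis
      using c[of w] c[of "w @ [(x, True)]"] w that
      by (simp add: csum_append[OF gval_closed])
  qed
  \<comment> \<open>\<open>fst x\<close> is one particular representative of the coset. Any other
    gives the same value, since a vertex letter changes \<open>c\<close> and \<open>pot\<close>
    equally.\<close>
  define \<sigma> where "\<sigma> x = (c (fst x) \<noteq> pot (fst x) (snd x))" for x
  have \<sigma>: "\<sigma> (bsv g v) = (c g \<noteq> pot g v)" if g: "g \<in> carrier W" and v: "v \<in> verts (base \<Delta>)" for g v
  proof -
    obtain b where b: "b \<in> vertex_group \<Delta> v" "bsv g v = (g \<otimes> b, v)" using bsv_rep[OF g v] by metis
    then obtain x where x: "b = gval (Vtx v x)" "x \<in> carrier (vgroup \<Delta> v)"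
      by (auto simp: vertex_group_gval)
    then show ?thesis
      using c_mult[OF g, of "Vtx v x"] b v by (auto simp: \<sigma>_def cross_def)
  qed
  have "(\<sigma> (tail bass_serre f) \<noteq> \<sigma> (head bass_serre f)) \<longleftrightarrow> lab f" if "f \<in> arcs bass_serre" for f
    using that
  proof (rule bs_arcsE)
    fix g e assume f: "g \<in> carrier W" "e \<in> arcs (base \<Delta>)" "f = bse g e"
    then have "c (g \<otimes> t e) = (c g \<noteq> cross g (Edg e))" using c_mult[of g "Edg e"] by simp
    then show ?thesis using f by (auto simp: tail_bse head_bse \<sigma> cross_def)
  qed
  then show ?thesis by blast
qed

end

text \<open>For the indicator of a single edge, the labels on the translate by \<open>g\<close> of
  the maximal tree are integrated modulo 2, which gives \<open>pot g\<close>.\<close>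

lemma serre_tree_bass_serre: "serre_tree bass_serre bs_rev"
proof -
  interpret B: bidirected_digraph bass_serre bs_rev by (rule bidirected_bass_serre)
  interpret T: serre_tree "(base \<Delta>)\<lparr>arcs := mtree \<Delta>\<rparr>" "\<lambda>e. if e \<in> mtree \<Delta> then arev \<Delta> e else e"
    by (rule serre_tree_mtree)
  have T: "mtree \<Delta> \<subseteq> arcs (base \<Delta>)" using maxtree by (simp add: maximal_tree_def)
  have "\<exists>\<sigma>. \<forall>f'\<in>arcs bass_serre. (\<sigma> (tail bass_serre f') \<noteq> (\<sigma> (head bass_serre f') :: bool)) \<longleftrightarrow>
      f' = f \<or> f' = bs_rev f" if "f \<in> arcs bass_serre" for f
  proof -
    define lab where "lab f' \<longleftrightarrow> f' = f \<or> f' = bs_rev f" for f'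
    have lab: "lab (bs_rev f') = lab f'" for f'
      unfolding lab_def by (metis B.arev_arev)
    have "\<exists>p. \<forall>e\<in>mtree \<Delta>. p (head (base \<Delta>) e) = (p (tail (base \<Delta>) e) \<noteq> lab (bse g e))"
      if g: "g \<in> carrier W" for g
    proof -
      have "lab (bse g (arev \<Delta> e)) = lab (bse g e)" if "e \<in> mtree \<Delta>" for e
        using lab[of "bse g e"] bs_rev_bse[OF g, of e] T that g by auto
      then show ?thesis
        using T.bool_potential_exists[of "\<lambda>e. lab (bse g e)"] by auto
    qed
    then obtain pot where pot: "\<forall>e\<in>mtree \<Delta>. pot g (head (base \<Delta>) e) =
        (pot g (tail (base \<Delta>) e) \<noteq> lab (bse g e))" if "g \<in> carrier W" for g
      by metis
    show ?thesis
      using side_of_cross[of lab pot] lab pot unfolding lab_def by blast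
  qed
  then show ?thesis
    using bidirected_bass_serre connected_bass_serre
    by (simp add: serre_tree_def serre_tree_axioms_def)
qed

end


section \<open>Groups acting on trees\<close>

text \<open>The orientation \<open>Or\<close> is invariant, so the action is without inversions.\<close>

locale tree_action = serre_tree X rv + H: group H
  for X :: "('b, 'c) pre_digraph" and rv and H :: "'g monoid" +
  fixes av :: "'g \<Rightarrow> 'b \<Rightarrow> 'b" and ae :: "'g \<Rightarrow> 'c \<Rightarrow> 'c" and Or :: "'c set"
  assumes av_closed [simp]: "h \<in> carrier H \<Longrightarrow> v \<in> verts X \<Longrightarrow> av h v \<in> verts X"
    and ae_closed [simp]: "h \<in> carrier H \<Longrightarrow> f \<in> arcs X \<Longrightarrow> ae h f \<in> arcs X"
    and av_one [simp]: "v \<in> verts X \<Longrightarrow> av \<one>\<^bsub>H\<^esub> v = v"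
    and ae_one [simp]: "f \<in> arcs X \<Longrightarrow> ae \<one>\<^bsub>H\<^esub> f = f"
    and av_mult: "h \<in> carrier H \<Longrightarrow> k \<in> carrier H \<Longrightarrow> v \<in> verts X \<Longrightarrow> av (h \<otimes>\<^bsub>H\<^esub> k) v = av h (av k v)"
    and ae_mult: "h \<in> carrier H \<Longrightarrow> k \<in> carrier H \<Longrightarrow> f \<in> arcs X \<Longrightarrow> ae (h \<otimes>\<^bsub>H\<^esub> k) f = ae h (ae k f)"
    and tail_ae [simp]: "h \<in> carrier H \<Longrightarrow> f \<in> arcs X \<Longrightarrow> tail X (ae h f) = av h (tail X f)"
    and ae_rv: "h \<in> carrier H \<Longrightarrow> f \<in> arcs X \<Longrightarrow> ae h (rv f) = rv (ae h f)"
    and Or_ae: "h \<in> carrier H \<Longrightarrow> f \<in> arcs X \<Longrightarrow> ae h f \<in> Or \<longleftrightarrow> f \<in> Or"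
    and Or_rv: "f \<in> arcs X \<Longrightarrow> rv f \<in> Or \<longleftrightarrow> f \<notin> Or"
begin

lemma head_ae [simp]:
  assumes "h \<in> carrier H" "f \<in> arcs X" shows "head X (ae h f) = av h (head X f)"
  using assms tail_ae[of h "rv f"] ae_rv[of h f] by (metis ae_closed arev_in_arcs tail_arev)

lemma ae_inv_cancel [simp]:
  assumes "h \<in> carrier H" "f \<in> arcs X"
  shows "ae (inv\<^bsub>H\<^esub> h) (ae h f) = f" "ae h (ae (inv\<^bsub>H\<^esub> h) f) = f"
  using assms by (simp_all add: ae_mult[symmetric])

lemma av_inv_cancel [simp]:
  assumes "h \<in> carrier H" "v \<in> verts X"
  shows "av (inv\<^bsub>H\<^esub> h) (av h v) = v" "av h (av (inv\<^bsub>H\<^esub> h) v) = v"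
  using assms by (simp_all add: av_mult[symmetric])

text \<open>An element fixing \<open>x\<close> and \<open>y\<close> preserves distances from
  \<open>x\<close>, so it maps the parent arc of \<open>y\<close> to a parent arc of
  \<open>y\<close>, which is unique. It then fixes the tail of this arc as well, and descending to
  \<open>x\<close> gives the first arc of the path.\<close>

lemma fixed_arc:
  assumes x: "x \<in> verts X" and y: "y \<in> verts X" and ne: "x \<noteq> y"
  shows "\<exists>f\<in>arcs X. tail X f = x \<and> (\<forall>h\<in>carrier H. av h x = x \<longrightarrow> av h y = y \<longrightarrow> ae h f = f)"
  using y ne
proof (induction "depth x y" arbitrary: y rule: less_induct)
  case less
  obtain f where f: "f \<in> arcs X" "head X f = y" "depth x y = Suc (depth x (tail X f))"
    using parent_exists[OF x less.prems] by blast
  have fixed: "ae h f = f" if h: "h \<in> carrier H" "av h x = x" "av h y = y" for h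
  proof -
    have walk: "\<exists>q. awalk (av h u) q (av h z) \<and> length q = length p" if "awalk u p z" for u p z
      using that
    proof (induction p arbitrary: u)
      case Nil
      then show ?case using h by (auto simp: awalk_Nil_iff)
    next
      case (Cons a p)
      then have a: "a \<in> arcs X" "tail X a = u" "awalk (head X a) p z" by (auto simp: awalk_Cons_iff)
      then obtain q where "awalk (av h (head X a)) q (av h z)" "length q = length p"
        using Cons.IH by blast
      then show ?case using a h by (intro exI[of _ "ae h a # q"]) (auto simp: awalk_Cons_iff)
    qed
    obtain p where p: "awalk x p (tail X f)" "length p = depth x (tail X f)"
      using shortest x f by (metis tail_in_verts)
    then have "depth x (tail X (ae h f)) \<le> depth x (tail X f)"
      using walk[OF p(1)] depth_le f h by (metis tail_ae)
    moreover have hf: "head X (ae h f) = y" using f h by simp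
    ultimately have "depth x y = Suc (depth x (tail X (ae h f)))"
      using depth_arc[OF x, of "ae h f"] f h by auto
    then show ?thesis using parent_unique[OF x _ f(1) hf f(2)] f h by simp
  qed
  show ?case
  proof (cases "tail X f = x")
    case True
    then show ?thesis using f fixed by blast
  next
    case False
    then obtain f' where f': "f' \<in> arcs X" "tail X f' = x"
      "\<forall>h\<in>carrier H. av h x = x \<longrightarrow> av h (tail X f) = tail X f \<longrightarrow> ae h f' = f'"
      using less.hyps[of "tail X f"] f by auto
    moreover have "av h (tail X f) = tail X f" if "h \<in> carrier H" "av h x = x" "av h y = y" for h
      using fixed[OF that] f(1) that(1) by (metis tail_ae)
    ultimately show ?thesis by blast
  qed
qed

end

text \<open>Seen from the common tail, both arcs are the parent arc of the common head.\<close>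

lemma (in serre_tree) arc_unique:
  assumes "f \<in> arcs G" "f' \<in> arcs G" "tail G f = tail G f'" "head G f = head G f'"
  shows "f = f'"
proof -
  have d: "depth (tail G f) (head G f) = Suc (depth (tail G f) (tail G f))"
    using depth_arc[of "tail G f" f] assms(1) by (auto simp: depth_self)
  then have d': "depth (tail G f) (head G f) = Suc (depth (tail G f) (tail G f'))"
    by (simp only: assms(3))
  show ?thesis
    by (rule parent_unique[OF _ assms(1,2) HOL.refl assms(4)[symmetric] d d']) (simp add: assms(1))
qed

section \<open>Stabilizers and orbit representatives\<close>

context tree_action
begin

definition Stab :: "'b \<Rightarrow> 'g set" where
  "Stab v = {h \<in> carrier H. av h v = v}"

definition EStab :: "'c \<Rightarrow> 'g set" where
  "EStab f = {h \<in> carrier H. ae h f = f}"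

lemma Stab_subgroup: "v \<in> verts X \<Longrightarrow> subgroup (Stab v) H"
proof (rule H.subgroupI)
  assume v: "v \<in> verts X"
  show "inv\<^bsub>H\<^esub> h \<in> Stab v" if "h \<in> Stab v" for h
    using that v av_inv_cancel(1)[of h v] by (simp add: Stab_def)
  show "Stab v \<noteq> {}" using v H.one_closed av_one unfolding Stab_def by blast
qed (auto simp: Stab_def av_mult)

lemma EStab_subgroup: "f \<in> arcs X \<Longrightarrow> subgroup (EStab f) H"
proof (rule H.subgroupI)
  assume f: "f \<in> arcs X"
  show "inv\<^bsub>H\<^esub> h \<in> EStab f" if "h \<in> EStab f" for h
    using that f ae_inv_cancel(1)[of h f] by (simp add: EStab_def)
  show "EStab f \<noteq> {}" using f H.one_closed ae_one unfolding EStab_def by blast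
qed (auto simp: EStab_def ae_mult)

text \<open>A maximal tree of the quotient is lifted: Zorn's lemma yields a maximal set that meets
  each orbit at most once and contains the parent of each of its vertices other than the root.
  Maximality makes it meet every orbit.\<close>

lemma transversal_exists:
  assumes x: "x \<in> verts X"
  shows "\<exists>C\<subseteq>verts X. x \<in> C \<and> (\<forall>v\<in>C. \<forall>h\<in>carrier H. av h v \<in> C \<longrightarrow> av h v = v) \<and>
    (\<forall>y\<in>verts X. \<exists>h\<in>carrier H. \<exists>v\<in>C. y = av h v) \<and>
    (\<forall>y\<in>C. y \<noteq> x \<longrightarrow> (\<exists>f\<in>arcs X. head X f = y \<and> tail X f \<in> C \<and> depth x y = Suc (depth x (tail X f))))"
proof -
  define par where "par C y \<longleftrightarrow>
    (\<exists>f\<in>arcs X. head X f = y \<and> tail X f \<in> C \<and> depth x y = Suc (depth x (tail X f)))" for C y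
  define inj where "inj C \<longleftrightarrow> (\<forall>v\<in>C. \<forall>h\<in>carrier H. av h v \<in> C \<longrightarrow> av h v = v)" for C
  let ?A = "{C. C \<subseteq> verts X \<and> x \<in> C \<and> inj C \<and> (\<forall>y\<in>C. y \<noteq> x \<longrightarrow> par C y)}"
  have par_mono: "par C y \<Longrightarrow> C \<subseteq> D \<Longrightarrow> par D y" for C D y unfolding par_def by blast
  have "\<exists>M\<in>?A. \<forall>C\<in>?A. M \<subseteq> C \<longrightarrow> C = M"
  proof (rule subset_Zorn_nonempty)
    have "{x} \<in> ?A" using x by (auto simp: inj_def)
    then show "?A \<noteq> {}" by blast
    fix \<C> assume ne: "\<C> \<noteq> {}" and ch: "subset.chain ?A \<C>"
    have sub: "C \<in> ?A" if "C \<in> \<C>" for C using ch that by (auto simp: subset_chain_def)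
    have "av h v = v" if vC: "v \<in> \<Union>\<C>" "h \<in> carrier H" "av h v \<in> \<Union>\<C>" for h v
    proof -
      obtain C D where C: "C \<in> \<C>" "v \<in> C" and D: "D \<in> \<C>" "av h v \<in> D" using vC by blast
      then have "C \<subseteq> D \<or> D \<subseteq> C" using ch by (auto simp: subset_chain_def)
      then obtain E where "E \<in> \<C>" "v \<in> E" "av h v \<in> E" using C D by blast
      then show ?thesis using sub[of E] vC(2) unfolding inj_def by blast
    qed
    then have "inj (\<Union>\<C>)" unfolding inj_def by blast
    moreover have "par (\<Union>\<C>) y" if y: "y \<in> \<Union>\<C>" "y \<noteq> x" for y
    proof -
      obtain C where "C \<in> \<C>" "y \<in> C" using y by blast
      then show ?thesis using sub[of C] y par_mono[of C y "\<Union>\<C>"] by blast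
    qed
    moreover have "x \<in> \<Union>\<C>" "\<Union>\<C> \<subseteq> verts X" using sub ne by blast+
    ultimately show "\<Union>\<C> \<in> ?A" by blast
  qed
  then obtain C where CA: "C \<in> ?A" and max: "\<forall>D\<in>?A. C \<subseteq> D \<longrightarrow> D = C"
    by (rule bexE)
  have C: "C \<subseteq> verts X" "x \<in> C" "inj C" "\<And>y. y \<in> C \<Longrightarrow> y \<noteq> x \<Longrightarrow> par C y"
    using CA by simp_all
  define P where "P y \<longleftrightarrow> (\<exists>h\<in>carrier H. \<exists>v\<in>C. y = av h v)" for y
  \<comment> \<open>A translate \<open>a\<close> of \<open>f\<close> starts in \<open>C\<close>; if
    its other end \<open>z\<close> were in no translate of \<open>C\<close>, then \<open>C\<close>
    could be enlarged by \<open>z\<close>.\<close>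
  have step: "P (head X f)" if f: "f \<in> arcs X" "P (tail X f)" for f
  proof -
    obtain h v where h: "h \<in> carrier H" "v \<in> C" "tail X f = av h v" using f P_def by auto
    define a where "a = ae (inv\<^bsub>H\<^esub> h) f"
    define z where "z = head X a"
    have v: "v \<in> verts X" using h C by blast
    have a: "a \<in> arcs X" "tail X a = v" "head X a = z" "head X f = av h z" "z \<in> verts X"
      using f(1) h v by (simp_all add: a_def z_def)
    have "P z"
    proof (rule ccontr)
      assume nP: "\<not> P z"
      have zC: "z \<notin> C"
      proof
        assume "z \<in> C"
        then have "P z" unfolding P_def using a(5) by (metis H.one_closed av_one)
        then show False using nP by simp
      qed
      then have zx: "z \<noteq> x" using C by blast
      \<comment> \<open>Otherwise \<open>rv a\<close> would be the parent arc of \<open>v\<close>,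
        and its tail \<open>z\<close> would already be in \<open>C\<close>.\<close>
      have "depth x z = Suc (depth x v)"
      proof (rule ccontr)
        assume "depth x z \<noteq> Suc (depth x v)"
        then have d: "depth x v = Suc (depth x z)" using depth_arc[OF x a(1)] a by auto
        then have "v \<noteq> x" using depth_self[OF x] by auto
        then obtain g where g: "g \<in> arcs X" "head X g = v" "tail X g \<in> C"
          "depth x v = Suc (depth x (tail X g))"
          using C(4)[of v] h(2) unfolding par_def by blast
        have "rv a = g"
          by (rule parent_unique[OF x, of _ _ v]) (use a d g in auto)
        then have "z = tail X g" using a by auto
        then show False using g zC by blast
      qed
      then have "par (insert z C) z" unfolding par_def using a h by blast
      moreover have "inj (insert z C)"
        unfolding inj_def
      proof (intro ballI impI)
        fix w k assume w: "w \<in> insert z C" "k \<in> carrier H" "av k w \<in> insert z C"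
        show "av k w = w"
        proof (cases "w = z")
          case True
          have "av k z \<notin> C"
          proof
            assume "av k z \<in> C"
            moreover have "z = av (inv\<^bsub>H\<^esub> k) (av k z)" using w a by simp
            ultimately have "P z" unfolding P_def using w(2) H.inv_closed by blast
            then show False using nP by simp
          qed
          then show ?thesis using w True by auto
        next
          case False
          then have "w \<in> C" using w by simp
          then have "av k w \<noteq> z" using nP w(2) unfolding P_def by auto
          then show ?thesis using \<open>w \<in> C\<close> w C(3) unfolding inj_def by blast
        qed
      qed
      moreover have "par (insert z C) y" if "y \<in> C" "y \<noteq> x" for y
        using C(4)[OF that] par_mono by blast
      ultimately have "insert z C \<in> ?A"
        using C(1,2) a(5) by auto
      then have "insert z C = C" using bspec[OF max] by blast
      then show False using zC by blast
    qed
    then obtain k w where "k \<in> carrier H" "w \<in> C" "z = av k w" unfolding P_def by blast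
    then have "head X f = av (h \<otimes>\<^bsub>H\<^esub> k) w" using a h C by (simp add: av_mult subset_iff)
    then show ?thesis unfolding P_def using h \<open>k \<in> carrier H\<close> \<open>w \<in> C\<close> by blast
  qed
  have all: "P y" if "y \<in> verts X" for y
  proof (rule connected_induct[OF connected x, of P])
    show "P x" unfolding P_def using C(2) x by (metis H.one_closed av_one)
    show "P (tail X f) \<longleftrightarrow> P (head X f)" if "f \<in> arcs X" for f
      using step[of f] step[of "rv f"] that by auto
  qed (rule that)
  show ?thesis
    using C(1-3) all C(4) unfolding P_def inj_def par_def by (intro exI[of _ C] conjI) simp_all
qed

text \<open>The representatives have to include every positive arc inside \<open>C\<close>, so that
  the lifted maximal tree consists of representatives. An orbit with an arc inside \<open>C\<close>
  is therefore represented by such an arc.\<close>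

lemma arc_reps_exist:
  assumes CH: "C \<subseteq> verts X" "\<forall>v\<in>C. \<forall>h\<in>carrier H. av h v \<in> C \<longrightarrow> av h v = v"
    "\<forall>y\<in>verts X. \<exists>h\<in>carrier H. \<exists>v\<in>C. y = av h v"
  shows "\<exists>P\<subseteq>arcs X \<inter> Or. tail X ` P \<subseteq> C \<and>
    (\<forall>f\<in>P. \<forall>h\<in>carrier H. ae h f \<in> P \<longrightarrow> ae h f = f) \<and>
    (\<forall>f\<in>arcs X \<inter> Or. \<exists>h\<in>carrier H. \<exists>f'\<in>P. f = ae h f') \<and>
    (\<forall>f\<in>arcs X \<inter> Or. tail X f \<in> C \<longrightarrow> head X f \<in> C \<longrightarrow> f \<in> P)"
proof -
  note C = CH(1) CH(2)[rule_format] CH(3)[rule_format]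
  define orb where "orb f = (\<lambda>h. ae h f) ` carrier H" for f
  define good where "good f f' \<longleftrightarrow> f' \<in> orb f \<and> tail X f' \<in> C \<and>
    ((\<exists>a\<in>orb f. tail X a \<in> C \<and> head X a \<in> C) \<longrightarrow> head X f' \<in> C)" for f f'
  define \<rho> where "\<rho> f = (SOME f'. good f f')" for f
  have orb_self: "f \<in> orb f" if "f \<in> arcs X" for f
    unfolding orb_def using that ae_one[of f] by (metis H.one_closed imageI)
  have orb_eq: "orb (ae h f) = orb f" if "h \<in> carrier H" "f \<in> arcs X" for h f
  proof -
    have "ae k (ae h f) \<in> orb f" if "k \<in> carrier H" for k
    proof -
      have "ae k (ae h f) = ae (k \<otimes>\<^bsub>H\<^esub> h) f"
        using that \<open>h \<in> carrier H\<close> \<open>f \<in> arcs X\<close> by (simp add: ae_mult)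
      then show ?thesis unfolding orb_def using that \<open>h \<in> carrier H\<close> by blast
    qed
    moreover have "ae k f \<in> orb (ae h f)" if "k \<in> carrier H" for k
    proof -
      have "ae k f = ae (k \<otimes>\<^bsub>H\<^esub> inv\<^bsub>H\<^esub> h) (ae h f)"
        using that \<open>h \<in> carrier H\<close> \<open>f \<in> arcs X\<close> by (simp add: ae_mult)
      then show ?thesis unfolding orb_def using that \<open>h \<in> carrier H\<close> by blast
    qed
    ultimately show ?thesis by (auto simp: orb_def)
  qed
  have good: "good f (\<rho> f)" if f: "f \<in> arcs X" for f
    unfolding \<rho>_def
  proof (rule someI_ex)
    show "\<exists>f'. good f f'"
    proof (cases "\<exists>a\<in>orb f. tail X a \<in> C \<and> head X a \<in> C")
      case True
      then show ?thesis unfolding good_def by blast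
    next
      case False
      obtain h v where h: "h \<in> carrier H" "v \<in> C" "tail X f = av h v" using C(3)[of "tail X f"] f by auto
      have "ae (inv\<^bsub>H\<^esub> h) f \<in> orb f" unfolding orb_def using h by blast
      moreover have "tail X (ae (inv\<^bsub>H\<^esub> h) f) = v" using h f C(1) by (simp add: subset_iff)
      ultimately show ?thesis using False h unfolding good_def by blast
    qed
  qed
  \<comment> \<open>As \<open>good f\<close> depends only on the orbit of \<open>f\<close>, the
    choice is constant on orbits.\<close>
  have good_ae: "good (ae h f) = good f" if "h \<in> carrier H" "f \<in> arcs X" for h f
    unfolding good_def using orb_eq[OF that] by simp
  then have \<rho>_ae: "\<rho> (ae h f) = \<rho> f" if "h \<in> carrier H" "f \<in> arcs X" for h f
    unfolding \<rho>_def using that by simp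
  have \<rho>: "\<exists>h\<in>carrier H. \<rho> f = ae h f" if "f \<in> arcs X" for f
    using good[OF that] unfolding good_def orb_def by blast
  let ?P = "\<rho> ` (arcs X \<inter> Or)"
  have 1: "?P \<subseteq> arcs X \<inter> Or"
  proof
    fix f assume "f \<in> ?P"
    then obtain a where a: "a \<in> arcs X" "a \<in> Or" "f = \<rho> a" by blast
    then obtain h where "h \<in> carrier H" "f = ae h a" using \<rho> by blast
    then show "f \<in> arcs X \<inter> Or" using a Or_ae by simp
  qed
  have 2: "tail X ` ?P \<subseteq> C" using good unfolding good_def by blast
  have 3: "ae h f = f" if f: "f \<in> ?P" "h \<in> carrier H" "ae h f \<in> ?P" for f h
  proof -
    have fixed: "\<rho> f = f" if f: "f \<in> ?P" for f
    proof -
      obtain a where a: "a \<in> arcs X" "f = \<rho> a" using f by blast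
      then obtain h where "h \<in> carrier H" "f = ae h a" using \<rho> by blast
      then show ?thesis using a \<rho>_ae by metis
    qed
    have "f \<in> arcs X" using f(1) 1 by blast
    then show ?thesis using fixed[OF f(1)] fixed[OF f(3)] \<rho>_ae f(2) by metis
  qed
  have 4: "\<exists>h\<in>carrier H. \<exists>f'\<in>?P. f = ae h f'" if f: "f \<in> arcs X \<inter> Or" for f
  proof -
    obtain h where h: "h \<in> carrier H" "\<rho> f = ae h f" using \<rho> f by blast
    then have "f = ae (inv\<^bsub>H\<^esub> h) (\<rho> f)" using f by simp
    then show ?thesis using h f H.inv_closed by blast
  qed
  \<comment> \<open>\<open>f\<close> and its representative are translates with all ends in
    \<open>C\<close>, so their ends agree, and a tree has no parallel arcs.\<close>
  have 5: "f \<in> ?P" if f: "f \<in> arcs X \<inter> Or" "tail X f \<in> C" "head X f \<in> C" for f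
  proof -
    obtain h where h: "h \<in> carrier H" "\<rho> f = ae h f" using \<rho> f by blast
    have "tail X (\<rho> f) \<in> C" "head X (\<rho> f) \<in> C"
      using good[of f] f orb_self[of f] unfolding good_def by blast+
    then have "tail X (\<rho> f) = tail X f" "head X (\<rho> f) = head X f"
      using C(2)[of "tail X f" h] C(2)[of "head X f" h] h f by auto
    then have "\<rho> f = f" using arc_unique[of "\<rho> f" f] h f by simp
    then show ?thesis using f(1) by (metis imageI)
  qed
  show ?thesis
    by (intro exI[of _ ?P] conjI ballI impI 1 2) (rule 3 4 5; assumption)+
qed

end

section \<open>The quotient graph of groups\<close>

text \<open>
  A tree \<open>C\<close> of representatives of the orbits of vertices, and representatives \<open>P\<close> of the orbits
  of positive arcs, with tails in \<open>C\<close>. The element \<open>\<gamma> f\<close> translates a vertex of \<open>C\<close> to the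
  head of \<open>f\<close>.
\<close>

locale orbit_reps = tree_action X rv H av ae Or
  for X :: "('b, 'c) pre_digraph" and rv and H :: "'g monoid" and av ae Or +
  fixes x0 :: 'b and C :: "'b set" and P :: "'c set" and \<gamma> :: "'c \<Rightarrow> 'g"
  assumes C_sub: "C \<subseteq> verts X" and x0: "x0 \<in> C"
    and C_inj: "v \<in> C \<Longrightarrow> h \<in> carrier H \<Longrightarrow> av h v \<in> C \<Longrightarrow> av h v = v"
    and C_ex: "y \<in> verts X \<Longrightarrow> \<exists>h\<in>carrier H. \<exists>v\<in>C. y = av h v"
    and C_par: "y \<in> C \<Longrightarrow> y \<noteq> x0 \<Longrightarrow>
      \<exists>f\<in>arcs X. head X f = y \<and> tail X f \<in> C \<and> depth x0 y = Suc (depth x0 (tail X f))"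
    and P_sub: "P \<subseteq> arcs X \<inter> Or" and P_tail: "f \<in> P \<Longrightarrow> tail X f \<in> C"
    and P_inj: "f \<in> P \<Longrightarrow> h \<in> carrier H \<Longrightarrow> ae h f \<in> P \<Longrightarrow> ae h f = f"
    and P_ex: "f \<in> arcs X \<Longrightarrow> f \<in> Or \<Longrightarrow> \<exists>h\<in>carrier H. \<exists>f'\<in>P. f = ae h f'"
    and P_tree: "f \<in> arcs X \<Longrightarrow> f \<in> Or \<Longrightarrow> tail X f \<in> C \<Longrightarrow> head X f \<in> C \<Longrightarrow> f \<in> P"
    and \<gamma>: "f \<in> P \<Longrightarrow> \<gamma> f \<in> carrier H" "f \<in> P \<Longrightarrow> av (inv\<^bsub>H\<^esub> (\<gamma> f)) (head X f) \<in> C"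
    and \<gamma>_tree: "f \<in> P \<Longrightarrow> head X f \<in> C \<Longrightarrow> \<gamma> f = \<one>\<^bsub>H\<^esub>"

lemma (in tree_action) orbit_reps_exist:
  "\<exists>x0 C P \<gamma>. orbit_reps X rv H av ae Or x0 C P \<gamma>"
proof -
  obtain x0 where x0: "x0 \<in> verts X" using connected by (auto simp: connected_conv)
  obtain C where C: "C \<subseteq> verts X" "x0 \<in> C" "\<forall>v\<in>C. \<forall>h\<in>carrier H. av h v \<in> C \<longrightarrow> av h v = v"
    "\<forall>y\<in>verts X. \<exists>h\<in>carrier H. \<exists>v\<in>C. y = av h v"
    "\<forall>y\<in>C. y \<noteq> x0 \<longrightarrow> (\<exists>f\<in>arcs X. head X f = y \<and> tail X f \<in> C \<and> depth x0 y = Suc (depth x0 (tail X f)))"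
    using transversal_exists[OF x0] by (elim exE conjE)
  obtain P where P: "P \<subseteq> arcs X \<inter> Or" "tail X ` P \<subseteq> C"
    "\<forall>f\<in>P. \<forall>h\<in>carrier H. ae h f \<in> P \<longrightarrow> ae h f = f"
    "\<forall>f\<in>arcs X \<inter> Or. \<exists>h\<in>carrier H. \<exists>f'\<in>P. f = ae h f'"
    "\<forall>f\<in>arcs X \<inter> Or. tail X f \<in> C \<longrightarrow> head X f \<in> C \<longrightarrow> f \<in> P"
    using arc_reps_exist[OF C(1,3,4)] by (elim exE conjE)
  have "\<exists>h. h \<in> carrier H \<and> av (inv\<^bsub>H\<^esub> h) (head X f) \<in> C \<and> (head X f \<in> C \<longrightarrow> h = \<one>\<^bsub>H\<^esub>)" if "f \<in> P" for f
  proof (cases "head X f \<in> C")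
    case True
    then show ?thesis using C(1) by (intro exI[of _ "\<one>\<^bsub>H\<^esub>"]) auto
  next
    case False
    have "head X f \<in> verts X" using P(1) that by auto
    then obtain h v where h: "h \<in> carrier H" "v \<in> C" "head X f = av h v"
      using C(4) by blast
    then show ?thesis using False C(1) by (intro exI[of _ h]) (simp add: subset_iff)
  qed
  then obtain \<gamma> where \<gamma>: "\<gamma> f \<in> carrier H \<and> av (inv\<^bsub>H\<^esub> (\<gamma> f)) (head X f) \<in> C \<and>
      (head X f \<in> C \<longrightarrow> \<gamma> f = \<one>\<^bsub>H\<^esub>)" if "f \<in> P" for f
    by metis
  have "orbit_reps X rv H av ae Or x0 C P \<gamma>"
  proof unfold_locales
    show "C \<subseteq> verts X" "x0 \<in> C" "P \<subseteq> arcs X \<inter> Or" using C(1,2) P(1) by auto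
    show "av h v = v" if "v \<in> C" "h \<in> carrier H" "av h v \<in> C" for v h
      using C(3) that by blast
    show "\<exists>h\<in>carrier H. \<exists>v\<in>C. y = av h v" if "y \<in> verts X" for y
      using C(4) that by blast
    show "\<exists>f\<in>arcs X. head X f = y \<and> tail X f \<in> C \<and> depth x0 y = Suc (depth x0 (tail X f))"
      if "y \<in> C" "y \<noteq> x0" for y
      using C(5) that by blast
    show "tail X f \<in> C" if "f \<in> P" for f
      using P(2) that by blast
    show "ae h f = f" if "f \<in> P" "h \<in> carrier H" "ae h f \<in> P" for f h
      using P(3) that by blast
    show "\<exists>h\<in>carrier H. \<exists>f'\<in>P. f = ae h f'" if "f \<in> arcs X" "f \<in> Or" for f
      using P(4) that by blast
    show "f \<in> P" if "f \<in> arcs X" "f \<in> Or" "tail X f \<in> C" "head X f \<in> C" for f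
      using P(5) that by blast
    show "\<gamma> f \<in> carrier H" "av (inv\<^bsub>H\<^esub> (\<gamma> f)) (head X f) \<in> C" if "f \<in> P" for f
      using \<gamma>[OF that] by simp_all
    show "\<gamma> f = \<one>\<^bsub>H\<^esub>" if "f \<in> P" "head X f \<in> C" for f
      using \<gamma>[OF that(1)] that(2) by simp
  qed
  then show ?thesis by blast
qed

context orbit_reps
begin

text \<open>The reverse of a positive representative need not start in \<open>C\<close>; this
  translate of it does.\<close>

definition flip :: "'c \<Rightarrow> 'c" where
  "flip f = ae (inv\<^bsub>H\<^esub> (\<gamma> f)) (rv f)"

definition reps :: "'c set" where
  "reps = P \<union> flip ` P"

text \<open>The element of \<open>H\<close> that the letter of \<open>r\<close> will denote:
  \<open>\<gamma>\<close>, extended so that reversed representatives get inverse elements.\<close>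

definition gam :: "'c \<Rightarrow> 'g" where
  "gam r = (if r \<in> P then \<gamma> r else inv\<^bsub>H\<^esub> (\<gamma> (the_inv_into P flip r)))"

definition qrev :: "'c \<Rightarrow> 'c" where
  "qrev r = (if r \<in> reps then ae (inv\<^bsub>H\<^esub> (gam r)) (rv r) else r)"

text \<open>The quotient graph realized on representatives: the head of \<open>r\<close> is moved
  back to the vertex of \<open>C\<close> in its orbit.\<close>

definition qgraph :: "('b, 'c) pre_digraph" where
  "qgraph = \<lparr>verts = C, arcs = reps, tail = tail X, head = (\<lambda>r. av (inv\<^bsub>H\<^esub> (gam r)) (head X r))\<rparr>"

definition qtree :: "'c set" where
  "qtree = {f \<in> arcs X. tail X f \<in> C \<and> head X f \<in> C}"

text \<open>The group of an arc has to coincide with that of the reversed arc; it is the stabilizer of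
  the positive one of the two.\<close>

definition qdec :: "(('b, 'c, 'g) generator word set \<Rightarrow> 'z) \<Rightarrow> ('b, 'c, 'g, 'g, 'z) decomposition" where
  "qdec \<iota> =
    \<lparr>base = qgraph, arev = qrev, vgroup = (\<lambda>v. H\<lparr>carrier := Stab v\<rparr>),
     egroup = (\<lambda>r. H\<lparr>carrier := EStab (if r \<in> P then r else qrev r)\<rparr>),
     emb = (\<lambda>r a. if r \<in> P then inv\<^bsub>H\<^esub> (\<gamma> r) \<otimes>\<^bsub>H\<^esub> a \<otimes>\<^bsub>H\<^esub> \<gamma> r else a),
     mtree = qtree, ident = \<iota>\<rparr>"

lemma qdec_simps [simp]:
  "base (qdec \<iota>) = qgraph" "arev (qdec \<iota>) = qrev" "vgroup (qdec \<iota>) v = H\<lparr>carrier := Stab v\<rparr>"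
  "egroup (qdec \<iota>) r = H\<lparr>carrier := EStab (if r \<in> P then r else qrev r)\<rparr>"
  "emb (qdec \<iota>) r = (\<lambda>a. if r \<in> P then inv\<^bsub>H\<^esub> (\<gamma> r) \<otimes>\<^bsub>H\<^esub> a \<otimes>\<^bsub>H\<^esub> \<gamma> r else a)"
  "mtree (qdec \<iota>) = qtree" "ident (qdec \<iota>) = \<iota>"
  by (simp_all add: qdec_def)

lemma qgraph_simps [simp]:
  "verts qgraph = C" "arcs qgraph = reps" "tail qgraph = tail X"
  "head qgraph r = av (inv\<^bsub>H\<^esub> (gam r)) (head X r)"
  by (simp_all add: qgraph_def)

lemma P_arcs: "f \<in> P \<Longrightarrow> f \<in> arcs X" and P_Or: "f \<in> P \<Longrightarrow> f \<in> Or"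
  using P_sub by auto

lemma flip:
  assumes f: "f \<in> P"
  shows "flip f \<in> arcs X" "flip f \<notin> Or" "flip f \<notin> P"
    "tail X (flip f) = av (inv\<^bsub>H\<^esub> (\<gamma> f)) (head X f)" "head X (flip f) = av (inv\<^bsub>H\<^esub> (\<gamma> f)) (tail X f)"
proof -
  show *: "flip f \<in> arcs X" "flip f \<notin> Or"
    "tail X (flip f) = av (inv\<^bsub>H\<^esub> (\<gamma> f)) (head X f)" "head X (flip f) = av (inv\<^bsub>H\<^esub> (\<gamma> f)) (tail X f)"
    using \<gamma>(1)[OF f] P_arcs[OF f] P_Or[OF f] by (simp_all add: flip_def Or_ae Or_rv)
  show "flip f \<notin> P" using *(2) P_Or by blast
qed

text \<open>Arcs with equal flips are translates of each other, and \<open>P\<close> contains only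
  one arc of each orbit. This justifies the inverse of \<open>flip\<close> in
  \<open>gam\<close>.\<close>

lemma inj_flip: "inj_on flip P"
proof (rule inj_onI)
  fix f f' assume f: "f \<in> P" "f' \<in> P" "flip f = flip f'"
  let ?h = "\<gamma> f' \<otimes>\<^bsub>H\<^esub> inv\<^bsub>H\<^esub> (\<gamma> f)"
  have g: "\<gamma> f \<in> carrier H" "\<gamma> f' \<in> carrier H" using \<gamma> f by auto
  have "rv f' = ae (\<gamma> f') (flip f')" using g f P_arcs by (simp add: flip_def)
  also have "\<dots> = ae ?h (rv f)" unfolding f(3)[symmetric]
    using g f P_arcs by (simp add: flip_def ae_mult)
  also have "\<dots> = rv (ae ?h f)" using g f P_arcs by (simp add: ae_rv)
  finally have "f' = ae ?h f" by (metis arev_arev)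
  then show "f = f'" using P_inj[of f ?h] f g by simp
qed

lemma reps_cases:
  assumes "r \<in> reps"
  obtains "r \<in> P" "gam r = \<gamma> r"
  | f where "f \<in> P" "r = flip f" "gam r = inv\<^bsub>H\<^esub> (\<gamma> f)" "r \<notin> P"
  using assms flip(3) the_inv_into_f_f[OF inj_flip] unfolding reps_def gam_def by auto

lemma reps_arcs [simp]: "r \<in> reps \<Longrightarrow> r \<in> arcs X"
  using P_arcs flip(1) by (auto simp: reps_def)

lemma gam_closed [simp]: "r \<in> reps \<Longrightarrow> gam r \<in> carrier H"
  by (erule reps_cases) (use \<gamma>(1) in auto)

lemma qrev_flip: "f \<in> P \<Longrightarrow> qrev f = flip f" "f \<in> P \<Longrightarrow> qrev (flip f) = f"
proof -
  assume f: "f \<in> P"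
  then have r: "f \<in> reps" "flip f \<in> reps" by (auto simp: reps_def)
  show "qrev f = flip f" using f r by (simp add: qrev_def flip_def gam_def)
  have "gam (flip f) = inv\<^bsub>H\<^esub> (\<gamma> f)" using f flip(3) the_inv_into_f_f[OF inj_flip] by (simp add: gam_def)
  then show "qrev (flip f) = f"
    using f r P_arcs \<gamma>(1) by (simp add: qrev_def flip_def ae_rv)
qed

lemma qrev_facts:
  assumes r: "r \<in> reps"
  shows "qrev r \<in> reps" "qrev (qrev r) = r" "gam (qrev r) = inv\<^bsub>H\<^esub> (gam r)" "qrev r \<in> P \<longleftrightarrow> r \<notin> P"
proof -
  have "qrev r \<in> reps \<and> qrev (qrev r) = r \<and> gam (qrev r) = inv\<^bsub>H\<^esub> (gam r) \<and> (qrev r \<in> P \<longleftrightarrow> r \<notin> P)"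
    using r
  proof (cases rule: reps_cases)
    case 1
    then show ?thesis using flip(3) the_inv_into_f_f[OF inj_flip]
      by (simp add: qrev_flip gam_def reps_def)
  next
    case (2 f)
    then show ?thesis using \<gamma>(1) by (simp add: qrev_flip gam_def reps_def)
  qed
  then show "qrev r \<in> reps" "qrev (qrev r) = r" "gam (qrev r) = inv\<^bsub>H\<^esub> (gam r)" "qrev r \<in> P \<longleftrightarrow> r \<notin> P"
    by auto
qed

lemma qrev_eq: "r \<in> reps \<Longrightarrow> qrev r = ae (inv\<^bsub>H\<^esub> (gam r)) (rv r)"
  by (simp add: qrev_def)

lemma reps_tail: "r \<in> reps \<Longrightarrow> tail X r \<in> C"
  by (erule reps_cases) (use P_tail \<gamma>(2) in \<open>auto simp: flip\<close>)

lemma reps_head: "r \<in> reps \<Longrightarrow> head qgraph r = tail X (qrev r)"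
  by (simp add: qrev_eq)

lemma bidirected_qgraph: "bidirected_digraph qgraph qrev"
proof -
  have "wf_digraph qgraph"
    using reps_tail reps_head qrev_facts(1) by unfold_locales (auto simp del: qgraph_simps(4))
  then show ?thesis
  proof (rule wf_digraph.bidirected_digraphI)
    show "qrev r = r" if "r \<notin> arcs qgraph" for r using that by (simp add: qrev_def)
    show "qrev r \<noteq> r" if "r \<in> arcs qgraph" for r using that qrev_facts(4)[of r] by auto
    show "qrev (qrev r) = r" if "r \<in> arcs qgraph" for r using that qrev_facts(2)[of r] by simp
    show "tail qgraph (qrev r) = head qgraph r" if "r \<in> arcs qgraph" for r
      using that reps_head[of r] by simp
  qed
qed

text \<open>Arcs inside \<open>C\<close> need no translation: \<open>P_tree\<close> and
  \<open>\<gamma>_tree\<close> are arranged so that these arcs get the trivial element and keep the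
  reversal of \<open>X\<close>.\<close>

lemma gam_tree:
  assumes "r \<in> qtree" shows "r \<in> reps" "gam r = \<one>\<^bsub>H\<^esub>" "qrev r = rv r"
proof -
  have r: "r \<in> arcs X" "tail X r \<in> C" "head X r \<in> C" using assms by (auto simp: qtree_def)
  have "r \<in> reps \<and> gam r = \<one>\<^bsub>H\<^esub>"
  proof (cases "r \<in> Or")
    case True
    then have "r \<in> P" using r P_tree by blast
    then show ?thesis using r \<gamma>_tree by (simp add: reps_def gam_def)
  next
    case False
    then have p: "rv r \<in> P" using r Or_rv[of r] by (intro P_tree) auto
    then have "\<gamma> (rv r) = \<one>\<^bsub>H\<^esub>" using r by (intro \<gamma>_tree) auto
    then have "flip (rv r) = r" using r by (simp add: flip_def)
    moreover have "flip (rv r) \<in> reps" using p by (simp add: reps_def)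
    ultimately have "r \<in> reps" "qrev (rv r) = r" using qrev_flip(1)[OF p] by simp_all
    moreover have "rv r \<in> reps" "gam (rv r) = \<one>\<^bsub>H\<^esub>"
      using p \<open>\<gamma> (rv r) = \<one>\<^bsub>H\<^esub>\<close> by (simp_all add: reps_def gam_def)
    ultimately show ?thesis using qrev_facts(3)[of "rv r"] by simp
  qed
  then show "r \<in> reps" "gam r = \<one>\<^bsub>H\<^esub>" "qrev r = rv r" using r by (auto simp: qrev_eq)
qed

lemma qtree_rv: "r \<in> qtree \<Longrightarrow> rv r \<in> qtree"
  by (auto simp: qtree_def)

lemma qtree_head: "r \<in> qtree \<Longrightarrow> head qgraph r = head X r"
  using gam_tree[of r] by (auto simp: qtree_def)

lemma wf_qtree: "wf_digraph (qgraph\<lparr>arcs := qtree\<rparr>)"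
  by unfold_locales (auto simp: qtree_head simp del: qgraph_simps(4), auto simp: qtree_def)

lemma connected_qtree: "connected (qgraph\<lparr>arcs := qtree\<rparr>)"
proof (rule wf_digraph.connectedI_closed[OF wf_qtree])
  show "x0 \<in> verts (qgraph\<lparr>arcs := qtree\<rparr>)" using x0 by simp
  fix Q y
  assume Q: "Q x0" and y: "y \<in> verts (qgraph\<lparr>arcs := qtree\<rparr>)"
    and step: "\<And>f. f \<in> arcs (qgraph\<lparr>arcs := qtree\<rparr>) \<Longrightarrow>
      Q (tail (qgraph\<lparr>arcs := qtree\<rparr>) f) \<longleftrightarrow> Q (head (qgraph\<lparr>arcs := qtree\<rparr>) f)"
  have "Q y" if "y \<in> C" for y
    using that
  proof (induction "depth x0 y" arbitrary: y)
    case 0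
    then show ?case using depth_eq_0[of x0 y] C_sub x0 Q by auto
  next
    case (Suc n)
    then have "y \<noteq> x0" using depth_self[of x0] C_sub x0 by auto
    then obtain f where f: "f \<in> arcs X" "head X f = y" "tail X f \<in> C"
      "depth x0 y = Suc (depth x0 (tail X f))" using C_par Suc.prems by blast
    then have "f \<in> qtree" using Suc.prems by (auto simp: qtree_def)
    moreover have "Q (tail X f)" using Suc f by simp
    ultimately show ?case using step[of f] qtree_head[of f] f by simp
  qed
  then show "Q y" using y by simp
qed

lemma connected_qgraph: "connected qgraph"
proof -
  interpret Q: bidirected_digraph qgraph qrev by (rule bidirected_qgraph)
  show ?thesis
  proof (rule Q.connectedI_closed)
    show "x0 \<in> verts qgraph" using x0 by simp
    fix S y
    assume S: "S x0" "y \<in> verts qgraph"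
      "\<And>f. f \<in> arcs qgraph \<Longrightarrow> S (tail qgraph f) \<longleftrightarrow> S (head qgraph f)"
    show "S y"
      by (rule wf_digraph.connected_induct[OF wf_qtree connected_qtree, of x0])
        (use S x0 gam_tree(1) in auto)
  qed
qed

lemma maximal_tree_qdec: "maximal_tree (qdec \<iota>) qtree"
  unfolding maximal_tree_def qdec_simps
proof (intro conjI allI impI)
  let ?T = "qgraph\<lparr>arcs := qtree\<rparr>"
  show "qtree \<subseteq> arcs qgraph" "qrev ` qtree \<subseteq> qtree"
    using gam_tree qtree_rv by auto
  show "connected ?T" by (rule connected_qtree)
  fix p assume "pre_digraph.cycle ?T p"
  then obtain u where p: "pre_digraph.awalk ?T u p u" "distinct (tl (pre_digraph.awalk_verts ?T u p))" "p \<noteq> []"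
    unfolding pre_digraph.cycle_def by blast
  have q: "set p \<subseteq> qtree" "u \<in> C" using p(1) by (auto simp: pre_digraph.awalk_def)
  \<comment> \<open>Arcs of \<open>qtree\<close> have the same ends in \<open>qgraph\<close> as in
    \<open>X\<close>, so a circuit of \<open>qtree\<close> is a circuit of the tree
    \<open>X\<close>.\<close>
  have cas: "pre_digraph.cas ?T u p v = cas u p v \<and> pre_digraph.awalk_verts ?T u p = awalk_verts u p"
    if "set p \<subseteq> qtree" for u v p
    using that by (induction p arbitrary: u)
      (simp_all add: pre_digraph.cas.simps pre_digraph.awalk_verts.simps qtree_head del: qgraph_simps(4))
  have "awalk u p u"
    using p(1) cas[OF q(1)] q C_sub by (auto simp: pre_digraph.awalk_def qtree_def)
  moreover have "distinct (tl (awalk_verts u p))"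
    using p(2) cas[OF q(1)] by metis
  ultimately have "cycle p" using p(3) unfolding cycle_def by blast
  then obtain e where e: "p = [e, rv e]" using cycle_trivial by blast
  then show "\<exists>e. p = [e, qrev e]" using q gam_tree(3)[of e] by (intro exI[of _ e]) auto
qed

lemma EStab_tail: "f \<in> arcs X \<Longrightarrow> a \<in> EStab f \<Longrightarrow> a \<in> Stab (tail X f)"
  unfolding EStab_def Stab_def using tail_ae by fastforce

lemma EStab_head: "f \<in> arcs X \<Longrightarrow> a \<in> EStab f \<Longrightarrow> a \<in> Stab (head X f)"
  unfolding EStab_def Stab_def using head_ae by fastforce

lemma Stab_conj:
  assumes "g \<in> carrier H" "v \<in> verts X" "a \<in> Stab v"
  shows "inv\<^bsub>H\<^esub> g \<otimes>\<^bsub>H\<^esub> a \<otimes>\<^bsub>H\<^esub> g \<in> Stab (av (inv\<^bsub>H\<^esub> g) v)"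
  using assms by (auto simp: Stab_def av_mult)

lemma wf_qdec: "wf_graph_of_groups (qdec \<iota>)"
proof -
  have sub: "group (H\<lparr>carrier := K\<rparr>)" if "subgroup K H" for K
    using subgroup.subgroup_is_group[OF that H.group_axioms] .
  have emb: "emb (qdec \<iota>) r \<in> mon (egroup (qdec \<iota>) r) (vgroup (qdec \<iota>) (head qgraph r))"
    if "r \<in> reps" for r
    using that
  proof (cases rule: reps_cases)
    case 1
    have g: "\<gamma> r \<in> carrier H" "r \<in> arcs X" using 1 \<gamma>(1) P_arcs by auto
    have cl: "a \<in> carrier H" if "a \<in> EStab r" for a using that by (simp add: EStab_def)
    have "inv\<^bsub>H\<^esub> \<gamma> r \<otimes>\<^bsub>H\<^esub> a \<otimes>\<^bsub>H\<^esub> \<gamma> r \<in> Stab (head qgraph r)" if "a \<in> EStab r" for a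
      using Stab_conj[of "\<gamma> r" "head X r" a] EStab_head[of r a] that g 1 by simp
    moreover have "inv\<^bsub>H\<^esub> \<gamma> r \<otimes>\<^bsub>H\<^esub> (a \<otimes>\<^bsub>H\<^esub> b) \<otimes>\<^bsub>H\<^esub> \<gamma> r =
        inv\<^bsub>H\<^esub> \<gamma> r \<otimes>\<^bsub>H\<^esub> a \<otimes>\<^bsub>H\<^esub> \<gamma> r \<otimes>\<^bsub>H\<^esub> (inv\<^bsub>H\<^esub> \<gamma> r \<otimes>\<^bsub>H\<^esub> b \<otimes>\<^bsub>H\<^esub> \<gamma> r)"
      if "a \<in> EStab r" "b \<in> EStab r" for a b
      using cl that g by (simp add: H.m_assoc H.mult_inv_cancel)
    moreover have "inj_on (\<lambda>a. inv\<^bsub>H\<^esub> \<gamma> r \<otimes>\<^bsub>H\<^esub> a \<otimes>\<^bsub>H\<^esub> \<gamma> r) (EStab r)"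
      using cl g by (auto intro!: inj_onI)
    ultimately show ?thesis
      using 1 by (auto simp: mon_def hom_def simp del: qgraph_simps(4))
  next
    case (2 f)
    then have "head qgraph r = tail X f" "qrev r = f"
      using P_arcs \<gamma>(1) by (simp_all add: flip qrev_flip)
    then show ?thesis
      using 2 EStab_tail[of f] P_arcs
      by (auto simp: mon_def hom_def inj_on_def simp del: qgraph_simps(4))
  qed
  have P_reps: "P \<subseteq> reps" by (auto simp: reps_def)
  show ?thesis
    unfolding wf_graph_of_groups_def
  proof (intro conjI ballI)
    show "bidirected_digraph (base (qdec \<iota>)) (arev (qdec \<iota>))" using bidirected_qgraph by simp
    show "connected (base (qdec \<iota>))" using connected_qgraph by simp
    show "group (vgroup (qdec \<iota>) v)" if "v \<in> verts (base (qdec \<iota>))" for v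
      using that C_sub by (auto intro!: sub Stab_subgroup)
    fix r assume "r \<in> arcs (base (qdec \<iota>))"
    then have r: "r \<in> reps" by simp
    show "group (egroup (qdec \<iota>) r)"
      using r qrev_facts(1)[OF r] by (auto intro!: sub EStab_subgroup)
    show "egroup (qdec \<iota>) (arev (qdec \<iota>) r) = egroup (qdec \<iota>) r"
      using qrev_facts[OF r] by auto
    show "emb (qdec \<iota>) r \<in> mon (egroup (qdec \<iota>) r) (vgroup (qdec \<iota>) (head (base (qdec \<iota>)) r))"
      using emb[OF r] by simp
  qed
qed

section \<open>The fundamental group of the quotient is the acting group\<close>

definition qgens :: "('b, 'c, 'g) generator set" where
  "qgens = fg_generators (qdec id)"

definition qrels :: "('b, 'c, 'g) generator word set" where
  "qrels = fg_relators (qdec id) qtree"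

definition qval :: "('b, 'c, 'g) generator \<Rightarrow> 'g" where
  "qval x = (case x of Vtx v h \<Rightarrow> h | Edg r \<Rightarrow> gam r)"

abbreviation "A \<equiv> presented_group qgens qrels"

lemma fg_qdec: "fg_generators (qdec \<iota>) = qgens" "fg_relators (qdec \<iota>) qtree = qrels"
  by (simp_all only: qgens_def qrels_def fg_generators_def fg_relators_def qdec_simps)

lemma qdec_decomposition:
  assumes "\<iota> \<in> iso A G"
  shows "graph_of_groups_decomposition G (qdec \<iota>)"
  using assms wf_qdec[of \<iota>] maximal_tree_qdec[of \<iota>]
  by (simp add: graph_of_groups_decomposition_def fundamental_group_def fg_qdec)

text \<open>With the identity as identification, \<open>A\<close> decomposes tautologically, so the
  relations proved for decomposed groups hold among its generators.\<close>

sublocale K: decomposed_group A "qdec id"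
proof -
  have "id \<in> iso A A" using iso_set_refl by (simp add: id_def)
  then show "decomposed_group A (qdec id)"
    using qdec_decomposition[of id A] group_presented_group
    by (simp add: decomposed_group_def decomposed_group_axioms_def)
qed

lemma qgens_iff [simp]:
  "Vtx v h \<in> qgens \<longleftrightarrow> v \<in> C \<and> h \<in> Stab v" "Edg r \<in> qgens \<longleftrightarrow> r \<in> reps"
  using K.gens_iff(1)[of v h] K.gens_iff(2)[of r] by (simp_all add: qgens_def)

lemma Stab_carrier: "h \<in> Stab v \<Longrightarrow> h \<in> carrier H"
  by (simp add: Stab_def)

lemma qval_closed: "qval \<in> qgens \<rightarrow> carrier H"
proof
  fix x assume "x \<in> qgens"
  then show "qval x \<in> carrier H" using Stab_carrier by (cases x) (auto simp: qval_def)
qed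

abbreviation "vx v h \<equiv> K.gval (Vtx v h)"
abbreviation "ed r \<equiv> K.gval (Edg r)"

lemma vx_closed: "v \<in> C \<Longrightarrow> h \<in> Stab v \<Longrightarrow> vx v h \<in> carrier A"
  using K.gval_in[of "Vtx v h"] by (simp add: fg_qdec)

lemma ed_closed: "r \<in> reps \<Longrightarrow> ed r \<in> carrier A"
  using K.gval_in[of "Edg r"] by (simp add: fg_qdec)

lemma vx_mult: "v \<in> C \<Longrightarrow> h \<in> Stab v \<Longrightarrow> h' \<in> Stab v \<Longrightarrow> vx v (h \<otimes>\<^bsub>H\<^esub> h') = vx v h \<otimes>\<^bsub>A\<^esub> vx v h'"
  using K.gval_vtx_mult[of v h h'] by simp

lemma ed_qrev: "r \<in> reps \<Longrightarrow> ed r \<otimes>\<^bsub>A\<^esub> ed (qrev r) = \<one>\<^bsub>A\<^esub>"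
  using K.t_arev[of r] by simp

lemma ed_conj:
  assumes f: "f \<in> P" and a: "a \<in> EStab f"
  shows "ed f \<otimes>\<^bsub>A\<^esub> vx (head qgraph f) (inv\<^bsub>H\<^esub> \<gamma> f \<otimes>\<^bsub>H\<^esub> a \<otimes>\<^bsub>H\<^esub> \<gamma> f) = vx (tail X f) a \<otimes>\<^bsub>A\<^esub> ed f"
proof -
  have "f \<in> reps" using f by (simp add: reps_def)
  then show ?thesis using K.t_conj[of f a] qrev_facts(4)[of f] f a by simp
qed

lemma qval_relator:
  assumes r: "r \<in> qrels" "r \<in> words qgens"
  shows "wval H qval r = \<one>\<^bsub>H\<^esub>"
proof -
  consider
    (vtx) v x y where "v \<in> C" "x \<in> Stab v" "y \<in> Stab v"
      "r = [(Vtx v x, True), (Vtx v y, True), (Vtx v (x \<otimes>\<^bsub>H\<^esub> y), False)]"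
  | (rev) e where "e \<in> reps" "r = [(Edg e, True), (Edg (qrev e), True)]"
  | (conj) e a where "e \<in> reps" "a \<in> carrier (egroup (qdec id) e)"
      "r = [(Edg e, True), (Vtx (head qgraph e) (emb (qdec id) e a), True), (Edg e, False),
        (Vtx (tail X e) (emb (qdec id) (qrev e) a), False)]"
  | (tree) e where "e \<in> qtree" "r = [(Edg e, True)]"
    using r(1) unfolding qrels_def fg_relators_def by fastforce
  then show ?thesis
  proof cases
    case vtx
    then have "x \<in> carrier H" "y \<in> carrier H" using Stab_carrier by auto
    then have "x \<otimes>\<^bsub>H\<^esub> (y \<otimes>\<^bsub>H\<^esub> inv\<^bsub>H\<^esub> (x \<otimes>\<^bsub>H\<^esub> y)) = \<one>\<^bsub>H\<^esub>"
      by (simp add: H.m_assoc[symmetric])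
    then show ?thesis using vtx \<open>x \<in> carrier H\<close> \<open>y \<in> carrier H\<close> by (simp add: qval_def)
  next
    case rev
    then show ?thesis using qrev_facts by (simp add: qval_def)
  next
    case conj
    have a: "a \<in> carrier H" using conj by (simp add: EStab_def)
    show ?thesis
      using conj(1)
    proof (cases rule: reps_cases)
      case 1
      then have "\<gamma> e \<in> carrier H" using \<gamma> by simp
      then show ?thesis using 1 conj a qrev_facts(4)[of e]
        by (simp add: qval_def H.m_assoc H.mult_inv_cancel)
    next
      case (2 f)
      then have "\<gamma> f \<in> carrier H" "qrev e = f" using \<gamma> qrev_flip by auto
      then have *: "wval H qval r = inv\<^bsub>H\<^esub> \<gamma> f \<otimes>\<^bsub>H\<^esub> (a \<otimes>\<^bsub>H\<^esub> (\<gamma> f \<otimes>\<^bsub>H\<^esub>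
          inv\<^bsub>H\<^esub> (inv\<^bsub>H\<^esub> \<gamma> f \<otimes>\<^bsub>H\<^esub> a \<otimes>\<^bsub>H\<^esub> \<gamma> f)))"
        using 2 conj a by (simp add: qval_def)
      show ?thesis
        unfolding * using \<open>\<gamma> f \<in> carrier H\<close> a by (simp add: H.m_assoc[symmetric])
    qed
  next
    case tree
    then show ?thesis using gam_tree by (simp add: qval_def)
  qed
qed

lemma Stab_quot:
  assumes "h \<in> carrier H" "k \<in> carrier H" "v \<in> verts X" "av h v = av k v"
  shows "inv\<^bsub>H\<^esub> k \<otimes>\<^bsub>H\<^esub> h \<in> Stab v"
  using assms by (simp add: Stab_def av_mult)

text \<open>An inverse of the homomorphism from the fundamental group to \<open>H\<close>: label the arcs of the tree
  \<open>X\<close> by elements of the fundamental group and take a potential.\<close>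

lemma section_exists:
  "\<exists>F. (\<forall>h\<in>carrier H. F h \<in> carrier A) \<and>
    (\<forall>h\<in>carrier H. \<forall>x\<in>qgens. F (h \<otimes>\<^bsub>H\<^esub> qval x) = F h \<otimes>\<^bsub>A\<^esub> K.gval x)"
proof -
  have "\<forall>y\<in>verts X. \<exists>p. fst p \<in> carrier H \<and> snd p \<in> C \<and> y = av (fst p) (snd p)"
    using C_ex by fastforce
  then obtain kv where kv: "\<forall>y\<in>verts X. fst (kv y) \<in> carrier H \<and> snd (kv y) \<in> C \<and>
      y = av (fst (kv y)) (snd (kv y))"
    by (rule bchoice[THEN exE])
  \<comment> \<open>\<open>k y\<close> moves the representative \<open>vr y\<close> to
    \<open>y\<close>; \<open>l\<close> and \<open>pr\<close> below do the same for positive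
    arcs.\<close>
  define k vr where "k y = fst (kv y)" and "vr y = snd (kv y)" for y
  have k: "k y \<in> carrier H" "vr y \<in> C" "av (k y) (vr y) = y" if "y \<in> verts X" for y
    using kv that unfolding k_def vr_def by simp_all
  have "\<forall>f\<in>arcs X \<inter> Or. \<exists>p. fst p \<in> carrier H \<and> snd p \<in> P \<and> f = ae (fst p) (snd p)"
    using P_ex by fastforce
  then obtain lp where lp: "\<forall>f\<in>arcs X \<inter> Or. fst (lp f) \<in> carrier H \<and> snd (lp f) \<in> P \<and>
      f = ae (fst (lp f)) (snd (lp f))"
    by (rule bchoice[THEN exE])
  define l pr where "l f = fst (lp f)" and "pr f = snd (lp f)" for f
  have l: "l f \<in> carrier H" "pr f \<in> P" "ae (l f) (pr f) = f" if "f \<in> arcs X" "f \<in> Or" for f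
    using lp that unfolding l_def pr_def by simp_all
  have CV: "v \<in> verts X" if "v \<in> C" for v using C_sub that by blast
  have vr: "vr (av h v) = v" if "h \<in> carrier H" "v \<in> C" for h v
  proof -
    let ?y = "av h v"
    have y: "?y \<in> verts X" using that CV by simp
    have "vr ?y = av (inv\<^bsub>H\<^esub> (k ?y)) (av (k ?y) (vr ?y))"
      using k(1,2)[OF y] CV by (intro av_inv_cancel(1)[symmetric]) auto
    also have "\<dots> = av (inv\<^bsub>H\<^esub> (k ?y) \<otimes>\<^bsub>H\<^esub> h) v" using k[OF y] that CV by (simp add: av_mult)
    finally show ?thesis using C_inj[of v "inv\<^bsub>H\<^esub> (k ?y) \<otimes>\<^bsub>H\<^esub> h"] k[OF y] that by simp
  qed
  have pr: "pr (ae h f) = f" if "h \<in> carrier H" "f \<in> P" for h f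
  proof -
    let ?a = "ae h f"
    have a: "?a \<in> arcs X" "?a \<in> Or" using that P_arcs P_Or by (simp_all add: Or_ae)
    have "pr ?a = ae (inv\<^bsub>H\<^esub> (l ?a)) (ae (l ?a) (pr ?a))"
      using l(1,2)[OF a] P_arcs by (intro ae_inv_cancel(1)[symmetric]) auto
    also have "\<dots> = ae (inv\<^bsub>H\<^esub> (l ?a) \<otimes>\<^bsub>H\<^esub> h) f" using l[OF a] that P_arcs by (simp add: ae_mult)
    finally show ?thesis using P_inj[of f "inv\<^bsub>H\<^esub> (l ?a) \<otimes>\<^bsub>H\<^esub> h"] l[OF a] that by simp
  qed
  have hd: "head qgraph f \<in> C" "head qgraph f = av (inv\<^bsub>H\<^esub> \<gamma> f) (head X f)"
    "av (\<gamma> f) (head qgraph f) = head X f" "f \<in> reps"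
    if "f \<in> P" for f
    using that \<gamma>[OF that] P_arcs by (simp_all add: gam_def reps_def)
  \<comment> \<open>Passing from \<open>k\<close> at the tail to \<open>k\<close> at the head:
    \<open>k\<close> is corrected to \<open>l f\<close> in the stabilizer of the tail of
    \<open>pr f\<close>, the letter is crossed, and \<open>l f \<otimes> \<gamma> (pr f)\<close> is
    corrected to \<open>k\<close> in the stabilizer of the head in the quotient.\<close>
  define lab0 where "lab0 f = vx (vr (tail X f)) (inv\<^bsub>H\<^esub> (k (tail X f)) \<otimes>\<^bsub>H\<^esub> l f) \<otimes>\<^bsub>A\<^esub> ed (pr f) \<otimes>\<^bsub>A\<^esub>
      vx (vr (head X f)) (inv\<^bsub>H\<^esub> (l f \<otimes>\<^bsub>H\<^esub> \<gamma> (pr f)) \<otimes>\<^bsub>H\<^esub> k (head X f))" for f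
  have tail_stab: "vr (tail X f) = tail X (pr f)"
      "inv\<^bsub>H\<^esub> (k (tail X f)) \<otimes>\<^bsub>H\<^esub> l f \<in> Stab (tail X (pr f))"
    and head_stab: "vr (head X f) = head qgraph (pr f)"
      "inv\<^bsub>H\<^esub> (l f \<otimes>\<^bsub>H\<^esub> \<gamma> (pr f)) \<otimes>\<^bsub>H\<^esub> k (head X f) \<in> Stab (head qgraph (pr f))"
    if f: "f \<in> arcs X" "f \<in> Or" for f
  proof -
    note lf = l[OF f]
    have g: "\<gamma> (pr f) \<in> carrier H" and p: "pr f \<in> arcs X" using \<gamma> lf P_arcs by auto
    have t: "av (l f) (tail X (pr f)) = tail X f" using tail_ae[OF lf(1) p] lf by simp
    show 1: "vr (tail X f) = tail X (pr f)"
      using vr[of "l f" "tail X (pr f)"] t lf P_tail by simp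
    show "inv\<^bsub>H\<^esub> (k (tail X f)) \<otimes>\<^bsub>H\<^esub> l f \<in> Stab (tail X (pr f))"
      by (rule Stab_quot) (use k[of "tail X f"] 1 t lf p f in auto)
    have h: "av (l f \<otimes>\<^bsub>H\<^esub> \<gamma> (pr f)) (head qgraph (pr f)) = head X f"
      using head_ae[OF lf(1) p] lf g hd[OF lf(2)] CV by (simp add: av_mult del: qgraph_simps(4))
    show 2: "vr (head X f) = head qgraph (pr f)"
      using vr[of "l f \<otimes>\<^bsub>H\<^esub> \<gamma> (pr f)" "head qgraph (pr f)"] h lf g hd(1)[OF lf(2)]
      by (simp del: qgraph_simps(4))
    show "inv\<^bsub>H\<^esub> (l f \<otimes>\<^bsub>H\<^esub> \<gamma> (pr f)) \<otimes>\<^bsub>H\<^esub> k (head X f) \<in> Stab (head qgraph (pr f))"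
      by (rule Stab_quot) (use k[of "head X f"] 2 h lf g hd(1)[OF lf(2)] CV f in \<open>auto simp del: qgraph_simps(4)\<close>)
  qed
  have lab0_closed: "lab0 f \<in> carrier A" if f: "f \<in> arcs X" "f \<in> Or" for f
    unfolding lab0_def using tail_stab[OF f] head_stab[OF f] l[OF f] hd P_tail
    by (simp add: vx_closed ed_closed del: qgraph_simps(4))
  define lab where "lab f = (if f \<in> Or then lab0 f else inv\<^bsub>A\<^esub> (lab0 (rv f)))" for f
  have lab: "lab f \<in> carrier A" "lab f \<otimes>\<^bsub>A\<^esub> lab (rv f) = \<one>\<^bsub>A\<^esub>" if "f \<in> arcs X" for f
    using lab0_closed[of f] lab0_closed[of "rv f"] Or_rv[of f] that by (auto simp: lab_def)
  obtain c where c: "\<forall>v\<in>verts X. c v \<in> carrier A"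
    "\<forall>f\<in>arcs X. c (head X f) = c (tail X f) \<otimes>\<^bsub>A\<^esub> lab f"
    using potential_exists[of A lab, OF group_presented_group lab] by blast
  \<comment> \<open>\<open>c\<close> sees only the vertex \<open>av h v\<close>. Since
    \<open>k (av h v)\<close> and \<open>h\<close> both take \<open>v\<close> there, a letter from
    the stabilizer of \<open>v\<close> converts the one into the other.\<close>
  define F where "F v h = c (av h v) \<otimes>\<^bsub>A\<^esub> vx v (inv\<^bsub>H\<^esub> (k (av h v)) \<otimes>\<^bsub>H\<^esub> h)" for v h
  have quot: "inv\<^bsub>H\<^esub> (k (av h v)) \<otimes>\<^bsub>H\<^esub> h \<in> Stab v" if "v \<in> C" "h \<in> carrier H" for v h
    by (rule Stab_quot) (use k[of "av h v"] vr[of h v] that CV in auto)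
  have F_closed: "F v h \<in> carrier A" if "v \<in> C" "h \<in> carrier H" for v h
    unfolding F_def using vx_closed[OF that(1) quot[OF that]] c(1) that CV by simp
  have F_stab: "F v (h \<otimes>\<^bsub>H\<^esub> s) = F v h \<otimes>\<^bsub>A\<^esub> vx v s" if v: "v \<in> C" and h: "h \<in> carrier H" and s: "s \<in> Stab v" for v h s
  proof -
    have "av (h \<otimes>\<^bsub>H\<^esub> s) v = av h v" using v h s CV by (simp add: av_mult Stab_def)
    moreover have "vx v (inv\<^bsub>H\<^esub> (k (av h v)) \<otimes>\<^bsub>H\<^esub> (h \<otimes>\<^bsub>H\<^esub> s)) =
        vx v (inv\<^bsub>H\<^esub> (k (av h v)) \<otimes>\<^bsub>H\<^esub> h) \<otimes>\<^bsub>A\<^esub> vx v s"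
      using vx_mult[OF v quot[OF v h] s] h s k[of "av h v"] v CV
      by (simp add: H.m_assoc Stab_carrier)
    ultimately show ?thesis
      unfolding F_def using vx_closed[OF v quot[OF v h]] vx_closed[OF v s] c(1) h v CV
      by (simp add: K.m_assoc)
  qed
  have F_pos: "F (head qgraph f) (h \<otimes>\<^bsub>H\<^esub> \<gamma> f) = F (tail X f) h \<otimes>\<^bsub>A\<^esub> ed f"
    if f: "f \<in> P" and h: "h \<in> carrier H" for f h
  proof -
    define a v w y z where "a = ae h f" and "v = tail X f" and "w = head qgraph f"
      and "y = av h v" and "z = av (h \<otimes>\<^bsub>H\<^esub> \<gamma> f) w"
    have fX: "f \<in> arcs X" and g: "\<gamma> f \<in> carrier H" using f P_arcs \<gamma> by auto
    have a: "a \<in> arcs X" "a \<in> Or" "pr a = f"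
      using fX h f P_Or pr by (simp_all add: a_def Or_ae)
    have vw: "v \<in> C" "w \<in> C" using P_tail hd(1) f by (auto simp: v_def w_def)
    have ends: "tail X a = y" "head X a = z"
      using fX h g hd(3)[OF f] vw CV by (simp_all add: a_def y_def z_def v_def w_def av_mult del: qgraph_simps(4))
    have yz: "y \<in> verts X" "z \<in> verts X" using ends a by auto
    note la = l[OF a(1,2)]
    \<comment> \<open>\<open>s\<close> compares \<open>h\<close> with the chosen translation
      \<open>l a\<close> to the same arc. It fixes \<open>f\<close>, so \<open>ed_conj\<close>
      carries it across the letter and the corrections at both ends collapse.\<close>
    define s where "s = inv\<^bsub>H\<^esub> (l a) \<otimes>\<^bsub>H\<^esub> h"
    have s: "s \<in> EStab f"
      using la a fX h by (simp add: s_def EStab_def ae_mult) (metis a_def ae_inv_cancel(1))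
    have sv: "s \<in> Stab v" using EStab_tail[OF fX s] by (simp add: v_def)
    have sH: "s \<in> carrier H" using sv Stab_carrier by blast
    have kH: "k y \<in> carrier H" "k z \<in> carrier H" using k yz by auto
    have m1: "inv\<^bsub>H\<^esub> (k y) \<otimes>\<^bsub>H\<^esub> l a \<in> Stab v"
      using tail_stab(2)[OF a(1,2)] a ends by (simp add: v_def)
    have m2: "inv\<^bsub>H\<^esub> (l a \<otimes>\<^bsub>H\<^esub> \<gamma> f) \<otimes>\<^bsub>H\<^esub> k z \<in> Stab w"
      using head_stab(2)[OF a(1,2)] a ends by (simp add: w_def del: qgraph_simps(4))
    have m3: "inv\<^bsub>H\<^esub> (k z) \<otimes>\<^bsub>H\<^esub> (h \<otimes>\<^bsub>H\<^esub> \<gamma> f) \<in> Stab w"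
      using quot[OF vw(2), of "h \<otimes>\<^bsub>H\<^esub> \<gamma> f"] h g by (simp add: z_def)
    have labd: "lab0 a = vx v (inv\<^bsub>H\<^esub> (k y) \<otimes>\<^bsub>H\<^esub> l a) \<otimes>\<^bsub>A\<^esub> ed f \<otimes>\<^bsub>A\<^esub>
        vx w (inv\<^bsub>H\<^esub> (l a \<otimes>\<^bsub>H\<^esub> \<gamma> f) \<otimes>\<^bsub>H\<^esub> k z)"
      using tail_stab(1)[OF a(1,2)] head_stab(1)[OF a(1,2)] a ends
      by (simp add: lab0_def v_def w_def del: qgraph_simps(4))
    have cz: "c z = c y \<otimes>\<^bsub>A\<^esub> lab0 a" using c(2) a ends by (auto simp: lab_def)
    have e1: "inv\<^bsub>H\<^esub> (l a \<otimes>\<^bsub>H\<^esub> \<gamma> f) \<otimes>\<^bsub>H\<^esub> k z \<otimes>\<^bsub>H\<^esub> (inv\<^bsub>H\<^esub> (k z) \<otimes>\<^bsub>H\<^esub> (h \<otimes>\<^bsub>H\<^esub> \<gamma> f)) =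
        inv\<^bsub>H\<^esub> \<gamma> f \<otimes>\<^bsub>H\<^esub> s \<otimes>\<^bsub>H\<^esub> \<gamma> f"
      using kH la g h by (simp add: s_def H.m_assoc H.mult_inv_cancel H.inv_mult_group)
    have e2: "inv\<^bsub>H\<^esub> (k y) \<otimes>\<^bsub>H\<^esub> l a \<otimes>\<^bsub>H\<^esub> s = inv\<^bsub>H\<^esub> (k y) \<otimes>\<^bsub>H\<^esub> h"
      using kH la h by (simp add: s_def H.m_assoc H.mult_inv_cancel)
    have conj: "ed f \<otimes>\<^bsub>A\<^esub> vx w (inv\<^bsub>H\<^esub> \<gamma> f \<otimes>\<^bsub>H\<^esub> s \<otimes>\<^bsub>H\<^esub> \<gamma> f) = vx v s \<otimes>\<^bsub>A\<^esub> ed f"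
      using ed_conj[OF f s] by (simp add: v_def w_def)
    note cl = vx_closed[OF vw(1) m1] vx_closed[OF vw(2) m2] vx_closed[OF vw(2) m3]
      vx_closed[OF vw(1) sv] ed_closed[OF hd(4)[OF f]]
    have cy: "c y \<in> carrier A" using c(1) yz by blast
    have "F w (h \<otimes>\<^bsub>H\<^esub> \<gamma> f) = c z \<otimes>\<^bsub>A\<^esub> vx w (inv\<^bsub>H\<^esub> (k z) \<otimes>\<^bsub>H\<^esub> (h \<otimes>\<^bsub>H\<^esub> \<gamma> f))"
      by (simp add: F_def z_def)
    also have "\<dots> = c y \<otimes>\<^bsub>A\<^esub> (vx v (inv\<^bsub>H\<^esub> (k y) \<otimes>\<^bsub>H\<^esub> l a) \<otimes>\<^bsub>A\<^esub> (ed f \<otimes>\<^bsub>A\<^esub>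
        (vx w (inv\<^bsub>H\<^esub> (l a \<otimes>\<^bsub>H\<^esub> \<gamma> f) \<otimes>\<^bsub>H\<^esub> k z) \<otimes>\<^bsub>A\<^esub> vx w (inv\<^bsub>H\<^esub> (k z) \<otimes>\<^bsub>H\<^esub> (h \<otimes>\<^bsub>H\<^esub> \<gamma> f)))))"
      unfolding cz labd using cl cy by (simp add: K.m_assoc)
    also have "vx w (inv\<^bsub>H\<^esub> (l a \<otimes>\<^bsub>H\<^esub> \<gamma> f) \<otimes>\<^bsub>H\<^esub> k z) \<otimes>\<^bsub>A\<^esub> vx w (inv\<^bsub>H\<^esub> (k z) \<otimes>\<^bsub>H\<^esub> (h \<otimes>\<^bsub>H\<^esub> \<gamma> f)) =
        vx w (inv\<^bsub>H\<^esub> \<gamma> f \<otimes>\<^bsub>H\<^esub> s \<otimes>\<^bsub>H\<^esub> \<gamma> f)"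
      using vx_mult[OF vw(2) m2 m3] by (simp only: e1)
    also have "ed f \<otimes>\<^bsub>A\<^esub> vx w (inv\<^bsub>H\<^esub> \<gamma> f \<otimes>\<^bsub>H\<^esub> s \<otimes>\<^bsub>H\<^esub> \<gamma> f) = vx v s \<otimes>\<^bsub>A\<^esub> ed f"
      by (rule conj)
    also have "vx v (inv\<^bsub>H\<^esub> (k y) \<otimes>\<^bsub>H\<^esub> l a) \<otimes>\<^bsub>A\<^esub> (vx v s \<otimes>\<^bsub>A\<^esub> ed f) =
        vx v (inv\<^bsub>H\<^esub> (k y) \<otimes>\<^bsub>H\<^esub> h) \<otimes>\<^bsub>A\<^esub> ed f"
      using vx_mult[OF vw(1) m1 sv] cl by (simp add: e2 K.m_assoc)
    also have "c y \<otimes>\<^bsub>A\<^esub> (vx v (inv\<^bsub>H\<^esub> (k y) \<otimes>\<^bsub>H\<^esub> h) \<otimes>\<^bsub>A\<^esub> ed f) = F v h \<otimes>\<^bsub>A\<^esub> ed f"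
      using vx_closed[OF vw(1) quot[OF vw(1) h]] cy cl by (simp add: F_def y_def K.m_assoc)
    finally show ?thesis by (simp only: v_def w_def)
  qed
  have F_arc: "F (head qgraph r) (h \<otimes>\<^bsub>H\<^esub> gam r) = F (tail X r) h \<otimes>\<^bsub>A\<^esub> ed r"
    if r: "r \<in> reps" and h: "h \<in> carrier H" for r h
    using r
  proof (cases rule: reps_cases)
    case 1
    then show ?thesis using F_pos[OF 1(1) h] by (simp del: qgraph_simps(4))
  next
    case (2 f)
    then have rf: "qrev r = f" "qrev f = r" "\<gamma> f \<in> carrier H" using qrev_flip \<gamma> by auto
    have ht: "head qgraph r = tail X f" "tail X r = head qgraph f"
      using reps_head[OF r] reps_head[OF hd(4)[OF 2(1)]] rf by auto
    have "F (head qgraph f) h = F (tail X f) (h \<otimes>\<^bsub>H\<^esub> inv\<^bsub>H\<^esub> \<gamma> f) \<otimes>\<^bsub>A\<^esub> ed f"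
      using F_pos[OF 2(1), of "h \<otimes>\<^bsub>H\<^esub> inv\<^bsub>H\<^esub> \<gamma> f"] h rf by (simp add: H.m_assoc del: qgraph_simps(4))
    moreover have "ed f \<otimes>\<^bsub>A\<^esub> ed r = \<one>\<^bsub>A\<^esub>" using ed_qrev[OF hd(4)[OF 2(1)]] rf by simp
    ultimately show ?thesis
      using F_closed[OF P_tail[OF 2(1)], of "h \<otimes>\<^bsub>H\<^esub> inv\<^bsub>H\<^esub> \<gamma> f"] ed_closed[OF r]
        ed_closed[OF hd(4)[OF 2(1)]] h rf 2 ht
      by (simp add: K.m_assoc del: qgraph_simps(4))
  qed
  \<comment> \<open>On arcs of \<open>qtree\<close> both \<open>gam\<close> and the letter are
    trivial, so a single function serves all vertices.\<close>
  have F_eq: "F v h = F x0 h" if "v \<in> C" and h: "h \<in> carrier H" for v h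
  proof (rule wf_digraph.connected_induct[OF wf_qtree connected_qtree, of x0 "\<lambda>v. F v h = F x0 h"])
    fix r assume "r \<in> arcs (qgraph\<lparr>arcs := qtree\<rparr>)"
    then have r: "r \<in> qtree" by simp
    have "ed r = \<one>\<^bsub>A\<^esub>" using K.t_mtree[of r] r by simp
    then have "F (head qgraph r) h = F (tail X r) h"
      using F_arc[OF gam_tree(1)[OF r] h] gam_tree(2)[OF r] h F_closed[of "tail X r" h] r
      by (simp add: qtree_def)
    then show "F (tail (qgraph\<lparr>arcs := qtree\<rparr>) r) h = F x0 h \<longleftrightarrow>
        F (head (qgraph\<lparr>arcs := qtree\<rparr>) r) h = F x0 h"
      by (simp del: qgraph_simps(4))
  qed (use that x0 in auto)
  have "F x0 (h \<otimes>\<^bsub>H\<^esub> qval x) = F x0 h \<otimes>\<^bsub>A\<^esub> K.gval x" if h: "h \<in> carrier H" and x: "x \<in> qgens" for h x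
  proof (cases x)
    case (Vtx v s)
    then have vs: "v \<in> C" "s \<in> Stab v" using x by auto
    then show ?thesis
      using F_stab[OF vs(1) h vs(2)] F_eq[OF vs(1)] h Vtx Stab_carrier by (simp add: qval_def)
  next
    case (Edg r)
    then have r: "r \<in> reps" using x by simp
    have "head qgraph r \<in> C" using reps_head[OF r] reps_tail[OF qrev_facts(1)[OF r]] by simp
    then show ?thesis
      using F_arc[OF r h] F_eq[of "head qgraph r" "h \<otimes>\<^bsub>H\<^esub> gam r"] F_eq[OF reps_tail[OF r] h] h r Edg
      by (simp add: qval_def del: qgraph_simps(4))
  qed
  then show ?thesis using F_closed[OF x0] by (intro exI[of _ "F x0"]) blast
qed

lemma class_val_qval:
  "w \<in> words qgens \<Longrightarrow> H.class_val qval (word_class qgens qrels w) = wval H qval w"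
  using qval_closed qval_relator by (rule H.class_val_word_class)

text \<open>Injectivity: \<open>F\<close> turns right multiplication by the value of a word into
  right multiplication by its class, so the value determines the class. Surjectivity: the image
  contains the stabilizers of the vertices in \<open>C\<close> and all \<open>gam r\<close>, and the
  translates of \<open>C\<close> by the image exhaust the connected graph \<open>X\<close>.\<close>

lemma qval_iso: "H.class_val qval \<in> iso A H"
proof -
  let ?\<phi> = "H.class_val qval"
  define \<kappa> where "\<kappa> = K.gval"
  have hom: "?\<phi> \<in> hom A H" using qval_closed qval_relator by (rule H.class_val_hom)
  note val = class_val_qval
  have cls: "word_class qgens qrels w = wval A \<kappa> w" if "w \<in> words qgens" for w
    using K.ident_wval[of w] that by (simp add: fg_qdec \<kappa>_def)
  have gval: "\<kappa> x \<in> carrier A" if "x \<in> qgens" for x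
    using K.gval_in[of x] that by (simp add: fg_qdec \<kappa>_def)
  obtain F where F: "\<And>h. h \<in> carrier H \<Longrightarrow> F h \<in> carrier A"
    "\<And>h x. h \<in> carrier H \<Longrightarrow> x \<in> qgens \<Longrightarrow> F (h \<otimes>\<^bsub>H\<^esub> qval x) = F h \<otimes>\<^bsub>A\<^esub> \<kappa> x"
    using section_exists unfolding \<kappa>_def by blast
  have F_word: "F (h \<otimes>\<^bsub>H\<^esub> wval H qval w) = F h \<otimes>\<^bsub>A\<^esub> wval A \<kappa> w"
    if "h \<in> carrier H" "w \<in> words qgens" for h w
    using that
  proof (induction w arbitrary: h)
    case Nil
    then show ?case using F by simp
  next
    case (Cons l w)
    obtain x b where l: "l = (x, b)" by force
    then have x: "x \<in> qgens" and w: "w \<in> words qgens" using Cons.prems by auto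
    have cl: "qval x \<in> carrier H" "wval H qval w \<in> carrier H" "wval A \<kappa> w \<in> carrier A"
      using x w qval_closed gval by (auto intro!: H.wval_closed[of _ qgens] K.wval_closed[of _ qgens])
    have "F h = F (h \<otimes>\<^bsub>H\<^esub> inv\<^bsub>H\<^esub> qval x) \<otimes>\<^bsub>A\<^esub> \<kappa> x"
      using F(2)[of "h \<otimes>\<^bsub>H\<^esub> inv\<^bsub>H\<^esub> qval x" x] x cl Cons.prems by (simp add: H.m_assoc)
    then have "F (h \<otimes>\<^bsub>H\<^esub> inv\<^bsub>H\<^esub> qval x) = F h \<otimes>\<^bsub>A\<^esub> inv\<^bsub>A\<^esub> \<kappa> x"
      using F(1) gval[OF x] cl Cons.prems by (simp add: K.m_assoc)
    then show ?case
      using Cons.IH[of "h \<otimes>\<^bsub>H\<^esub> (if b then qval x else inv\<^bsub>H\<^esub> qval x)"] Cons.prems F x w cl gval l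
      by (cases b) (simp_all add: H.m_assoc K.m_assoc)
  qed
  have inj: "inj_on ?\<phi> (carrier A)"
  proof (rule inj_onI)
    fix a b assume ab: "a \<in> carrier A" "b \<in> carrier A" "?\<phi> a = ?\<phi> b"
    then obtain u v where u: "u \<in> words qgens" "a = word_class qgens qrels u"
      and v: "v \<in> words qgens" "b = word_class qgens qrels v"
      by (auto simp: carrier_presented_group)
    then have "F \<one>\<^bsub>H\<^esub> \<otimes>\<^bsub>A\<^esub> a = F \<one>\<^bsub>H\<^esub> \<otimes>\<^bsub>A\<^esub> b"
      using F_word[of "\<one>\<^bsub>H\<^esub>" u] F_word[of "\<one>\<^bsub>H\<^esub>" v] ab(3) val cls by simp
    then show "a = b" using ab F(1)[of "\<one>\<^bsub>H\<^esub>"] by simp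
  qed
  interpret h: group_hom A H ?\<phi>
    using hom by unfold_locales
  let ?S = "?\<phi> ` carrier A"
  have S: "subgroup ?S H" by (rule h.img_is_subgroup)
  have S_gen: "qval x \<in> ?S" if "x \<in> qgens" for x
  proof -
    have "qval x \<in> carrier H" using qval_closed that by auto
    then have "?\<phi> (word_class qgens qrels [(x, True)]) = qval x" using val[of "[(x, True)]"] that by simp
    moreover have "word_class qgens qrels [(x, True)] \<in> carrier A"
      using that by (simp add: carrier_presented_group)
    ultimately show ?thesis by (metis imageI)
  qed
  have S_stab: "h \<in> ?S" if "h \<in> Stab v" "v \<in> C" for h v
    using S_gen[of "Vtx v h"] that by (simp add: qval_def)
  have S_gam: "gam r \<in> ?S" if "r \<in> reps" for r
    using S_gen[of "Edg r"] that by (simp add: qval_def)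
  have S_cl: "h \<in> carrier H" if "h \<in> ?S" for h using subgroup.mem_carrier[OF S that] .
  have CV: "v \<in> verts X" if "v \<in> C" for v using C_sub that by blast
  \<comment> \<open>An element that takes a vertex of \<open>C\<close> to the same place as an
    element of the image differs from it by a stabilizer, which is in the image.\<close>
  have absorb: "h \<in> ?S \<and> v = w" if "k \<in> ?S" "v \<in> C" "w \<in> C" "h \<in> carrier H" "av h w = av k v" for h k v w
  proof -
    have kH: "k \<in> carrier H" using S_cl that by blast
    have "av (inv\<^bsub>H\<^esub> k \<otimes>\<^bsub>H\<^esub> h) w = v" using that kH CV by (simp add: av_mult)
    then have vw: "v = w" using C_inj[of w "inv\<^bsub>H\<^esub> k \<otimes>\<^bsub>H\<^esub> h"] that kH by simp
    then have "inv\<^bsub>H\<^esub> k \<otimes>\<^bsub>H\<^esub> h \<in> ?S" using Stab_quot[of h k v] that kH CV S_stab by auto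
    then have "k \<otimes>\<^bsub>H\<^esub> (inv\<^bsub>H\<^esub> k \<otimes>\<^bsub>H\<^esub> h) \<in> ?S" using subgroup.m_closed[OF S] that(1) by blast
    then show ?thesis using kH that vw by (simp add: H.mult_inv_cancel)
  qed
  define Q where "Q y \<longleftrightarrow> (\<exists>k\<in>?S. \<exists>v\<in>C. y = av k v)" for y
  have step: "Q (head X f)" if f: "f \<in> arcs X" "Q (tail X f)" for f
  proof -
    have "\<exists>l\<in>carrier H. \<exists>r\<in>reps. f = ae l r"
    proof (cases "f \<in> Or")
      case True
      then show ?thesis using P_ex[OF f(1)] by (auto simp: reps_def)
    next
      case False
      then obtain l p where l: "l \<in> carrier H" "p \<in> P" "rv f = ae l p"
        using P_ex[of "rv f"] f Or_rv[of f] by auto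
      then have g: "\<gamma> p \<in> carrier H" "p \<in> arcs X" using \<gamma> P_arcs by auto
      have "f = rv (ae l p)" using l(3) by (metis arev_arev)
      also have "\<dots> = ae (l \<otimes>\<^bsub>H\<^esub> \<gamma> p) (flip p)"
        using l g by (simp add: flip_def ae_mult ae_rv)
      finally show ?thesis using l g by (auto simp: reps_def intro!: bexI[of _ "l \<otimes>\<^bsub>H\<^esub> \<gamma> p"])
    qed
    then obtain l r where l: "l \<in> carrier H" "r \<in> reps" "f = ae l r" by blast
    obtain k v where k: "k \<in> ?S" "v \<in> C" "tail X f = av k v" using f(2) Q_def by auto
    have lS: "l \<in> ?S" using absorb[of k v "tail X r" l] k l reps_tail[OF l(2)] by simp
    have w: "head qgraph r \<in> C" using reps_head[OF l(2)] reps_tail[OF qrev_facts(1)[OF l(2)]] by simp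
    have "head X f = av (l \<otimes>\<^bsub>H\<^esub> gam r) (head qgraph r)"
      using l by (simp add: av_mult)
    moreover have "l \<otimes>\<^bsub>H\<^esub> gam r \<in> ?S" using subgroup.m_closed[OF S lS S_gam[OF l(2)]] .
    ultimately show ?thesis unfolding Q_def using w by blast
  qed
  have "Q y" if "y \<in> verts X" for y
  proof (rule connected_induct[OF connected, of x0 Q])
    show "x0 \<in> verts X" using x0 CV by blast
    have "x0 = av \<one>\<^bsub>H\<^esub> x0" using x0 CV by simp
    then show "Q x0" unfolding Q_def using x0 subgroup.one_closed[OF S] by blast
    show "Q (tail X f) \<longleftrightarrow> Q (head X f)" if "f \<in> arcs X" for f
      using step[of f] step[of "rv f"] that by auto
  qed (rule that)
  then have "h \<in> ?S" if "h \<in> carrier H" for h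
    using absorb[of _ _ x0 h] that x0 CV av_closed[OF that] unfolding Q_def by blast
  then have "?S = carrier H" using S_cl by blast
  then show ?thesis using hom inj by (simp add: iso_def bij_betw_def)
qed

lemma vertex_group_qdec:
  assumes "v \<in> C" shows "vertex_group (qdec (H.class_val qval)) v = Stab v"
proof -
  have "vertex_element (qdec (H.class_val qval)) v h = h" if "h \<in> Stab v" for h
    using class_val_qval[of "[(Vtx v h, True)]"] that assms
    by (simp add: vertex_element_def fg_qdec qval_def Stab_carrier)
  then show ?thesis by (simp add: vertex_group_def)
qed

end

text \<open>Vertices of the quotient are lifts to \<open>X\<close>, so the vertex groups are
  stabilizers on the nose and not only up to conjugation.\<close>

theorem (in tree_action) quotient_decomposition:
  "\<exists>\<Phi> :: ('b, 'c, 'g, 'g, 'g) decomposition. graph_of_groups_decomposition H \<Phi> \<and>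
    verts (base \<Phi>) \<subseteq> verts X \<and> (\<forall>v\<in>verts (base \<Phi>). vertex_group \<Phi> v = Stab v)"
proof -
  obtain x0 C P \<gamma> where "orbit_reps X rv H av ae Or x0 C P \<gamma>" using orbit_reps_exist by blast
  then interpret orbit_reps X rv H av ae Or x0 C P \<gamma> .
  show ?thesis
    using qdec_decomposition[OF qval_iso] vertex_group_qdec C_sub
    by (intro exI[of _ "qdec (H.class_val qval)"]) simp
qed

section \<open>Stabilizers in the Bass-Serre tree of a decomposition\<close>

context decomposed_group
begin

lemma conjugate_iff: "h \<in> conjugate W g K \<longleftrightarrow> (\<exists>b\<in>K. h = g \<otimes> b \<otimes> inv g)"
  by (auto simp: conjugate_def l_coset_def r_coset_def)

text \<open>The action does not change the base arc in the name of an arc, so an orientation of the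
  base graph lifts to an invariant one.\<close>

lemma bass_serre_action:
  assumes K: "subgroup K W"
  shows "\<exists>Or. tree_action bass_serre bs_rev (W\<lparr>carrier := K\<rparr>) bs_vact bs_eact Or"
proof -
  interpret B: serre_tree bass_serre bs_rev by (rule serre_tree_bass_serre)
  have KW: "h \<in> carrier W" if "h \<in> K" for h using subgroup.mem_carrier[OF K that] .
  \<comment> \<open>\<open>e\<close> and its reverse give the same set, hence the same
    choice.\<close>
  define pos where "pos e = (SOME x. x \<in> {e, arev \<Delta> e})" for e
  have pos: "pos (arev \<Delta> e) = pos e" "pos e \<in> {e, arev \<Delta> e}" for e
  proof -
    show "pos (arev \<Delta> e) = pos e" by (simp add: pos_def insert_commute)
    show "pos e \<in> {e, arev \<Delta> e}" unfolding pos_def by (rule someI[of _ e]) simp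
  qed
  have pos_iff: "pos (arev \<Delta> e) = arev \<Delta> e \<longleftrightarrow> pos e \<noteq> e" if "e \<in> arcs (base \<Delta>)" for e
    using pos(1)[of e] pos(2)[of e] arev_neq[OF that] by auto
  have "tree_action bass_serre bs_rev (W\<lparr>carrier := K\<rparr>) bs_vact bs_eact {f. pos (snd f) = snd f}"
  proof (intro tree_action.intro tree_action_axioms.intro)
    show "serre_tree bass_serre bs_rev" by (rule serre_tree_bass_serre)
    show "group (W\<lparr>carrier := K\<rparr>)" using subgroup.subgroup_is_group[OF K group_axioms] .
  qed (use KW in \<open>auto elim!: bs_vertsE bs_arcsE simp: bs_vact_bsv bs_eact_bse bs_rev_bse tail_bse
        m_assoc pos_iff\<close>)
  then show ?thesis by blast
qed

lemma bs_vact_fixed: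
  assumes "h \<in> carrier W" "g \<in> carrier W" "v \<in> verts (base \<Delta>)"
  shows "bs_vact h (bsv g v) = bsv g v \<longleftrightarrow> h \<in> conjugate W g (vertex_group \<Delta> v)"
proof -
  have sub: "b \<in> carrier W" if "b \<in> vertex_group \<Delta> v" for b
    using subgroup.mem_carrier[OF vertex_group_subgroup[OF assms(3)] that] .
  have "bs_vact h (bsv g v) = bsv g v \<longleftrightarrow> (\<exists>b\<in>vertex_group \<Delta> v. h \<otimes> g = g \<otimes> b)"
    using bsv_eq_iff[of g "h \<otimes> g" v v] assms by (metis bs_vact_bsv m_closed)
  also have "\<dots> \<longleftrightarrow> (\<exists>b\<in>vertex_group \<Delta> v. h = g \<otimes> b \<otimes> inv g)"
    using assms sub inv_solve_right by (metis m_closed)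
  finally show ?thesis by (simp add: conjugate_iff)
qed

lemma bs_eact_fixed:
  assumes "h \<in> carrier W" "g \<in> carrier W" "e \<in> arcs (base \<Delta>)"
  shows "bs_eact h (bse g e) = bse g e \<longleftrightarrow> h \<in> conjugate W g (arc_stab e)"
proof -
  have sub: "b \<in> carrier W" if "b \<in> arc_stab e" for b
    using subgroup.mem_carrier[OF arc_stab_subgroup[OF assms(3)] that] .
  have "bs_eact h (bse g e) = bse g e \<longleftrightarrow> (\<exists>b\<in>arc_stab e. h \<otimes> g = g \<otimes> b)"
    using bse_eq_iff[of g "h \<otimes> g" e e] assms by (metis bs_eact_bse m_closed)
  also have "\<dots> \<longleftrightarrow> (\<exists>b\<in>arc_stab e. h = g \<otimes> b \<otimes> inv g)"
    using assms sub inv_solve_right by (metis m_closed)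
  finally show ?thesis by (simp add: conjugate_iff)
qed

text \<open>An arc leaving \<open>bsv \<one> V\<close> has the form \<open>bse g e\<close> with
  \<open>g\<close> in the coset of \<one>, that is, in the vertex group; this is why the conjugator
  can be taken there.\<close>

lemma vertex_stabilizers_meet_in_edge:
  assumes V: "V \<in> verts (base \<Delta>)" and w: "w \<in> carrier W" "V' \<in> verts (base \<Delta>)"
    and ne: "bsv w V' \<noteq> bsv \<one> V"
  shows "\<exists>v\<in>vertex_group \<Delta> V. \<exists>e\<in>adjacent_edges \<Delta> V.
    vertex_group \<Delta> V \<inter> conjugate W w (vertex_group \<Delta> V') \<subseteq> conjugate W v (edge_group \<Delta> e)"
proof -
  have "subgroup (carrier W) W" by (rule subgroup_self)
  then obtain Or where "tree_action bass_serre bs_rev (W\<lparr>carrier := carrier W\<rparr>) bs_vact bs_eact Or"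
    using bass_serre_action by blast
  then interpret T: tree_action bass_serre bs_rev "W\<lparr>carrier := carrier W\<rparr>" bs_vact bs_eact Or .
  obtain f where f: "f \<in> arcs bass_serre" "tail bass_serre f = bsv \<one> V"
    "\<forall>h\<in>carrier W. bs_vact h (bsv \<one> V) = bsv \<one> V \<longrightarrow> bs_vact h (bsv w V') = bsv w V' \<longrightarrow> bs_eact h f = f"
    using T.fixed_arc[of "bsv \<one> V" "bsv w V'"] V w ne by auto
  obtain g e where g: "g \<in> carrier W" "e \<in> arcs (base \<Delta>)" "f = bse g e" using bs_arcsE[OF f(1)] by blast
  have "bsv \<one> V = bsv g (tail (base \<Delta>) e)" using f(2) g by (simp add: tail_bse)
  then have tail: "tail (base \<Delta>) e = V" "g \<in> vertex_group \<Delta> V"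
    using bsv_eq_iff[of \<one> g V "tail (base \<Delta>) e"] g V
      subgroup.mem_carrier[OF vertex_group_subgroup[OF V]] by auto
  have sub: "h \<in> carrier W" if "h \<in> vertex_group \<Delta> V" for h
    using subgroup.mem_carrier[OF vertex_group_subgroup[OF V] that] .
  have one: "conjugate W \<one> (vertex_group \<Delta> V) = vertex_group \<Delta> V"
    using sub by (force simp: conjugate_iff)
  have "vertex_group \<Delta> V \<inter> conjugate W w (vertex_group \<Delta> V') \<subseteq> conjugate W g (edge_group \<Delta> (arev \<Delta> e))"
  proof
    fix h assume h: "h \<in> vertex_group \<Delta> V \<inter> conjugate W w (vertex_group \<Delta> V')"
    then have hW: "h \<in> carrier W" using sub by blast
    then have "bs_eact h f = f"
      using f(3) h bs_vact_fixed[of h \<one> V] bs_vact_fixed[of h w V'] one V w by auto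
    then show "h \<in> conjugate W g (edge_group \<Delta> (arev \<Delta> e))"
      using bs_eact_fixed[OF hW g(1,2)] g by (simp add: arc_stab_def)
  qed
  \<comment> \<open>\<open>e\<close> starts at \<open>V\<close>, whereas
    \<open>adjacent_edges\<close> and \<open>edge_group\<close> refer to heads.\<close>
  moreover have "arev \<Delta> e \<in> adjacent_edges \<Delta> V" using g tail by (simp add: adjacent_edges_def)
  ultimately show ?thesis using tail by blast
qed

end

theorem theorem2:
  fixes W :: "'g monoid" and S :: "'g set"
    and \<Lambda> :: "('v, 'e, 'x, 'y, 'g) decomposition"
    and \<Psi> :: "('u, 'f, 'p, 'q, 'g) decomposition"
  assumes "coxeter_system W S" and "finite S"
    and "graph_of_groups_decomposition W \<Lambda>"
    and "graph_of_groups_decomposition W \<Psi>" and "reduced_graph_of_groups \<Psi>"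
    and "\<forall>U\<in>verts (base \<Psi>). \<exists>V\<in>verts (base \<Lambda>). \<exists>w\<in>carrier W.
      vertex_group \<Psi> U \<subseteq> conjugate W w (vertex_group \<Lambda> V)"
  shows "\<forall>V\<in>verts (base \<Lambda>). \<exists>\<Phi> :: ('g \<times> 'u, 'g \<times> 'f, 'g, 'g, 'g) decomposition.
    graph_of_groups_decomposition (W\<lparr>carrier := vertex_group \<Lambda> V\<rparr>) \<Phi> \<and>
    (\<forall>X\<in>verts (base \<Phi>).
      (\<exists>U\<in>verts (base \<Psi>). \<exists>w\<in>carrier W.
        vertex_group \<Phi> X = conjugate W w (vertex_group \<Psi> U)) \<or>
      (\<exists>v\<in>vertex_group \<Lambda> V. \<exists>E\<in>adjacent_edges \<Lambda> V.
        vertex_group \<Phi> X \<subseteq> conjugate W v (edge_group \<Lambda> E)))"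
proof
  interpret W: group W using assms(1) by (simp add: coxeter_system_def)
  interpret L: decomposed_group W \<Lambda> by unfold_locales (rule assms(3))
  interpret P: decomposed_group W \<Psi> by unfold_locales (rule assms(4))
  fix V assume V: "V \<in> verts (base \<Lambda>)"
  let ?H = "vertex_group \<Lambda> V"
  have H: "subgroup ?H W" by (rule L.vertex_group_subgroup[OF V])
  obtain Or where "tree_action P.bass_serre P.bs_rev (W\<lparr>carrier := ?H\<rparr>) P.bs_vact P.bs_eact Or"
    using P.bass_serre_action[OF H] by blast
  then interpret T: tree_action P.bass_serre P.bs_rev "W\<lparr>carrier := ?H\<rparr>" P.bs_vact P.bs_eact Or .
  obtain \<Phi> :: "('g \<times> 'u, 'g \<times> 'f, 'g, 'g, 'g) decomposition"
    where \<Phi>: "graph_of_groups_decomposition (W\<lparr>carrier := ?H\<rparr>) \<Phi>"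
      "verts (base \<Phi>) \<subseteq> verts P.bass_serre" "\<forall>v\<in>verts (base \<Phi>). vertex_group \<Phi> v = T.Stab v"
    using T.quotient_decomposition by blast
  have "(\<exists>U\<in>verts (base \<Psi>). \<exists>w\<in>carrier W. vertex_group \<Phi> X = conjugate W w (vertex_group \<Psi> U)) \<or>
      (\<exists>v\<in>?H. \<exists>E\<in>adjacent_edges \<Lambda> V. vertex_group \<Phi> X \<subseteq> conjugate W v (edge_group \<Lambda> E))"
    if X: "X \<in> verts (base \<Phi>)" for X
  proof -
    have "X \<in> verts P.bass_serre" using X \<Phi>(2) by blast
    then obtain g U where g: "g \<in> carrier W" "U \<in> verts (base \<Psi>)" "X = P.bsv g U"
      by (rule P.bs_vertsE)
    let ?K = "conjugate W g (vertex_group \<Psi> U)"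
    have HW: "h \<in> carrier W" if "h \<in> ?H" for h using subgroup.mem_carrier[OF H that] .
    have UW: "vertex_group \<Psi> U \<subseteq> carrier W"
      using subgroup.subset[OF P.vertex_group_subgroup[OF g(2)]] .
    have XK: "vertex_group \<Phi> X = ?H \<inter> ?K"
      using \<Phi>(3) X g P.bs_vact_fixed HW by (auto simp: T.Stab_def)
    obtain V' w where w: "V' \<in> verts (base \<Lambda>)" "w \<in> carrier W"
      "vertex_group \<Psi> U \<subseteq> conjugate W w (vertex_group \<Lambda> V')"
      using assms(6) g(2) by blast
    have V'W: "vertex_group \<Lambda> V' \<subseteq> carrier W"
      using subgroup.subset[OF L.vertex_group_subgroup[OF w(1)]] .
    \<comment> \<open>Thus \<open>?K\<close> fixes the vertex
      \<open>L.bsv (g \<otimes> w) V'\<close>, which the case distinction compares with the base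
      vertex.\<close>
    have KV': "?K \<subseteq> conjugate W (g \<otimes>\<^bsub>W\<^esub> w) (vertex_group \<Lambda> V')"
    proof
      fix h assume "h \<in> ?K"
      then obtain b where b: "b \<in> vertex_group \<Psi> U" "h = g \<otimes>\<^bsub>W\<^esub> b \<otimes>\<^bsub>W\<^esub> inv\<^bsub>W\<^esub> g"
        using L.conjugate_iff by auto
      then obtain c where c: "c \<in> vertex_group \<Lambda> V'" "b = w \<otimes>\<^bsub>W\<^esub> c \<otimes>\<^bsub>W\<^esub> inv\<^bsub>W\<^esub> w"
        using L.conjugate_iff w by blast
      have "c \<in> carrier W" using c V'W by blast
      then have "h = g \<otimes>\<^bsub>W\<^esub> w \<otimes>\<^bsub>W\<^esub> c \<otimes>\<^bsub>W\<^esub> inv\<^bsub>W\<^esub> (g \<otimes>\<^bsub>W\<^esub> w)"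
        using b(2) c(2) g w by (simp add: W.m_assoc W.inv_mult_group)
      then show "h \<in> conjugate W (g \<otimes>\<^bsub>W\<^esub> w) (vertex_group \<Lambda> V')"
        using L.conjugate_iff c by auto
    qed
    show ?thesis
    proof (cases "L.bsv (g \<otimes>\<^bsub>W\<^esub> w) V' = L.bsv \<one>\<^bsub>W\<^esub> V")
      case True
      \<comment> \<open>Equal vertices have equal stabilizers in \<open>W\<close>, and that of
        \<open>L.bsv \<one> V\<close> is \<open>?H\<close>.\<close>
      have "?K \<subseteq> ?H"
      proof
        fix h assume h: "h \<in> ?K"
        then have h': "h \<in> conjugate W (g \<otimes>\<^bsub>W\<^esub> w) (vertex_group \<Lambda> V')" using KV' by blast
        have hW: "h \<in> carrier W" using h g UW by (auto simp: L.conjugate_iff)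
        then have "h \<in> conjugate W \<one>\<^bsub>W\<^esub> ?H"
          using h' True L.bs_vact_fixed[of h "g \<otimes>\<^bsub>W\<^esub> w" V'] L.bs_vact_fixed[of h "\<one>\<^bsub>W\<^esub>" V] V g w
          by simp
        then show "h \<in> ?H" using HW by (auto simp: L.conjugate_iff)
      qed
      then have "vertex_group \<Phi> X = ?K" using XK by blast
      then show ?thesis using g by blast
    next
      case False
      then obtain v E where "v \<in> ?H" "E \<in> adjacent_edges \<Lambda> V"
        "?H \<inter> conjugate W (g \<otimes>\<^bsub>W\<^esub> w) (vertex_group \<Lambda> V') \<subseteq> conjugate W v (edge_group \<Lambda> E)"
        using L.vertex_stabilizers_meet_in_edge[OF V _ w(1) False] g w by auto
      then show ?thesis using XK KV' by blast
    qed
  qed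
  then show "\<exists>\<Phi> :: ('g \<times> 'u, 'g \<times> 'f, 'g, 'g, 'g) decomposition.
    graph_of_groups_decomposition (W\<lparr>carrier := ?H\<rparr>) \<Phi> \<and>
    (\<forall>X\<in>verts (base \<Phi>).
      (\<exists>U\<in>verts (base \<Psi>). \<exists>w\<in>carrier W.
        vertex_group \<Phi> X = conjugate W w (vertex_group \<Psi> U)) \<or>
      (\<exists>v\<in>?H. \<exists>E\<in>adjacent_edges \<Lambda> V.
        vertex_group \<Phi> X \<subseteq> conjugate W v (edge_group \<Lambda> E)))"
    using \<Phi>(1) by blast
qed

end
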